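(* Let $q$ be even and let $G$ be the Sylow $p$-subgroup ($p=2$) of $O^-(2m+2,q)$ generated by $G_1$ and $L_1$, where $G_1$ and $L_1$ are as defined in the context. Then $\mathbb{F}_q(V)^G$ is generated by $$x_1,\ N(x_2),\ldots,N(x_m),\ N(x_{m+1})^2+N(x_m)N(x_{m+1}),\ N(x_{m+2}),\ h_1,\ldots,h_m.$$
   Context: Here $q$ is a power of $2$, $m$ is a positive integer, $V=\mathbb{F}_q^{2m+2}$ (column vectors), $x_1,\ldots,x_{2m+2}$ is the dual basis of the standard basis, $\mathbb{F}_q[V]=\mathbb{F}_q[x_1,\ldots,x_{2m+2}]$, and $\mathbb{F}_q(V)$ is its fraction field; matrix groups act by $(g\cdot f)(v)=f(g^{-1}v)$. Fix $a\in\mathbb{F}_q$ such that $T^2+T+a$ is irreducible in $\mathbb{F}_q[T]$. $O^-(2m+2,q)$ is the group of invertible matrices preserving the quadratic form $Q(v)=\sum_{i=1}^{m}\alpha_{2m+3-i}\alpha_i+\alpha_{m+1}^2+\alpha_{m+1}\alpha_{m+2}+a\alpha_{m+2}^2$ for $v=(\alpha_1,\ldots,\alpha_{2m+2})^T$. $U(n,\mathbb{F}_q)$ denotes the group of lower triangular $n\times n$ matrices over $\mathbb{F}_q$ with ones on the diagonal, and $J_n$ the $n\times n$ matrix with ones on the antidiagonal and zeros elsewhere. Let $\mathfrak{G}^{+}_{J_m,J_2}=\{M\in U(2m+2,\mathbb{F}_q): M^TYM=Y\}$ with $Y=\begin{pmatrix}0&0&J_m\\ 0&J_2&0\\ J_m&0&0\end{pmatrix}$.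 Its elements are written in blocks $M=\begin{pmatrix}A&0&0\\ B&F&0\\ C&D&E\end{pmatrix}$ with $A,E\in U(m,\mathbb{F}_q)$, $F\in U(2,\mathbb{F}_q)$, and $S$ is defined by $C=J_m(A^{-1})^TS$; the entries of $B$ and $S$ are $b_{ij}$ and $s_{ij}$. $G_1$ is the group formed by the elements of $\mathfrak{G}^{+}_{J_m,J_2}$ that satisfy $s_{ii}=b_{1i}^2+b_{1i}b_{2i}+b_{2i}^2$ for $i=1,\ldots,m$. Further, $L_1=\begin{pmatrix}I_m&0&0\\ 0&J_2'&0\\ 0&0&I_m\end{pmatrix}$ with $J_2'=\begin{pmatrix}1&1\\ 0&1\end{pmatrix}$. $N(x_i)$ is the $G_1$-orbit product of $x_i$, i.e. the product of all elements of the orbit $G_1\cdot x_i$. The polynomials $h_k$ are $h_1=\sum_{i=1}^{m}x_{2m+3-i}x_i+x_{m+1}^2+x_{m+1}x_{m+2}+ax_{m+2}^2$ and, for $k\ge 2$, $h_k=\sum_{i=1}^{m+1}\left(x_{2m+3-i}^{q^{k-1}}x_i+x_{2m+3-i}x_i^{q^{k-1}}\right)$.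
   Formalization: Corrected: the quadratic generator has N(x_{m+2}) in place of N(x_m), as the printed one is not G-invariant; s_ii uses a·b_{2i}^2 instead of b_{2i}^2; and G_1 also requires F=I_2, without which G_1 and L_1 never generate a Sylow 2-subgroup of O^-(2m+2,q). *)

theory Defs
  imports
    "Jordan_Normal_Form.Matrix"
    "HOL-Algebra.Algebra"
    "HOL-Algebra.Algebraic_Closure_Type"
    "HOL-Library.Poly_Mapping"
begin

text \<open>
  Conventions. The finite field is a type of sort \<open>{finite, field}\<close>, and \<open>m\<close> is the parameter with
  \<open>dim V = 2 * m + 2\<close>. Variables and coordinates are numbered from 1 as in the mathematics, whereas
  \<open>$\<close> and \<open>$$\<close> count from 0, so coordinate \<open>i\<close> of a vector \<open>v\<close> is \<open>v $ (i - 1)\<close>.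
\<close>


subsection \<open>Matrix groups\<close>

definition GL :: "nat \<Rightarrow> 'a::field mat monoid" where
  "GL n = units_of (ring_mat TYPE('a) n ())"

definition minus_form :: "'b::comm_ring_1 \<Rightarrow> nat \<Rightarrow> (nat \<Rightarrow> 'b) \<Rightarrow> 'b" where
  "minus_form a m \<alpha> =
     (\<Sum>i=1..m. \<alpha> (2*m + 3 - i) * \<alpha> i) + \<alpha> (m+1) ^ 2 + \<alpha> (m+1) * \<alpha> (m+2) + a * \<alpha> (m+2) ^ 2"

definition quad_form :: "'a::field \<Rightarrow> nat \<Rightarrow> 'a vec \<Rightarrow> 'a" where
  "quad_form a m v = minus_form a m (\<lambda>i. v $ (i - 1))"

definition orth_minus :: "'a::field \<Rightarrow> nat \<Rightarrow> 'a mat monoid" where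
  "orth_minus a m = (GL (2*m+2))
     \<lparr>carrier := {M \<in> carrier (GL (2*m+2)).
        \<forall>v \<in> carrier_vec (2*m+2). quad_form a m (M *\<^sub>v v) = quad_form a m v}\<rparr>"

definition is_sylow_subgroup :: "nat \<Rightarrow> ('g, 'b) monoid_scheme \<Rightarrow> 'g set \<Rightarrow> bool" where
  "is_sylow_subgroup p K H \<longleftrightarrow> subgroup H K \<and> card H = p ^ multiplicity p (Coset.order K)"

definition lower_unitriangular :: "nat \<Rightarrow> 'a::field mat set" where
  "lower_unitriangular n =
     {M \<in> carrier_mat n n. (\<forall>i<n. M $$ (i, i) = 1) \<and> (\<forall>j<n. \<forall>i<j. M $$ (i, j) = 0)}"

definition antidiag_one :: "nat \<Rightarrow> 'a::field mat" where
  "antidiag_one n = mat n n (\<lambda>(i, j). if i + j + 1 = n then 1 else 0)"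

text \<open>The block matrix \<open>Y\<close> with blocks \<open>J\<^sub>m, J\<^sub>2, J\<^sub>m\<close> along the antidiagonal is
  \<open>antidiag_one (2 * m + 2)\<close>.\<close>

definition Gplus :: "nat \<Rightarrow> 'a::field mat set" where
  "Gplus m = {M \<in> lower_unitriangular (2*m+2).
     transpose_mat M * antidiag_one (2*m+2) * M = antidiag_one (2*m+2)}"

definition block_A :: "nat \<Rightarrow> 'a mat \<Rightarrow> 'a mat" where
  "block_A m M = mat m m (\<lambda>(i, j). M $$ (i, j))"

definition block_B :: "nat \<Rightarrow> 'a mat \<Rightarrow> 'a mat" where
  "block_B m M = mat 2 m (\<lambda>(i, j). M $$ (m + i, j))"

definition block_F :: "nat \<Rightarrow> 'a mat \<Rightarrow> 'a mat" where
  "block_F m M = mat 2 2 (\<lambda>(i, j). M $$ (m + i, m + j))"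

definition block_C :: "nat \<Rightarrow> 'a mat \<Rightarrow> 'a mat" where
  "block_C m M = mat m m (\<lambda>(i, j). M $$ (m + 2 + i, j))"

text \<open>
  For \<open>u = e\<^sub>i\<close> with \<open>i \<le> m\<close>, the form takes the value \<open>s\<^sub>i\<^sub>i + b\<^sub>1\<^sub>i\<^sup>2 + b\<^sub>1\<^sub>i b\<^sub>2\<^sub>i + a b\<^sub>2\<^sub>i\<^sup>2\<close> at \<open>M u\<close>
  and \<open>0\<close> at \<open>u\<close>; the condition on \<open>S\<close> below says that \<open>M\<close> preserves the value. In characteristic 2
  the equation defining \<open>Gplus\<close> leaves the subdiagonal entry of \<open>F\<close> free, so \<open>F = 1\<close> has to be
  demanded separately for \<open>G1\<close> to be a subgroup of the orthogonal group which together with \<open>L1\<close>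
  generates a 2-group.

  The usual printed form of the definition has no condition on \<open>F\<close> and coefficient \<open>1\<close> instead
  of \<open>a\<close> at \<open>b\<^sub>2\<^sub>i\<^sup>2\<close>. With that reading the group generated by \<open>G1\<close> and \<open>L1\<close> is never a Sylow
  2-subgroup of the orthogonal group.
\<close>

definition G1 :: "'a::field \<Rightarrow> nat \<Rightarrow> 'a mat set" where
  "G1 a m = {M \<in> Gplus m. block_F m M = 1\<^sub>m 2 \<and>
     (\<exists>S \<in> carrier_mat m m.
        block_C m M = antidiag_one m * transpose_mat (inv\<^bsub>GL m\<^esub> (block_A m M)) * S \<and>
        (\<forall>i<m. S $$ (i, i) = block_B m M $$ (0, i) ^ 2
                             + block_B m M $$ (0, i) * block_B m M $$ (1, i)
                             + a * block_B m M $$ (1, i) ^ 2))}"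

definition L1 :: "nat \<Rightarrow> 'a::field mat" where
  "L1 m = diag_block_mat [1\<^sub>m m, mat_of_rows_list 2 [[1, 1], [0, 1]], 1\<^sub>m m]"


subsection \<open>Polynomials and rational functions\<close>

text \<open>
  Polynomials live in the ring with variables indexed by all natural numbers; \<open>polys n\<close> is the
  subring in the variables \<open>1, \<dots>, n\<close> and \<open>ratfuns n\<close> its field of fractions.
\<close>

type_synonym 'a mpol = "(nat \<Rightarrow>\<^sub>0 nat) \<Rightarrow>\<^sub>0 'a"

definition Const :: "'a::field \<Rightarrow> 'a mpol" where
  "Const c = Poly_Mapping.single 0 c"

definition Var :: "nat \<Rightarrow> 'a::field mpol" where
  "Var i = Poly_Mapping.single (Poly_Mapping.single i 1) 1"

definition polys :: "nat \<Rightarrow> 'a::field mpol set" where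
  "polys n = {p. \<forall>t \<in> Poly_Mapping.keys p. Poly_Mapping.keys t \<subseteq> {1..n}}"

definition ratfuns :: "nat \<Rightarrow> 'a::field mpol fract set" where
  "ratfuns n = {Fract p r | p r. p \<in> polys n \<and> r \<in> polys n \<and> r \<noteq> 0}"

definition subst_poly :: "(nat \<Rightarrow> 'a mpol) \<Rightarrow> 'a::field mpol \<Rightarrow> 'a mpol" where
  "subst_poly \<sigma> p = (\<Sum>t \<in> Poly_Mapping.keys p.
     Const (Poly_Mapping.lookup p t) *
     (\<Prod>i \<in> Poly_Mapping.keys t. \<sigma> i ^ Poly_Mapping.lookup t i))"

text \<open>
  The rule \<open>(g \<cdot> f) v = f (g\<^sup>-\<^sup>1 v)\<close> replaces \<open>x\<^sub>i\<close> by the \<open>i\<close>-th coordinate of \<open>g\<^sup>-\<^sup>1 v\<close>. Variables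
  outside \<open>1, \<dots>, n\<close> are kept, so for \<open>g\<close> in \<open>GL n\<close> the result is an automorphism of the whole ring
  and the extension to fractions is well defined.
\<close>

definition act_poly :: "nat \<Rightarrow> 'a mat \<Rightarrow> 'a::field mpol \<Rightarrow> 'a mpol" where
  "act_poly n g = subst_poly (\<lambda>i. if i \<in> {1..n}
     then \<Sum>j=1..n. Const ((inv\<^bsub>GL n\<^esub> g) $$ (i - 1, j - 1)) * Var j else Var i)"

definition act_rat :: "nat \<Rightarrow> 'a mat \<Rightarrow> 'a::field mpol fract \<Rightarrow> 'a mpol fract" where
  "act_rat n g f =
     (THE f'. \<exists>p r. r \<noteq> 0 \<and> f = Fract p r \<and> f' = Fract (act_poly n g p) (act_poly n g r))"

definition invariant_field :: "nat \<Rightarrow> 'a mat set \<Rightarrow> 'a::field mpol fract set" where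
  "invariant_field n G = {f \<in> ratfuns n. \<forall>g \<in> G. act_rat n g f = f}"

definition field_generated_by :: "'a::field mpol fract set \<Rightarrow> 'a mpol fract set" where
  "field_generated_by H = generate_field ring_of_type_algebra (range (\<lambda>c. to_fract (Const c)) \<union> H)"

definition orbit_prod :: "nat \<Rightarrow> 'a mat set \<Rightarrow> 'a::field mpol \<Rightarrow> 'a mpol" where
  "orbit_prod n H f = \<Prod>((\<lambda>g. act_poly n g f) ` H)"

definition N :: "'a::field \<Rightarrow> nat \<Rightarrow> nat \<Rightarrow> 'a mpol" where
  "N a m i = orbit_prod (2*m+2) (G1 a m) (Var i)"

text \<open>
  \<open>L1\<close> fixes \<open>N (x\<^sub>m)\<close> and \<open>N (x\<^sub>m\<^sub>+\<^sub>2)\<close> and sends \<open>N (x\<^sub>m\<^sub>+\<^sub>1)\<close> to \<open>N (x\<^sub>m\<^sub>+\<^sub>1) + N (x\<^sub>m\<^sub>+\<^sub>2)\<close>. The invariant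
  quadratic expression, namely the product of \<open>N (x\<^sub>m\<^sub>+\<^sub>1)\<close> and its image, is therefore
  \<open>N (x\<^sub>m\<^sub>+\<^sub>1)\<^sup>2 + N (x\<^sub>m\<^sub>+\<^sub>2) N (x\<^sub>m\<^sub>+\<^sub>1)\<close>; the printed variant with \<open>N (x\<^sub>m)\<close> in place of \<open>N (x\<^sub>m\<^sub>+\<^sub>2)\<close> is not invariant.
\<close>

definition h :: "nat \<Rightarrow> 'a::field \<Rightarrow> nat \<Rightarrow> nat \<Rightarrow> 'a mpol" where
  "h q a m k = (if k = 1 then minus_form (Const a) m Var
     else \<Sum>i=1..m+1. Var (2*m+3-i) ^ (q ^ (k-1)) * Var i + Var (2*m+3-i) * Var i ^ (q ^ (k-1)))"

end

theory Submission
  imports Defs "Jordan_Normal_Form.Determinant"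
begin

text \<open>
  Let \<open>E\<close> be the field generated by the proposed generators and \<open>y\<^sub>i = x\<^sub>2\<^sub>m\<^sub>+\<^sub>3\<^sub>-\<^sub>i\<close>. Adjoin to \<open>E\<close>, in this
  order, \<open>x\<^sub>2, \<dots>, x\<^sub>m, x\<^sub>m\<^sub>+\<^sub>2, x\<^sub>m\<^sub>+\<^sub>1, y\<^sub>m, \<dots>, y\<^sub>1\<close>, which gives the field of all rational functions. (The
  variable \<open>x\<^sub>m\<^sub>+\<^sub>2\<close> precedes \<open>x\<^sub>m\<^sub>+\<^sub>1\<close> because \<open>L1\<close> adds it to \<open>x\<^sub>m\<^sub>+\<^sub>1\<close>.) At each step the adjoined
  element \<open>t\<close> is a root of a polynomial of some degree \<open>d\<close> over the field reached so far, while the elements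
  of \<open>G\<close> fixing that field give \<open>t\<close> at least \<open>d\<close> conjugates. An invariant can be written \<open>p(t)\<close> with
  \<open>deg p < d\<close> and takes the same value at all these conjugates, so \<open>p\<close> is constant and the invariant lies
  one step lower. Descending to the bottom, every invariant lies in \<open>E\<close>.

  The polynomials come from \<open>L\<^sub>r(T) = \<Prod> (T + w)\<close>, where \<open>w\<close> runs over the span of \<open>x\<^sub>1, \<dots>, x\<^sub>r\<close>. It is
  additive, \<open>L\<^sub>r(T) = \<Sum>\<^sub>s \<alpha>\<^sub>s T\<^bsup>q^s\<^esup>\<close>, and \<open>N(x\<^sub>i) = L\<^sub>r(x\<^sub>i)\<close> with \<open>r = min (i - 1) m\<close>. For \<open>t = y\<^sub>i\<close> put
  \<open>r = i - 1\<close>: the sum of all \<open>L\<^sub>r(x\<^sub>j) L\<^sub>r(y\<^sub>j)\<close> expands into products \<open>\<alpha>\<^sub>s \<alpha>\<^sub>t \<Sum>\<^sub>j x\<^sub>j\<^bsup>q^s\<^esup> y\<^sub>j\<^bsup>q^t\<^esup>\<close>. Up to terms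
  in \<open>x\<^sub>m\<^sub>+\<^sub>1, x\<^sub>m\<^sub>+\<^sub>2\<close>, those with \<open>s = t\<close> are powers of \<open>h\<^sub>1\<close> and the others pair up to powers of
  \<open>h\<close> with index \<open>\<bar>s - t\<bar> + 1 \<le> i\<close>. Since \<open>L\<^sub>r(x\<^sub>j) = 0\<close> for \<open>j < i\<close>, this determines
  \<open>L\<^sub>r(y\<^sub>i)\<close>, an equation of degree \<open>q\<^bsup>i-1\<^esup>\<close> for \<open>y\<^sub>i\<close>.
\<close>

subsection \<open>Invariants in simple extensions\<close>

abbreviation gen_field :: "'k::field set \<Rightarrow> 'k set" where
  "gen_field \<equiv> generate_field ring_of_type_algebra"

text \<open>Subfields as plain sets over the type class. Closure under \<open>inverse\<close> makes
  no exception at 0 because \<open>inverse 0 = 0\<close>.\<close>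

definition is_subfield :: "'k::field set \<Rightarrow> bool" where
  "is_subfield K \<longleftrightarrow> 1 \<in> K \<and> (\<forall>x\<in>K. \<forall>y\<in>K. x + y \<in> K \<and> x * y \<in> K) \<and> (\<forall>x\<in>K. - x \<in> K \<and> inverse x \<in> K)"

lemma is_subfieldD:
  assumes "is_subfield K"
  shows "1 \<in> K" "0 \<in> K" "x \<in> K \<Longrightarrow> y \<in> K \<Longrightarrow> x + y \<in> K" "x \<in> K \<Longrightarrow> y \<in> K \<Longrightarrow> x * y \<in> K"
    "x \<in> K \<Longrightarrow> - x \<in> K" "x \<in> K \<Longrightarrow> inverse x \<in> K" "x \<in> K \<Longrightarrow> y \<in> K \<Longrightarrow> x - y \<in> K"
    "x \<in> K \<Longrightarrow> y \<in> K \<Longrightarrow> x / y \<in> K" "x \<in> K \<Longrightarrow> x ^ n \<in> K"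
proof -
  note D = assms[unfolded is_subfield_def]
  show 1: "1 \<in> K" using D by blast
  show add: "x + y \<in> K" if "x \<in> K" "y \<in> K" for x y using D that by blast
  show mult: "x * y \<in> K" if "x \<in> K" "y \<in> K" for x y using D that by blast
  show um: "- x \<in> K" if "x \<in> K" for x using D that by blast
  show inv: "inverse x \<in> K" if "x \<in> K" for x using D that by blast
  show "0 \<in> K" using add[OF 1 um[OF 1]] by simp
  show "x - y \<in> K" if "x \<in> K" "y \<in> K" for x y using add[OF that(1) um[OF that(2)]] by simp
  show "x / y \<in> K" if "x \<in> K" "y \<in> K" for x y
    using mult[OF that(1) inv[OF that(2)]] by (simp add: divide_inverse)
  show "x ^ n \<in> K" if "x \<in> K" by (induction n) (auto intro: 1 mult that)
qed

lemma is_subfield_sum: "is_subfield K \<Longrightarrow> (\<And>i. i \<in> A \<Longrightarrow> f i \<in> K) \<Longrightarrow> sum f A \<in> K"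
  by (induction A rule: infinite_finite_induct) (auto intro: is_subfieldD)

lemma is_subfield_prod: "is_subfield K \<Longrightarrow> (\<And>i. i \<in> A \<Longrightarrow> f i \<in> K) \<Longrightarrow> prod f A \<in> K"
  by (induction A rule: infinite_finite_induct) (auto intro: is_subfieldD)

lemma m_inv_ring_of_type_algebra:
  assumes "x \<noteq> (0::'k::field)"
  shows "inv\<^bsub>ring_of_type_algebra\<^esub> x = inverse x"
proof -
  interpret field "ring_of_type_algebra :: 'k ring" by (rule field_from_type_algebra)
  show ?thesis
    by (rule comm_inv_char) (use assms in \<open>auto simp: ring_of_type_algebra_def\<close>)
qed

lemma a_inv_ring_of_type_algebra: "\<ominus>\<^bsub>ring_of_type_algebra\<^esub> x = - (x::'k::field)"
proof -
  interpret field "ring_of_type_algebra :: 'k ring" by (rule field_from_type_algebra)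
  show ?thesis
    using minus_equality[of "- x" x] by (simp add: ring_of_type_algebra_def)
qed

lemma is_subfield_gen_field: "is_subfield (gen_field H)"
  unfolding is_subfield_def
proof (intro conjI ballI)
  show "1 \<in> gen_field H"
    using generate_field.one[of ring_of_type_algebra H] by (simp add: ring_of_type_algebra_def)
  fix x assume x: "x \<in> gen_field H"
  show "- x \<in> gen_field H"
    using generate_field.a_inv[OF x] by (simp add: a_inv_ring_of_type_algebra)
  \<comment> \<open>\<open>generate_field\<close> inverts only nonzero elements, so the case
    \<open>x = 0\<close> of the next claim relies on 0 being a member.\<close>
  then have "x + - x \<in> gen_field H"
    using generate_field.eng_add[OF x, of "-x"] by (simp add: ring_of_type_algebra_def)
  then show "inverse x \<in> gen_field H"
    using generate_field.m_inv[OF x] m_inv_ring_of_type_algebra[of x]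
    by (cases "x = 0") (auto simp: ring_of_type_algebra_def)
  fix y assume y: "y \<in> gen_field H"
  show "x + y \<in> gen_field H" "x * y \<in> gen_field H"
    using generate_field.eng_add[OF x y] generate_field.eng_mult[OF x y]
    by (simp_all add: ring_of_type_algebra_def)
qed

lemma gen_field_least:
  assumes "is_subfield K" "H \<subseteq> K"
  shows "gen_field H \<subseteq> K"
proof
  fix x assume "x \<in> gen_field H"
  then show "x \<in> K"
  proof induction
    case one
    then show ?case using is_subfieldD(1)[OF assms(1)] by (simp add: ring_of_type_algebra_def)
  next
    case (incl h)
    then show ?case using assms by auto
  next
    case (a_inv h)
    then show ?case using is_subfieldD(5)[OF assms(1)] by (simp add: a_inv_ring_of_type_algebra)
  next
    case (m_inv h)
    have "h \<noteq> 0" using m_inv by (simp add: ring_of_type_algebra_def)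
    then show ?case using m_inv is_subfieldD(6)[OF assms(1)] by (simp add: m_inv_ring_of_type_algebra)
  next
    case (eng_add h1 h2)
    then show ?case using is_subfieldD(3)[OF assms(1)] by (simp add: ring_of_type_algebra_def)
  next
    case (eng_mult h1 h2)
    then show ?case using is_subfieldD(4)[OF assms(1)] by (simp add: ring_of_type_algebra_def)
  qed
qed

lemma gen_field_incl: "x \<in> H \<Longrightarrow> x \<in> gen_field H"
  by (rule generate_field.incl)

lemma gen_field_mono: "H \<subseteq> H' \<Longrightarrow> gen_field H \<subseteq> gen_field H'"
  by (rule gen_field_least[OF is_subfield_gen_field]) (auto intro: gen_field_incl)

section \<open>Polynomials with coefficients in a subfield, and simple extensions\<close>

definition polys_over :: "'k::field set \<Rightarrow> 'k poly set" where
  "polys_over K = {p. \<forall>i. coeff p i \<in> K}"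

lemma polys_over_simps:
  assumes "is_subfield K"
  shows "0 \<in> polys_over K" "1 \<in> polys_over K"
    "p \<in> polys_over K \<Longrightarrow> r \<in> polys_over K \<Longrightarrow> p + r \<in> polys_over K"
    "p \<in> polys_over K \<Longrightarrow> r \<in> polys_over K \<Longrightarrow> p - r \<in> polys_over K"
    "p \<in> polys_over K \<Longrightarrow> - p \<in> polys_over K"
    "p \<in> polys_over K \<Longrightarrow> r \<in> polys_over K \<Longrightarrow> p * r \<in> polys_over K"
    "c \<in> K \<Longrightarrow> [:c:] \<in> polys_over K" "c \<in> K \<Longrightarrow> monom c n \<in> polys_over K"
    "c \<in> K \<Longrightarrow> [:c, 1:] \<in> polys_over K"
  by (auto simp: polys_over_def coeff_mult coeff_pCons coeff_1 split: nat.splits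
      intro!: is_subfieldD[OF assms] is_subfield_sum[OF assms])

lemma polys_over_prod:
  assumes "is_subfield K" "\<And>i. i \<in> A \<Longrightarrow> f i \<in> polys_over K"
  shows "prod f A \<in> polys_over K"
  using assms(2) by (induction A rule: infinite_finite_induct)
    (auto intro: polys_over_simps[OF assms(1)])

text \<open>Leading terms are cancelled one at a time by \<open>c\<close>, whose coefficient is a
  quotient of elements of \<open>K\<close>; so quotient and remainder stay over \<open>K\<close>
  instead of the whole type.\<close>

lemma polys_over_division:
  assumes K: "is_subfield K" and s: "s \<in> polys_over K" "s \<noteq> 0" and p: "p \<in> polys_over K"
  shows "\<exists>u\<in>polys_over K. \<exists>r\<in>polys_over K. p = s * u + r \<and> (r = 0 \<or> degree r < degree s)"
  using p
proof (induction "degree p" arbitrary: p rule: less_induct)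
  case less
  show ?case
  proof (cases "p = 0 \<or> degree p < degree s")
    case True
    then show ?thesis using less.prems polys_over_simps(1)[OF K]
      by (intro bexI[of _ 0] bexI[of _ p]) auto
  next
    case False
    define c where "c = monom (lead_coeff p / lead_coeff s) (degree p - degree s)"
    have c: "c \<in> polys_over K" unfolding c_def
      using less.prems s by (intro polys_over_simps[OF K] is_subfieldD[OF K]) (auto simp: polys_over_def)
    have cn: "lead_coeff p / lead_coeff s \<noteq> 0" using False s by auto
    have dc: "degree (s * c) = degree p"
      using False s cn by (simp add: c_def degree_mult_eq degree_monom_eq monom_eq_0_iff)
    have lc: "lead_coeff (s * c) = lead_coeff p"
      unfolding lead_coeff_mult using s cn by (simp add: c_def degree_monom_eq)
    define p' where "p' = p - s * c"
    have p': "p' \<in> polys_over K" unfolding p'_def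
      by (intro polys_over_simps[OF K] less.prems c s)
    have dp': "p' = 0 \<or> degree p' < degree p"
    proof (cases "degree p = 0")
      case True
      then have "p' = 0" unfolding p'_def using dc lc
        by (metis degree_0_id diff_self)
      then show ?thesis ..
    next
      case False
      have "degree p' \<le> degree p" unfolding p'_def using dc degree_diff_le by (metis le_refl)
      moreover have "coeff p' (degree p) = 0" unfolding p'_def using lc dc by simp
      ultimately show ?thesis by (metis False eq_zero_or_degree_less)
    qed
    have "\<exists>u\<in>polys_over K. \<exists>r\<in>polys_over K. p' = s * u + r \<and> (r = 0 \<or> degree r < degree s)"
    proof (cases "p' = 0")
      case True
      then show ?thesis using polys_over_simps(1)[OF K] by (intro bexI[of _ 0]) auto
    next
      case False
      then show ?thesis using less.hyps[of p'] dp' p' by auto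
    qed
    then obtain u r where ur: "u \<in> polys_over K" "r \<in> polys_over K" "p' = s * u + r"
      "r = 0 \<or> degree r < degree s" by blast
    have "p = s * (u + c) + r" using ur(3) unfolding p'_def by (simp add: algebra_simps)
    then show ?thesis using ur c polys_over_simps(3)[OF K] by blast
  qed
qed

text \<open>A Euclidean descent. Writing \<open>P = p * u + r\<close> gives
  \<open>poly p t * poly u t = - poly r t\<close>, and \<open>poly r t\<close> is invertible by
  induction on the degree. Minimality of \<open>P\<close> among the polynomials that vanish at
  \<open>t\<close> keeps \<open>poly r t\<close> from being 0.\<close>

lemma inverse_of_algebraic:
  assumes K: "is_subfield K" and P: "P \<in> polys_over K" "poly P t = 0"
    and minimal: "\<And>p. p \<in> polys_over K \<Longrightarrow> p \<noteq> 0 \<Longrightarrow> poly p t = 0 \<Longrightarrow> degree P \<le> degree p"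
    and p: "p \<in> polys_over K" "poly p t \<noteq> 0" "degree p < degree P"
  shows "\<exists>s\<in>polys_over K. poly p t * poly s t = 1"
  using p
proof (induction "degree p" arbitrary: p rule: less_induct)
  case less
  have "p \<noteq> 0" using less.prems by auto
  from polys_over_division[OF K less.prems(1) this P(1)]
  obtain u r where ur: "u \<in> polys_over K" "r \<in> polys_over K" "P = p * u + r" "r = 0 \<or> degree r < degree p"
    by blast
  have eq: "poly p t * poly u t = - poly r t" using P(2) ur(3) by (simp add: add_eq_0_iff2)
  show ?case
  proof (cases "degree p = 0")
    case True
    then obtain c where c: "p = [:c:]" by (metis degree_eq_zeroE)
    then have "c \<in> K" using less.prems(1) by (auto simp: polys_over_def dest: spec[of _ 0])
    then have "[:inverse c:] \<in> polys_over K" by (intro polys_over_simps[OF K] is_subfieldD[OF K])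
    then show ?thesis using c less.prems(2) by (intro bexI[of _ "[:inverse c:]"]) auto
  next
    case False
    have "P \<noteq> 0" using less.prems by auto
    have rt: "poly r t \<noteq> 0"
    proof
      assume 0: "poly r t = 0"
      have "r = 0"
      proof (rule ccontr)
        assume "r \<noteq> 0"
        then show False using minimal[OF ur(2) _ 0] ur(4) less.prems by auto
      qed
      then have "poly u t = 0" using eq less.prems(2) by simp
      moreover have "u \<noteq> 0" using \<open>P \<noteq> 0\<close> ur(3) \<open>r = 0\<close> by auto
      ultimately have "degree P \<le> degree u" using minimal ur(1) by blast
      moreover have "degree P = degree p + degree u"
        using ur(3) \<open>r = 0\<close> \<open>u \<noteq> 0\<close> \<open>p \<noteq> 0\<close> by (simp add: degree_mult_eq)
      ultimately show False using False by simp
    qed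
    then have "degree r < degree p" using ur(4) by auto
    from less.hyps[OF this ur(2) rt] less.prems this
    obtain s where s: "s \<in> polys_over K" "poly r t * poly s t = 1" by auto
    show ?thesis
    proof (rule bexI[of _ "- (u * s)"])
      show "poly p t * poly (- (u * s)) t = 1" 
      proof -
        have "poly p t * poly (- (u * s)) t = - (poly p t * poly u t) * poly s t" by simp
        also have "\<dots> = 1" unfolding eq using s(2) by simp
        finally show ?thesis .
      qed
      show "- (u * s) \<in> polys_over K" by (intro polys_over_simps[OF K] ur s)
    qed
  qed
qed

text \<open>\<open>P\<close> may be reducible, so it is first replaced by a polynomial
  \<open>P0\<close> of least degree that vanishes at \<open>t\<close>. The values at
  \<open>t\<close> of polynomials over \<open>K\<close> then form a field, and reduction modulo
  \<open>P0\<close> bounds the degree.\<close>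

lemma simple_algebraic_extension:
  assumes K: "is_subfield K" and P: "P \<in> polys_over K" "P \<noteq> 0" "poly P t = 0"
    and f: "f \<in> gen_field (insert t K)"
  shows "\<exists>p\<in>polys_over K. degree p < degree P \<and> f = poly p t"
proof -
  define R where "R = (\<lambda>n. \<exists>p. p \<in> polys_over K \<and> p \<noteq> 0 \<and> poly p t = 0 \<and> degree p = n)"
  have "R (degree P)" using P by (auto simp: R_def)
  then have RL: "R (LEAST n. R n)" and le: "(LEAST n. R n) \<le> degree P"
    by (rule LeastI, rule Least_le)
  obtain P0 where P0: "P0 \<in> polys_over K" "P0 \<noteq> 0" "poly P0 t = 0" "degree P0 = (LEAST n. R n)"
    using RL unfolding R_def by blast
  have minimal: "degree P0 \<le> degree p" if "p \<in> polys_over K" "p \<noteq> 0" "poly p t = 0" for p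
    using that P0(4) by (auto intro!: Least_le simp: R_def)
  \<comment> \<open>A nonzero constant does not vanish at \<open>t\<close>. Positivity matters
    below, where the remainder 0 must also have degree less than \<open>degree P0\<close>.\<close>
  have P0deg: "degree P0 > 0"
    using P0 by (metis degree_eq_zeroE gr0I mult_zero_right pCons_eq_0_iff poly_pCons poly_0 add.right_neutral)
  let ?D = "{poly p t | p. p \<in> polys_over K}"
  have red: "\<exists>r\<in>polys_over K. poly p t = poly r t \<and> degree r < degree P0" if p: "p \<in> polys_over K" for p
  proof -
    from polys_over_division[OF K P0(1,2) p] obtain u r where
      "r \<in> polys_over K" "p = P0 * u + r" "r = 0 \<or> degree r < degree P0" by blast
    then show ?thesis using P0(3) P0deg by (intro bexI[of _ r]) auto
  qed
  have "is_subfield ?D"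
    unfolding is_subfield_def
  proof (intro conjI ballI)
    show "1 \<in> ?D" using polys_over_simps(2)[OF K] by (force intro: exI[of _ 1])
    fix x assume "x \<in> ?D"
    then obtain p where p: "p \<in> polys_over K" "x = poly p t" by auto
    show "- x \<in> ?D" using p polys_over_simps(5)[OF K] by (force intro: exI[of _ "-p"])
    show "inverse x \<in> ?D"
    proof (cases "x = 0")
      case True
      then show ?thesis using polys_over_simps(1)[OF K] by (force intro: exI[of _ 0])
    next
      case False
      obtain r where r: "r \<in> polys_over K" "x = poly r t" "degree r < degree P0" using red p by blast
      have "\<exists>s\<in>polys_over K. poly r t * poly s t = 1"
        by (rule inverse_of_algebraic[OF K P0(1,3) minimal r(1) _ r(3)]) (use False r(2) in simp_all)
      then obtain s where "s \<in> polys_over K" "x * poly s t = 1" unfolding r(2) by blast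
      moreover from this(2) have "inverse x = poly s t" by (rule inverse_unique)
      ultimately show ?thesis by auto
    qed
    fix y assume "y \<in> ?D"
    then obtain s where s: "s \<in> polys_over K" "y = poly s t" by auto
    show "x + y \<in> ?D" using p s polys_over_simps(3)[OF K] by (force intro: exI[of _ "p + s"])
    show "x * y \<in> ?D" using p s polys_over_simps(6)[OF K] by (force intro: exI[of _ "p * s"])
  qed
  moreover have "insert t K \<subseteq> ?D"
  proof
    fix x assume "x \<in> insert t K"
    then show "x \<in> ?D"
    proof
      assume "x = t"
      moreover have "[:0, 1:] \<in> polys_over K" by (intro polys_over_simps[OF K] is_subfieldD[OF K])
      ultimately show ?thesis by (force intro: exI[of _ "[:0, 1:]"])
    next
      assume "x \<in> K"
      then show ?thesis using polys_over_simps(7)[OF K] by (force intro: exI[of _ "[:x:]"])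
    qed
  qed
  ultimately have "f \<in> ?D" using gen_field_least f by blast
  then obtain p where "p \<in> polys_over K" "f = poly p t" by auto
  from red[OF this(1)] this(2) le P0(4) show ?thesis by force
qed

section \<open>Endomorphisms and the descent of invariants\<close>

definition ring_endo :: "('k::field \<Rightarrow> 'k) \<Rightarrow> bool" where
  "ring_endo \<sigma> \<longleftrightarrow> \<sigma> 1 = 1 \<and> (\<forall>x y. \<sigma> (x + y) = \<sigma> x + \<sigma> y \<and> \<sigma> (x * y) = \<sigma> x * \<sigma> y)"

lemma ring_endoD:
  assumes "ring_endo \<sigma>"
  shows "\<sigma> 1 = 1" "\<sigma> 0 = 0" "\<sigma> (x + y) = \<sigma> x + \<sigma> y" "\<sigma> (x * y) = \<sigma> x * \<sigma> y" "\<sigma> (- x) = - \<sigma> x"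
    "\<sigma> (inverse x) = inverse (\<sigma> x)" "\<sigma> (x ^ n) = \<sigma> x ^ n" "\<sigma> (sum f A) = (\<Sum>i\<in>A. \<sigma> (f i))"
    "\<sigma> (prod f A) = (\<Prod>i\<in>A. \<sigma> (f i))" "\<sigma> x = \<sigma> y \<longleftrightarrow> x = y"
proof -
  note D = assms[unfolded ring_endo_def]
  show 1: "\<sigma> 1 = 1" using D by blast
  show add: "\<sigma> (x + y) = \<sigma> x + \<sigma> y" for x y using D by blast
  show mult: "\<sigma> (x * y) = \<sigma> x * \<sigma> y" for x y using D by blast
  show 0: "\<sigma> 0 = 0" using add[of 0 0] by (metis add_cancel_right_left add_0)
  show um: "\<sigma> (- x) = - \<sigma> x" for x using add[of x "-x"] 0 by (simp add: eq_neg_iff_add_eq_0 add.commute)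
  show "\<sigma> (inverse x) = inverse (\<sigma> x)"
  proof (cases "x = 0")
    case False
    then have "\<sigma> x * \<sigma> (inverse x) = 1" using 1 mult[of x "inverse x"] by simp
    then show ?thesis by (simp add: inverse_unique)
  qed (simp add: 0)
  show "\<sigma> (x ^ n) = \<sigma> x ^ n" by (induction n) (auto simp: 1 mult)
  show "\<sigma> (sum f A) = (\<Sum>i\<in>A. \<sigma> (f i))" by (induction A rule: infinite_finite_induct) (auto simp: 0 add)
  show "\<sigma> (prod f A) = (\<Prod>i\<in>A. \<sigma> (f i))" by (induction A rule: infinite_finite_induct) (auto simp: 1 mult)
  have "z = 0" if "\<sigma> z = 0" for z
  proof (rule ccontr)
    assume "z \<noteq> 0"
    then have "\<sigma> (z * inverse z) = 1" using 1 by simp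
    then show False using mult that by simp
  qed
  from this[of "x + - y"] show "\<sigma> x = \<sigma> y \<longleftrightarrow> x = y" using add[of x "-y"] um by auto
qed

lemma ring_endo_poly:
  assumes "ring_endo \<sigma>" "p \<in> polys_over K" "\<And>x. x \<in> K \<Longrightarrow> \<sigma> x = x"
  shows "\<sigma> (poly p t) = poly p (\<sigma> t)"
proof -
  have "\<sigma> (coeff p i) = coeff p i" for i using assms by (auto simp: polys_over_def)
  then show ?thesis by (simp add: poly_altdef ring_endoD[OF assms(1)])
qed

lemma is_subfield_fixed:
  assumes "\<And>\<sigma>. \<sigma> \<in> H \<Longrightarrow> ring_endo \<sigma>"
  shows "is_subfield {x. \<forall>\<sigma>\<in>H. \<sigma> x = x}"
  unfolding is_subfield_def Ball_def mem_Collect_eq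
  by (metis assms ring_endoD(1) ring_endoD(3-6))

text \<open>One step of the descent. Each endomorphism fixes the coefficients of \<open>p\<close>
  and the value \<open>f = poly p t\<close>, hence \<open>p - [:f:]\<close> vanishes on
  \<open>R\<close>, which has more elements than its degree. So \<open>f\<close> is the constant
  coefficient of \<open>p\<close>.\<close>

lemma invariant_in_base:
  assumes P: "P \<in> polys_over (gen_field E)" "P \<noteq> 0" "poly P t = 0" "degree P \<le> card R"
    and conj: "\<And>r. r \<in> R \<Longrightarrow> \<exists>\<sigma>. ring_endo \<sigma> \<and> (\<forall>x\<in>E. \<sigma> x = x) \<and> \<sigma> f = f \<and> \<sigma> t = r"
    and f: "f \<in> gen_field (insert t E)"
  shows "f \<in> gen_field E"
proof -
  let ?K = "gen_field E"
  have "gen_field (insert t E) \<subseteq> gen_field (insert t ?K)"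
    by (rule gen_field_mono) (auto intro: gen_field_incl)
  with f have "f \<in> gen_field (insert t ?K)" by auto
  from simple_algebraic_extension[OF is_subfield_gen_field P(1-3) this]
  obtain p where p: "p \<in> polys_over ?K" "degree p < degree P" "f = poly p t" by blast
  let ?r = "p - [:f:]"
  have root: "poly ?r r = 0" if r: "r \<in> R" for r
  proof -
    obtain \<sigma> where \<sigma>: "ring_endo \<sigma>" "\<forall>x\<in>E. \<sigma> x = x" "\<sigma> f = f" "\<sigma> t = r" using conj[OF r] by blast
    have "?K \<subseteq> {x. \<forall>\<tau>\<in>{\<sigma>}. \<tau> x = x}"
      by (rule gen_field_least[OF is_subfield_fixed]) (use \<sigma> in auto)
    then have "\<sigma> (poly p t) = poly p r"
      using ring_endo_poly[OF \<sigma>(1) p(1)] \<sigma>(4) by auto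
    then show ?thesis using \<sigma>(3) p(3) by simp
  qed
  have "degree ?r < card R"
    using p(2) P(4) degree_diff_le[of p "degree p" "[:f:]"] by auto
  moreover have "card R > 0" using p(2) P(4) by linarith
  ultimately have "?r = 0"
    using root card_poly_roots_bound[of ?r] card_mono[OF poly_roots_finite[of ?r], of R]
    by (metis (mono_tags, lifting) linorder_not_le mem_Collect_eq order_trans subsetI)
  then have "coeff p 0 = f" by (metis coeff_pCons_0 eq_iff_diff_eq_0)
  then show ?thesis using p(1) by (auto simp: polys_over_def)
qed


subsection \<open>The additive polynomials of spans of variables\<close>

text \<open>Multiplication by a nonzero \<open>x\<close> permutes the nonzero elements, so their
  product absorbs the factor \<open>x ^ card ?U\<close>.\<close>

lemma finite_field_power_card:
  fixes x :: "'a::{finite,field}"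
  shows "x ^ card (UNIV :: 'a set) = x"
proof (cases "x = 0")
  case True
  then show ?thesis by (simp add: finite_UNIV_card_ge_0)
next
  case False
  let ?U = "UNIV - {0::'a}"
  have "bij_betw ((*) x) ?U ?U"
    by (rule bij_betw_byWitness[where f' = "(*) (inverse x)"]) (use False in auto)
  then have "prod id ?U = (\<Prod>y\<in>?U. x * y)"
    using prod.reindex_bij_betw[of "(*) x" ?U ?U id] by simp
  then have "prod id ?U = x ^ card ?U * prod id ?U" by (simp add: prod.distrib)
  moreover have "prod id ?U \<noteq> 0" by simp
  ultimately have 1: "x ^ card ?U = 1" by simp
  have "card (UNIV :: 'a set) = Suc (card ?U)"
    by (metis finite UNIV_I card_Suc_Diff1)
  then show ?thesis by (simp only: power_Suc 1 mult_1_right)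
qed

text \<open>By the previous lemma \<open>-1\<close> equals its own power with the even exponent
  \<open>card UNIV\<close>, which is 1.\<close>

lemma finite_field_even_card:
  assumes "even (card (UNIV :: 'a::{finite,field} set))"
  shows "(1::'a) + 1 = 0"
proof -
  have "(-1::'a) ^ card (UNIV :: 'a set) = 1" using assms by simp
  then have "(-1::'a) = 1" using finite_field_power_card[of "-1::'a"] by simp
  then show ?thesis by (metis add.right_inverse)
qed

text \<open>Leading terms cancel in the difference, which therefore has degree below
  \<open>n\<close> but at least \<open>n\<close> zeros.\<close>

lemma monic_poly_eqI:
  fixes p r :: "'k::field poly"
  assumes "degree p = n" "degree r = n" "lead_coeff p = 1" "lead_coeff r = 1" "n \<le> card S" "n > 0"
    and eq: "\<And>x. x \<in> S \<Longrightarrow> poly p x = poly r x"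
  shows "p = r"
proof (rule ccontr)
  assume "p \<noteq> r"
  then have 0: "p - r \<noteq> 0" by simp
  have "degree (p - r) \<le> n" using assms by (intro degree_diff_le) simp_all
  moreover have "coeff (p - r) n = 0" using assms by simp
  ultimately have "degree (p - r) < n" using 0 \<open>n > 0\<close>
    by (metis eq_zero_or_degree_less)
  moreover have "card S \<le> card {x. poly (p - r) x = 0}"
    by (rule card_mono[OF poly_roots_finite[OF 0]]) (use eq in auto)
  ultimately show False using card_poly_roots_bound[OF 0] assms by linarith
qed

lemma monic_prod_linear:
  assumes "finite A"
  shows "degree (\<Prod>c\<in>A. [:g c, 1::'k::field:]) = card A" "lead_coeff (\<Prod>c\<in>A. [:g c, 1::'k:]) = 1"
proof -
  show "degree (\<Prod>c\<in>A. [:g c, 1::'k:]) = card A"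
    by (subst degree_prod_eq_sum_degree) auto
  show "lead_coeff (\<Prod>c\<in>A. [:g c, 1::'k:]) = 1"
    by (simp add: lead_coeff_prod)
qed

text \<open>Off the diagonal the terms pair up as
  \<open>\<alpha> s * \<alpha> t * (M s t + M t s)\<close>, so only symmetrised values of
  \<open>M\<close> have to lie in \<open>K\<close>. The induction splits off the last row and
  column.\<close>

lemma twisted_sum_in_subfield:
  fixes r :: nat
  assumes K: "is_subfield K" and "\<And>s. s \<le> r \<Longrightarrow> M s s \<in> K"
    and "\<And>s t. s < t \<Longrightarrow> t \<le> r \<Longrightarrow> M s t + M t s \<in> K" and "\<And>s. s \<le> r \<Longrightarrow> \<alpha> s \<in> K"
  shows "(\<Sum>s\<le>r. \<Sum>t\<le>r. \<alpha> s * \<alpha> t * M s t) \<in> K"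
  using assms(2-)
proof (induction r)
  case 0
  then show ?case by (simp add: is_subfieldD(4)[OF K])
next
  case (Suc r)
  have "(\<Sum>s\<le>Suc r. \<Sum>t\<le>Suc r. \<alpha> s * \<alpha> t * M s t) =
    (\<Sum>s\<le>r. \<Sum>t\<le>r. \<alpha> s * \<alpha> t * M s t) +
    (\<Sum>s\<le>r. \<alpha> s * \<alpha> (Suc r) * (M s (Suc r) + M (Suc r) s)) + \<alpha> (Suc r) * \<alpha> (Suc r) * M (Suc r) (Suc r)"
    by (simp add: sum.distrib algebra_simps)
  also have "\<dots> \<in> K"
  proof (intro is_subfieldD(3)[OF K])
    show "(\<Sum>s\<le>r. \<Sum>t\<le>r. \<alpha> s * \<alpha> t * M s t) \<in> K"
      by (rule Suc.IH) (auto intro!: Suc.prems)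
    show "(\<Sum>s\<le>r. \<alpha> s * \<alpha> (Suc r) * (M s (Suc r) + M (Suc r) s)) \<in> K"
      by (intro is_subfield_sum[OF K] is_subfieldD(4)[OF K] Suc.prems(2)) (auto intro!: Suc.prems)
    show "\<alpha> (Suc r) * \<alpha> (Suc r) * M (Suc r) (Suc r) \<in> K"
      by (intro is_subfieldD(4)[OF K]) (auto intro!: Suc.prems)
  qed
  finally show ?case .
qed

text \<open>What the field theory has to know of rational functions: \<open>C\<close> embeds the
  constants, and the variables \<open>V j\<close> are linearly independent over them. The concrete
  instance is \<open>gf_vars_ratfuns\<close>.\<close>

locale gf_vars =
  fixes C :: "'a::{finite,field} \<Rightarrow> 'k::field" and V :: "nat \<Rightarrow> 'k" and q m :: nat
  assumes C_1: "C 1 = 1" and C_add: "C (x + y) = C x + C y" and C_mult: "C (x * y) = C x * C y"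
    and q_card: "q = card (UNIV :: 'a set)" and q_even: "even q"
    and indep: "(\<Sum>j=1..2*m+2. C (c j) * V j) = 0 \<Longrightarrow> j \<in> {1..2*m+2} \<Longrightarrow> c j = 0"
begin

section \<open>Characteristic 2 and the Frobenius power\<close>

lemma two_eq_0: "x + x = (0::'k)"
proof -
  have "(1::'k) + 1 = 0" using finite_field_even_card[where ?'a = 'a] q_card q_even C_1 C_add[of 1 1] C_add[of 0 0]
    by (metis add_cancel_right_left)
  then show ?thesis by (metis distrib_right mult_1 mult_zero_left)
qed

lemma uminus_eq: "- x = (x::'k)"
  by (rule minus_unique) (rule two_eq_0)

lemma two_eq_0': "y + (y + x) = (x::'k)"
  using two_eq_0[of y] by (simp add: add.assoc[symmetric])

lemma C_0: "C 0 = 0"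
  using C_add[of 0 0] by (metis add_cancel_right_left add_0)

lemma C_eq_0: "C x = 0 \<longleftrightarrow> x = 0"
proof
  assume "C x = 0"
  then show "x = 0" using C_mult[of x "inverse x"] C_1 by (cases "x = 0") auto
qed (simp add: C_0)

lemma C_inj: "inj C"
proof (rule injI)
  fix x y assume "C x = C y"
  then have "C (x - y) = 0" using C_add[of "x - y" y] by simp
  then show "x = y" using C_eq_0 by simp
qed

lemma C_power: "C (x ^ n) = C x ^ n"
  by (induction n) (auto simp: C_1 C_mult)

lemma C_power_q: "C e ^ q = C e"
  using finite_field_power_card[of e] C_power[of e q] q_card by simp

lemma q_ge_2: "q \<ge> 2"
proof -
  have "card {0::'a, 1} \<le> card (UNIV :: 'a set)" by (rule card_mono) auto
  then show ?thesis using q_card by simp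
qed

text \<open>Both sides are monic of degree \<open>q\<close> in \<open>T\<close> and vanish at all
  constants. The familiar \<open>T ^ q - T\<close> has a plus sign here by characteristic 2.\<close>

lemma prod_add_C: "(\<Prod>e\<in>UNIV. T + C e) = T ^ q + T"
proof -
  have "(\<Prod>e\<in>UNIV. [:C e, 1:]) = monom 1 q + [:0, 1:]"
  proof (rule monic_poly_eqI[of _ q _ "range C"])
    have d: "degree [:0, 1::'k:] < degree (monom (1::'k) q)"
      using q_ge_2 by (simp add: degree_monom_eq)
    then show "degree (monom (1::'k) q + [:0, 1:]) = q"
      by (simp add: degree_add_eq_left degree_monom_eq)
    then show "lead_coeff (monom (1::'k) q + [:0, 1:]) = 1"
      using q_ge_2 by (simp add: coeff_pCons split: nat.splits)
    show "q \<le> card (range C)" using card_image[OF C_inj] q_card by simp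
    fix x assume "x \<in> range C"
    then obtain e where e: "x = C e" by auto
    have "poly (\<Prod>e\<in>UNIV. [:C e, 1:]) x = 0"
      unfolding poly_prod e by (intro prod_zero bexI[of _ e]) (simp_all add: two_eq_0)
    moreover have "poly (monom 1 q + [:0, 1:]) x = 0"
      by (simp add: poly_monom e C_power_q two_eq_0)
    ultimately show "poly (\<Prod>e\<in>UNIV. [:C e, 1:]) x = poly (monom 1 q + [:0, 1:]) x" by simp
  qed (use q_card q_ge_2 monic_prod_linear[of "UNIV :: 'a set" C] in auto)
  then have "poly (\<Prod>e\<in>UNIV. [:C e, 1:]) T = poly (monom 1 q + [:0, 1:]) T" by simp
  then show ?thesis by (simp add: poly_prod poly_monom add.commute)
qed

text \<open>Additivity comes from \<open>prod_add_C\<close>: as polynomials in \<open>x\<close>, the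
  products of all \<open>x + y + C e\<close> and of all \<open>x + C e\<close> differ by the
  constant \<open>y ^ q + y\<close>, because at a constant \<open>x\<close> the first is merely
  reindexed and the second is 0.\<close>

lemma power_q_add: "(x + y :: 'k) ^ q = x ^ q + y ^ q"
proof -
  let ?F = "\<lambda>T. T ^ q + T :: 'k"
  have "(\<Prod>e\<in>UNIV. [:y + C e, 1:]) = (\<Prod>e\<in>UNIV. [:C e, 1:]) + [:?F y:]"
  proof (rule monic_poly_eqI[of _ q _ "range C"])
    note mp = monic_prod_linear[of "UNIV :: 'a set" C]
    have d: "degree [:?F y:] < degree (\<Prod>e\<in>UNIV. [:C e, 1:])"
      using q_ge_2 mp q_card by simp
    then show dd: "degree ((\<Prod>e\<in>UNIV. [:C e, 1:]) + [:?F y:]) = q"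
      using mp q_card by (simp add: degree_add_eq_left)
    have "coeff (\<Prod>e\<in>UNIV. [:C e, 1:]) q = 1" using mp q_card by simp
    then show "lead_coeff ((\<Prod>e\<in>UNIV. [:C e, 1:]) + [:?F y:]) = 1"
      unfolding dd using q_ge_2 by (simp add: coeff_pCons split: nat.splits)
    show "q \<le> card (range C)" using card_image[OF C_inj] q_card by simp
    fix x assume "x \<in> range C"
    then obtain e where e: "x = C e" by auto
    have "poly (\<Prod>e\<in>UNIV. [:C e, 1:]) x = 0"
      unfolding poly_prod e by (intro prod_zero bexI[of _ e]) (simp_all add: two_eq_0)
    moreover have "poly (\<Prod>e\<in>UNIV. [:y + C e, 1:]) x = (\<Prod>d\<in>UNIV. y + C (e + d))"
      by (simp add: poly_prod e C_add ac_simps)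
    moreover have "(\<Prod>d\<in>UNIV. y + C (e + d)) = (\<Prod>d\<in>UNIV. y + C d)"
      by (rule prod.reindex_bij_betw) (rule bij_betw_byWitness[where f' = "\<lambda>x. x - e"], auto)
    ultimately show "poly (\<Prod>e\<in>UNIV. [:y + C e, 1:]) x = poly ((\<Prod>e\<in>UNIV. [:C e, 1:]) + [:?F y:]) x"
      by (simp add: prod_add_C)
  qed (use q_card q_ge_2 monic_prod_linear[of "UNIV :: 'a set" "\<lambda>e. y + C e"] in auto)
  then have "poly (\<Prod>e\<in>UNIV. [:y + C e, 1:]) x = poly ((\<Prod>e\<in>UNIV. [:C e, 1:]) + [:?F y:]) x" by simp
  then have "(\<Prod>e\<in>UNIV. (x + y) + C e) = (\<Prod>e\<in>UNIV. x + C e) + ?F y"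
    by (simp add: poly_prod ac_simps)
  then show ?thesis unfolding prod_add_C by (simp add: algebra_simps)
qed

lemma power_qs_add: "(x + y :: 'k) ^ (q ^ s) = x ^ (q ^ s) + y ^ (q ^ s)"
proof (induction s arbitrary: x y)
  case (Suc s)
  show ?case by (simp only: power_Suc power_mult power_q_add Suc)
qed simp

lemma power_q_sum: "(\<Sum>i\<in>A. f i :: 'k) ^ (q ^ s) = (\<Sum>i\<in>A. f i ^ (q ^ s))"
  using q_ge_2 by (induction A rule: infinite_finite_induct) (auto simp: power_qs_add)

lemma C_power_qs: "C e ^ (q ^ s) = C e"
proof (induction s)
  case (Suc s)
  show ?case by (simp only: power_Suc power_mult C_power_q Suc)
qed simp

text \<open>Homogeneous version of \<open>prod_add_C\<close>, by substituting \<open>T / D\<close>;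
  for \<open>D = 0\<close> the second summand is 0 since \<open>q \<ge> 2\<close>.\<close>

lemma prod_add_C_mult: "(\<Prod>e\<in>UNIV. T + C e * D) = T ^ q + D ^ (q - 1) * T"
proof (cases "D = 0")
  case True
  then show ?thesis using q_ge_2 by (simp add: q_card)
next
  case False
  have "(\<Prod>e\<in>UNIV. T + C e * D) = (\<Prod>e\<in>UNIV. D * (T / D + C e))"
    using False by (intro prod.cong refl) (simp add: field_simps)
  also have "\<dots> = D ^ q * ((T / D) ^ q + T / D)"
    by (simp add: prod.distrib prod_add_C q_card)
  also have "\<dots> = T ^ q + D ^ (q - 1) * T"
    using False q_ge_2 by (cases q) (auto simp: field_simps)
  finally show ?thesis .
qed

section \<open>Coefficient vectors and the additive polynomials they define\<close>

definition coefs :: "nat \<Rightarrow> (nat \<Rightarrow> 'a) set" where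
  "coefs r = {c. \<forall>j. j \<notin> {1..r} \<longrightarrow> c j = 0}"

text \<open>The sum runs to \<open>m\<close> whatever \<open>r\<close> is, so one map serves every
  \<open>coefs r\<close> with \<open>r \<le> m\<close>: the extra coefficients are 0.\<close>

definition lin :: "(nat \<Rightarrow> 'a) \<Rightarrow> 'k" where
  "lin c = (\<Sum>j=1..m. C (c j) * V j)"

text \<open>The product is indexed by coefficient vectors rather than by elements of the span; for
  \<open>r \<le> m\<close> this is the same by \<open>lin_inj\<close>.\<close>

definition L :: "nat \<Rightarrow> 'k \<Rightarrow> 'k" where
  "L r T = (\<Prod>c\<in>coefs r. T + lin c)"

lemma coefs_0: "coefs 0 = {\<lambda>_. 0}"
  by (auto simp: coefs_def)

lemma coefs_mono: "r \<le> r' \<Longrightarrow> coefs r \<subseteq> coefs r'"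
  by (auto simp: coefs_def)

lemma coefs_Suc: "bij_betw (\<lambda>(e, c). c(Suc r := e)) (UNIV \<times> coefs r) (coefs (Suc r))"
proof (rule bij_betw_byWitness[where f' = "\<lambda>c. (c (Suc r), c(Suc r := 0))"])
  show "\<forall>z\<in>UNIV \<times> coefs r. ((case z of (e, c) \<Rightarrow> c(Suc r := e)) (Suc r),
      (case z of (e, c) \<Rightarrow> c(Suc r := e))(Suc r := 0)) = z"
  proof clarsimp
    fix c assume "c \<in> coefs r"
    then have "c (Suc r) = 0" by (force simp: coefs_def)
    then show "c(Suc r := 0) = c" by auto
  qed
  show "(\<lambda>(e, c). c(Suc r := e)) ` (UNIV \<times> coefs r) \<subseteq> coefs (Suc r)"
    by (auto simp: coefs_def)
  show "(\<lambda>c. (c (Suc r), c(Suc r := 0))) ` coefs (Suc r) \<subseteq> UNIV \<times> coefs r"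
    by (auto simp: coefs_def le_Suc_eq split: if_splits)
qed auto

lemma finite_coefs: "finite (coefs r)"
proof (induction r)
  case (Suc r)
  then show ?case using bij_betw_finite[OF coefs_Suc[of r]] by simp
qed (simp add: coefs_0)

lemma card_coefs: "card (coefs r) = q ^ r"
proof (induction r)
  case (Suc r)
  then show ?case using bij_betw_same_card[OF coefs_Suc[of r]] by (simp add: card_cartesian_product q_card)
qed (simp add: coefs_0)

lemma coefs_add: "c \<in> coefs r \<Longrightarrow> d \<in> coefs r \<Longrightarrow> (\<lambda>j. c j + d j) \<in> coefs r"
  by (simp add: coefs_def)

lemma coefs_diff: "c \<in> coefs r \<Longrightarrow> d \<in> coefs r \<Longrightarrow> (\<lambda>j. c j - d j) \<in> coefs r"
  by (simp add: coefs_def)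

lemma coefs_mult: "c \<in> coefs r \<Longrightarrow> (\<lambda>j. e * c j) \<in> coefs r"
  by (auto simp: coefs_def)

lemma lin_0: "lin (\<lambda>_. 0) = 0"
  by (simp add: lin_def C_0)

lemma lin_add: "lin (\<lambda>j. c j + d j) = lin c + lin d"
  by (simp add: lin_def C_add algebra_simps sum.distrib)

lemma lin_mult: "lin (\<lambda>j. e * c j) = C e * lin c"
  by (simp add: lin_def C_mult sum_distrib_left algebra_simps)

lemma lin_upd:
  assumes "c \<in> coefs r" "r < m"
  shows "lin (c(Suc r := e)) = lin c + C e * V (Suc r)"
proof -
  have "c (Suc r) = 0" using assms by (force simp: coefs_def)
  then have "lin c = (\<Sum>j\<in>{1..m} - {Suc r}. C (c j) * V j)"
    unfolding lin_def using assms by (subst sum.remove[of _ "Suc r"]) (auto simp: C_0)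
  moreover have "lin (c(Suc r := e)) = C e * V (Suc r) + (\<Sum>j\<in>{1..m} - {Suc r}. C (c j) * V j)"
    unfolding lin_def using assms by (subst sum.remove[of _ "Suc r"]) (auto intro!: sum.cong)
  ultimately show ?thesis by simp
qed

lemma V_eq_lin:
  assumes "j \<in> {1..r}" "r \<le> m"
  obtains c where "c \<in> coefs r" "V j = lin c"
proof
  show "(\<lambda>i. if i = j then 1 else 0) \<in> coefs r" using assms by (auto simp: coefs_def)
  show "V j = lin (\<lambda>i. if i = j then 1 else 0)"
    unfolding lin_def using assms
    by (subst sum.remove[of _ j]) (auto simp: C_1 C_0 intro!: sum.neutral)
qed

text \<open>In characteristic 2 the equation is a vanishing combination of all variables, with the
  coefficients of \<open>c\<close> on \<open>{1..m}\<close> and of \<open>b\<close> on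
  \<open>J\<close>.\<close>

lemma indep_lin:
  assumes "(\<Sum>j\<in>J. C (b j) * V j) = lin c" "c \<in> coefs m" "J \<subseteq> {m+1..2*m+2}"
  shows "c = (\<lambda>_. 0)" "j \<in> J \<Longrightarrow> b j = 0"
proof -
  let ?d = "\<lambda>j. if j \<in> {1..m} then c j else if j \<in> J then b j else 0"
  have "(\<Sum>j=1..2*m+2. C (?d j) * V j) = (\<Sum>j\<in>{1..m} \<union> J. C (?d j) * V j)"
    using assms(3) by (intro sum.mono_neutral_right) (auto simp: C_0)
  also have "\<dots> = (\<Sum>j\<in>{1..m}. C (?d j) * V j) + (\<Sum>j\<in>J. C (?d j) * V j)"
    using assms(3) by (intro sum.union_disjoint) (auto dest: finite_subset)
  also have "(\<Sum>j\<in>{1..m}. C (?d j) * V j) = lin c" unfolding lin_def by (intro sum.cong) auto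
  also have "(\<Sum>j\<in>J. C (?d j) * V j) = lin c" unfolding assms(1)[symmetric] using assms(3)
    by (intro sum.cong) (auto dest: subsetD)
  finally have 0: "(\<Sum>j=1..2*m+2. C (?d j) * V j) = 0" by (simp add: two_eq_0)
  show "c = (\<lambda>_. 0)"
  proof
    fix j show "c j = 0" using indep[OF 0, of j] assms(2) by (cases "j \<in> {1..m}") (auto simp: coefs_def)
  qed
  show "b j = 0" if "j \<in> J" for j using indep[OF 0, of j] assms(3) that by (auto dest: subsetD split: if_splits)
qed

lemma lin_inj: "c \<in> coefs m \<Longrightarrow> d \<in> coefs m \<Longrightarrow> lin c = lin d \<Longrightarrow> c = d"
proof -
  assume c: "c \<in> coefs m" "d \<in> coefs m" "lin c = lin d"
  have "lin (\<lambda>j. c j - d j) + lin d = lin c" by (simp flip: lin_add)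
  then have "(\<Sum>j\<in>{}. C (c j) * V j) = lin (\<lambda>j. c j - d j)" using c by simp
  moreover have "(\<lambda>j. c j - d j) \<in> coefs m" using c coefs_diff by auto
  ultimately have "(\<lambda>j. c j - d j) = (\<lambda>_. 0)" by (rule indep_lin) auto
  then show "c = d" by (metis eq_iff_diff_eq_0 ext)
qed

lemma L_0: "L 0 T = T"
  by (simp add: L_def coefs_0 lin_0)

lemma L_Suc:
  assumes "r < m"
  shows "L (Suc r) T = (\<Prod>e\<in>UNIV. L r (T + C e * V (Suc r)))"
proof -
  have "L (Suc r) T = (\<Prod>(e, c)\<in>UNIV \<times> coefs r. T + lin (c(Suc r := e)))"
    unfolding L_def using prod.reindex_bij_betw[OF coefs_Suc[of r], of "\<lambda>c. T + lin c"]
    by (simp add: case_prod_unfold)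
  also have "\<dots> = (\<Prod>(e, c)\<in>UNIV \<times> coefs r. T + C e * V (Suc r) + lin c)"
    using assms by (intro prod.cong) (auto simp: lin_upd ac_simps)
  also have "\<dots> = (\<Prod>e\<in>UNIV. L r (T + C e * V (Suc r)))"
    unfolding L_def by (rule prod.cartesian_product[symmetric])
  finally show ?thesis .
qed

abbreviation VF :: "nat set \<Rightarrow> 'k set" where
  "VF S \<equiv> gen_field (range C \<union> V ` S)"

lemma lin_in_VF: "c \<in> coefs r \<Longrightarrow> r \<le> m \<Longrightarrow> lin c \<in> VF {1..r}"
proof -
  assume c: "c \<in> coefs r" "r \<le> m"
  have "C (c j) * V j \<in> VF {1..r}" for j
  proof (cases "j \<in> {1..r}")
    case True
    then show ?thesis by (intro is_subfieldD[OF is_subfield_gen_field] gen_field_incl) auto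
  next
    case False
    then have "c j = 0" using c by (auto simp: coefs_def)
    then show ?thesis using is_subfieldD(2)[OF is_subfield_gen_field] by (simp add: C_0)
  qed
  then show ?thesis unfolding lin_def by (intro is_subfield_sum[OF is_subfield_gen_field])
qed

text \<open>Induction through \<open>L (Suc r) T = L r T ^ q + ?D ^ (q - 1) * L r T\<close>, which
  is \<open>prod_add_C_mult\<close> applied to values of the already additive
  \<open>L r\<close>.\<close>

lemma L_additive_poly:
  "r \<le> m \<Longrightarrow> \<exists>\<alpha>. \<alpha> r = 1 \<and> (\<forall>s. \<alpha> s \<in> VF {1..r}) \<and> (\<forall>T. L r T = (\<Sum>s\<le>r. \<alpha> s * T ^ (q ^ s)))"
proof (induction r)
  case 0
  show ?case by (rule exI[of _ "\<lambda>_. 1"]) (auto simp: L_0 intro: is_subfieldD is_subfield_gen_field)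
next
  case (Suc r)
  then obtain \<alpha> where \<alpha>: "\<alpha> r = 1" "\<And>s. \<alpha> s \<in> VF {1..r}" "\<And>T. L r T = (\<Sum>s\<le>r. \<alpha> s * T ^ (q ^ s))"
    by auto
  let ?D = "L r (V (Suc r))"
  have lin: "L r (T + C e * S) = L r T + C e * L r S" for T e S
    by (simp add: \<alpha>(3) power_qs_add power_mult_distrib C_power_qs algebra_simps sum.distrib sum_distrib_left)
  \<comment> \<open>Coefficients of the recursion: raising to the power \<open>q\<close> shifts the
    index up by one, hence 0 at \<open>s = 0\<close>; the second summand ends at \<open>r\<close>,
    where the sum for \<open>L r\<close> stops.\<close>
  define \<beta> where "\<beta> s = (case s of 0 \<Rightarrow> 0 | Suc u \<Rightarrow> \<alpha> u ^ q) + (if s \<le> r then ?D ^ (q - 1) * \<alpha> s else 0)" for s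
  have "L (Suc r) T = (\<Sum>s\<le>Suc r. \<beta> s * T ^ (q ^ s))" for T
  proof -
    have "L (Suc r) T = L r T ^ q + ?D ^ (q - 1) * L r T"
      using Suc.prems by (simp add: L_Suc lin prod_add_C_mult)
    also have "L r T ^ q = (\<Sum>s\<le>r. \<alpha> s ^ q * T ^ (q ^ Suc s))"
      unfolding \<alpha>(3) using power_q_sum[of _ "{..r}" 1]
      by (simp add: power_mult_distrib flip: power_mult) (simp add: mult.commute)
    also have "\<dots> = (\<Sum>s\<le>Suc r. (case s of 0 \<Rightarrow> 0 | Suc u \<Rightarrow> \<alpha> u ^ q) * T ^ (q ^ s))"
      by (subst sum.atMost_Suc_shift) simp
    also have "?D ^ (q - 1) * L r T = (\<Sum>s\<le>Suc r. (if s \<le> r then ?D ^ (q - 1) * \<alpha> s else 0) * T ^ (q ^ s))"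
      by (simp add: \<alpha>(3)[of T] sum_distrib_left sum_distrib_right algebra_simps)
    finally show ?thesis by (simp add: \<beta>_def sum.distrib algebra_simps)
  qed
  moreover have "\<beta> (Suc r) = 1" by (simp add: \<beta>_def \<alpha>(1))
  moreover have "\<beta> s \<in> VF {1..Suc r}" for s
  proof -
    define K where "K = VF {1..Suc r}"
    have K: "is_subfield K" by (simp add: K_def is_subfield_gen_field)
    have "VF {1..r} \<subseteq> K" unfolding K_def by (intro gen_field_mono) auto
    then have a: "\<alpha> u \<in> K" for u using \<alpha>(2) by auto
    have x: "V (Suc r) \<in> K" unfolding K_def by (intro gen_field_incl) auto
    have d: "?D \<in> K" unfolding \<alpha>(3)
      by (intro is_subfield_sum[OF K] is_subfieldD[OF K] a x)
    show ?thesis unfolding \<beta>_def K_def[symmetric]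
      by (cases s) (auto intro: is_subfieldD[OF K] a d)
  qed
  ultimately show ?case by (intro exI[of _ \<beta>]) auto
qed

lemma L_add: "r \<le> m \<Longrightarrow> L r (S + T) = L r S + L r T"
  using L_additive_poly[of r] by (auto simp: power_qs_add algebra_simps sum.distrib)

lemma L_lin: "c \<in> coefs r \<Longrightarrow> L r (lin c) = 0"
  unfolding L_def using finite_coefs by (intro prod_zero) (auto intro!: bexI[of _ c] simp: two_eq_0)

lemma L_V: "j \<in> {1..r} \<Longrightarrow> r \<le> m \<Longrightarrow> L r (V j) = 0"
  using V_eq_lin[of j r] L_lin by metis

text \<open>A vanishing factor would express \<open>V i\<close> through variables of index at most
  \<open>r\<close>. For \<open>i \<le> m\<close> this contradicts \<open>lin_inj\<close>, for larger
  \<open>i\<close> it contradicts \<open>indep_lin\<close>.\<close>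

lemma L_V_nonzero:
  assumes "r < i" "r \<le> m" "i \<le> 2*m+2"
  shows "L r (V i) \<noteq> 0"
proof
  assume "L r (V i) = 0"
  then obtain c where c: "c \<in> coefs r" "V i + lin c = 0"
    unfolding L_def using finite_coefs by (auto simp: prod_zero_iff)
  let ?d = "c(i := 1)"
  have ci: "c i = 0" using c assms by (force simp: coefs_def)
  have cm: "c \<in> coefs m" using c coefs_mono assms by blast
  show False
  proof (cases "i \<le> m")
    case True
    have "lin (\<lambda>j. if j = i then 1 else 0) = V i"
      using True assms unfolding lin_def by (subst sum.remove[of _ i]) (auto simp: C_1 C_0 intro!: sum.neutral)
    moreover have "(\<lambda>j. if j = i then 1 else 0) \<in> coefs m" using True assms by (auto simp: coefs_def)
    moreover have "V i = lin c" using c by (metis add_eq_0_iff2 uminus_eq)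
    ultimately have "c = (\<lambda>j. if j = i then 1 else 0)" using lin_inj cm by metis
    then show False using ci by simp
  next
    case False
    have "(\<Sum>j\<in>{i}. C 1 * V j) = lin c" using c by (simp add: C_1) (metis add_eq_0_iff2 uminus_eq)
    from indep_lin(2)[where b = "\<lambda>_. 1", OF this cm, of i] False assms show False by auto
  qed
qed

definition Lpoly :: "nat \<Rightarrow> 'k poly" where
  "Lpoly r = (\<Prod>c\<in>coefs r. [:lin c, 1:])"

lemma poly_Lpoly: "poly (Lpoly r) T = L r T"
  by (simp add: Lpoly_def L_def poly_prod add.commute)

lemma degree_Lpoly: "degree (Lpoly r) = q ^ r"
  unfolding Lpoly_def by (simp add: monic_prod_linear finite_coefs card_coefs)

lemma Lpoly_over: "r \<le> m \<Longrightarrow> VF {1..r} \<subseteq> gen_field H \<Longrightarrow> Lpoly r \<in> polys_over (gen_field H)"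
  unfolding Lpoly_def using lin_in_VF
  by (intro polys_over_prod polys_over_simps is_subfield_gen_field) auto

text \<open>These translates are the conjugates in the descent; their number is the degree of
  \<open>Lpoly r\<close>.\<close>

lemma card_translates: "r \<le> m \<Longrightarrow> card ((\<lambda>c. T + lin c) ` coefs r) = q ^ r"
  by (subst card_image) (auto simp: card_coefs intro!: inj_onI lin_inj intro: subsetD[OF coefs_mono])

end


subsection \<open>The tower of extensions\<close>

lemma degree_diff_const:
  assumes "degree (p :: 'k::field poly) > 0"
  shows "degree (p - [:c:]) = degree p"
proof -
  have "p - [:c:] = p + [:- c:]" by (simp add: diff_conv_add_uminus del: add_uminus_conv_diff)
  moreover have "degree (p + [:- c:]) = degree p" using assms by (intro degree_add_eq_left) simp
  ultimately show ?thesis by (simp only:)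
qed

section \<open>Equations over the generators and the descent through the tower\<close>

context gf_vars begin

text \<open>The orbit products in closed form, tied to \<open>N\<close> by
  \<open>to_fract_N\<close>; likewise \<open>hV\<close> below stands for \<open>h\<close> by
  \<open>to_fract_h\<close>. The minimum matters at \<open>i = m + 2\<close>, whose orbit consists
  of translates by the first \<open>m\<close> variables only.\<close>

definition NV :: "nat \<Rightarrow> 'k" where
  "NV i = L (min (i - 1) m) (V i)"

definition hV :: "'a \<Rightarrow> nat \<Rightarrow> 'k" where
  "hV a k = (if k = 1 then minus_form (C a) m V
     else \<Sum>i=1..m+1. V (2*m+3-i) ^ (q ^ (k-1)) * V i + V (2*m+3-i) * V i ^ (q ^ (k-1)))"

text \<open>Expanding both factors by \<open>L_additive_poly\<close> gives the shape of
  \<open>twisted_sum_in_subfield\<close>. The condition \<open>r < m\<close> keeps the indices of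
  the \<open>hV a k\<close> that occur within \<open>{1..m}\<close>.\<close>

lemma L_paired_sum_in_subfield:
  assumes K: "is_subfield K" and CK: "range C \<subseteq> K" and V: "\<And>j. j \<in> {1..m+2} \<Longrightarrow> V j \<in> K"
    and h: "\<And>k. k \<in> {1..m} \<Longrightarrow> hV a k \<in> K" and r: "r < m"
  shows "(\<Sum>j=1..m. L r (V j) * L r (V (2*m+3-j))) \<in> K"
proof -
  obtain \<alpha> where \<alpha>: "\<And>s. \<alpha> s \<in> VF {1..r}" "\<And>T. L r T = (\<Sum>s\<le>r. \<alpha> s * T ^ (q ^ s))"
    using L_additive_poly[of r] r by auto
  have "VF {1..r} \<subseteq> K" using CK V r by (intro gen_field_least[OF K]) auto
  then have \<alpha>K: "\<alpha> s \<in> K" for s using \<alpha>(1) by auto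
  define M where "M s t = (\<Sum>j=1..m. V j ^ (q ^ s) * V (2*m+3-j) ^ (q ^ t))" for s t
  have VK: "V (Suc m) \<in> K" "V (Suc (Suc m)) \<in> K" using V[of "m+1"] V[of "m+2"] by auto
  have "(\<Sum>j=1..m. L r (V j) * L r (V (2*m+3-j))) = (\<Sum>j=1..m. \<Sum>s\<le>r. \<Sum>t\<le>r. \<alpha> s * \<alpha> t * (V j ^ (q ^ s) * V (2*m+3-j) ^ (q ^ t)))"
    by (simp add: \<alpha>(2) sum_product algebra_simps)
  also have "\<dots> = (\<Sum>s\<le>r. \<Sum>t\<le>r. \<alpha> s * \<alpha> t * M s t)"
    unfolding M_def sum_distrib_left
    by (simp only: sum.swap[where A = "{1..m}"])
  also have "\<dots> \<in> K"
  proof (rule twisted_sum_in_subfield[OF K])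
    fix s
    \<comment> \<open>The diagonal value \<open>M s s\<close> is the \<open>q ^ s\<close>-th power
      of this sum, the hyperbolic part of the quadratic form; the remaining terms of the form
      involve only \<open>V (m+1)\<close> and \<open>V (m+2)\<close>.\<close>
    have "(\<Sum>j=1..m. V j * V (2*m+3-j)) =
      hV a 1 + (V (m+1) ^ 2 + V (m+1) * V (m+2) + C a * V (m+2) ^ 2)"
      unfolding hV_def minus_form_def by (simp add: ac_simps two_eq_0')
    also have "\<dots> \<in> K"
      using h[of 1] r CK VK by (auto intro!: is_subfieldD[OF K])
    finally have "(\<Sum>j=1..m. V j * V (2*m+3-j)) ^ (q ^ s) \<in> K" by (intro is_subfieldD[OF K])
    then show "M s s \<in> K" unfolding M_def power_q_sum by (simp add: power_mult_distrib)
  next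
    fix s t assume st: "s < t" "t \<le> r"
    define d where "d = t - s"
    have d: "t = d + s" "d \<noteq> 0" "d < m" using st r by (auto simp: d_def)
    \<comment> \<open>Pulling out the power \<open>q ^ s\<close> leaves the exponents 1 and
      \<open>q ^ d\<close>. The sum in \<open>hV\<close> has one more term, at index
      \<open>m+1\<close>, which pairs \<open>V (m+1)\<close> with \<open>V (m+2)\<close> and is
      moved across.\<close>
    have "(\<Sum>j=1..m. V (2*m+3-j) ^ (q ^ d) * V j + V (2*m+3-j) * V j ^ (q ^ d))
      = hV a (Suc d) + (V (m+2) ^ (q ^ d) * V (m+1) + V (m+2) * V (m+1) ^ (q ^ d))"
      unfolding hV_def using d by (simp add: algebra_simps two_eq_0')
    also have "\<dots> \<in> K"
      using h[of "Suc d"] d VK by (auto intro!: is_subfieldD[OF K])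
    finally have "(\<Sum>j=1..m. V (2*m+3-j) ^ (q ^ d) * V j + V (2*m+3-j) * V j ^ (q ^ d)) ^ (q ^ s) \<in> K"
      by (intro is_subfieldD[OF K])
    then show "M s t + M t s \<in> K"
      unfolding M_def power_q_sum sum.distrib[symmetric] power_qs_add d(1)
      by (simp add: power_mult_distrib power_add algebra_simps flip: power_mult)
  qed (rule \<alpha>K)
  finally show ?thesis .
qed

text \<open>In the paired sum for \<open>r = i - 1\<close>, the terms with \<open>j < i\<close>
  vanish and those with \<open>j > i\<close> have both factors in \<open>K\<close>. So the product
  at \<open>j = i\<close> is in \<open>K\<close>, and its factor \<open>L r (V i)\<close> is in
  \<open>K\<close> and nonzero.\<close>

lemma L_isotropic_in_subfield:
  assumes K: "is_subfield K" and CK: "range C \<subseteq> K" and V: "\<And>j. j \<in> {1..<2*m+3-i} \<Longrightarrow> V j \<in> K"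
    and h: "\<And>k. k \<in> {1..m} \<Longrightarrow> hV a k \<in> K" and i: "i \<in> {1..m}"
  shows "L (i - 1) (V (2*m+3-i)) \<in> K"
proof -
  define r where "r = i - 1"
  have r: "r < m" using i by (auto simp: r_def)
  have LK: "L r (V j) \<in> K" if "V j \<in> K" for j
  proof -
    have "VF {1..r} \<subseteq> K" using CK V r i by (intro gen_field_least[OF K]) auto
    then show ?thesis unfolding L_def using lin_in_VF[of _ r] r that
      by (intro is_subfield_prod[OF K] is_subfieldD(3)[OF K]) auto
  qed
  let ?g = "\<lambda>j. L r (V j) * L r (V (2*m+3-j))"
  have total: "(\<Sum>j=1..m. ?g j) \<in> K"
    by (rule L_paired_sum_in_subfield[OF K CK V h r]) (use i in auto)
  have split: "(\<Sum>j=1..m. ?g j) = ?g i + (\<Sum>j\<in>{1..m}-{i}. ?g j)"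
    by (rule sum.remove) (use i in auto)
  have rest: "(\<Sum>j\<in>{1..m}-{i}. ?g j) \<in> K"
  proof (rule is_subfield_sum[OF K])
    fix j assume j: "j \<in> {1..m} - {i}"
    show "?g j \<in> K"
    proof (cases "j < i")
      case True
      then have "L r (V j) = 0" using L_V[of j r] j r by (auto simp: r_def)
      then show ?thesis using is_subfieldD(2)[OF K] by simp
    next
      case False
      then have "V j \<in> K" "V (2*m+3-j) \<in> K" using j by (auto intro!: V)
      then show ?thesis using LK by (intro is_subfieldD(4)[OF K]) auto
    qed
  qed
  have "?g i \<in> K" using is_subfieldD(7)[OF K total rest] unfolding split add_diff_cancel_right' .
  moreover have "L r (V i) \<in> K" using i by (intro LK V) auto
  moreover have "L r (V i) \<noteq> 0" using i by (intro L_V_nonzero) (auto simp: r_def)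
  ultimately have "?g i / L r (V i) \<in> K" by (intro is_subfieldD(8)[OF K])
  then show ?thesis using \<open>L r (V i) \<noteq> 0\<close> by (simp add: r_def)
qed

lemma tower_step:
  assumes "P \<in> polys_over (gen_field (E \<union> V ` S))" "P \<noteq> 0" "poly P (V i) = 0" "degree P \<le> card R"
    and "\<And>r. r \<in> R \<Longrightarrow> \<exists>\<sigma>. ring_endo \<sigma> \<and> (\<forall>x\<in>E. \<sigma> x = x) \<and> \<sigma> f = f \<and> (\<forall>j\<in>S. \<sigma> (V j) = V j) \<and> \<sigma> (V i) = r"
    and "f \<in> gen_field (E \<union> V ` insert i S)"
  shows "f \<in> gen_field (E \<union> V ` S)"
proof (rule invariant_in_base[OF assms(1-4)])
  fix r assume "r \<in> R"
  from assms(5)[OF this] show "\<exists>\<sigma>. ring_endo \<sigma> \<and> (\<forall>x\<in>E \<union> V ` S. \<sigma> x = x) \<and> \<sigma> f = f \<and> \<sigma> (V i) = r"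
    by blast
qed (use assms(6) in simp)

text \<open>The descent itself. \<open>shear\<close> provides the conjugates
  \<open>V k + lin c\<close> while fixing what is adjoined before \<open>V k\<close>; the condition
  \<open>r \<le> m+2 \<or> r < k\<close> allows for the place of \<open>V (m+2)\<close> before
  \<open>V (m+1)\<close>. \<open>shear'\<close> provides the second half of the conjugates of
  \<open>V (m+1)\<close>.\<close>

theorem invariants_generated:
  assumes endo: "\<And>\<sigma>. \<sigma> \<in> \<Gamma> \<Longrightarrow> ring_endo \<sigma>" and fixE: "\<And>\<sigma> x. \<sigma> \<in> \<Gamma> \<Longrightarrow> x \<in> E \<Longrightarrow> \<sigma> x = x"
    and shear: "\<And>k c. k \<in> {1..2*m+2} \<Longrightarrow> c \<in> coefs m \<Longrightarrow> (\<And>j. c j \<noteq> 0 \<Longrightarrow> j < k \<and> j < 2*m+3-k) \<Longrightarrow>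
      \<exists>\<sigma>\<in>\<Gamma>. \<sigma> (V k) = V k + lin c \<and> (\<forall>r\<in>{1..2*m+2}. r \<noteq> k \<and> (r \<le> m+2 \<or> r < k) \<longrightarrow> \<sigma> (V r) = V r)"
    and shear': "\<And>c. c \<in> coefs m \<Longrightarrow>
      \<exists>\<sigma>\<in>\<Gamma>. \<sigma> (V (m+1)) = V (m+1) + V (m+2) + lin c \<and> (\<forall>r\<in>insert (m+2) {1..m}. \<sigma> (V r) = V r)"
    and E: "range C \<subseteq> E" "V 1 \<in> E" "\<And>i. i \<in> {2..m} \<Longrightarrow> NV i \<in> E" "NV (m+2) \<in> E"
      "NV (m+1) ^ 2 + NV (m+2) * NV (m+1) \<in> E" "\<And>k. k \<in> {1..m} \<Longrightarrow> hV a k \<in> E"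
    and f: "f \<in> gen_field (E \<union> V ` {1..2*m+2})" "\<And>\<sigma>. \<sigma> \<in> \<Gamma> \<Longrightarrow> \<sigma> f = f"
  shows "f \<in> gen_field E"
proof -
  let ?K = "\<lambda>S. gen_field (E \<union> V ` S)"
  note sub = is_subfield_gen_field
  have VFK: "VF S' \<subseteq> ?K S" if "S' \<subseteq> S" for S S'
    using E(1) that by (intro gen_field_mono) auto
  have EK: "x \<in> ?K S" if "x \<in> E" for x S using that by (intro gen_field_incl) auto
  \<comment> \<open>Common step for every variable except \<open>V (m+1)\<close>: it is a root of
    \<open>L r\<close> minus its own value, of degree \<open>q ^ r\<close>, and \<open>shear\<close>
    gives \<open>q ^ r\<close> conjugates.\<close>
  have step: "f \<in> ?K S"
    if st: "f \<in> ?K (insert k S)" "k \<in> {1..2*m+2}" "r \<le> m" "r < k" "r < 2*m+3-k" "S \<subseteq> {1..2*m+2}"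
      "\<And>j. j \<in> S \<Longrightarrow> j \<noteq> k \<and> (j \<le> m+2 \<or> j < k)" "{1..r} \<subseteq> S" "L r (V k) \<in> ?K S" for k r S
  proof -
    let ?P = "Lpoly r - [:L r (V k):]"
    have d: "degree ?P = q ^ r" using degree_diff_const[of "Lpoly r"] q_ge_2 by (simp add: degree_Lpoly)
    show ?thesis
    proof (rule tower_step[where P = ?P and R = "(\<lambda>c. V k + lin c) ` coefs r" and i = k])
      show "?P \<in> polys_over (?K S)"
        using st VFK by (intro polys_over_simps sub Lpoly_over) auto
      have "degree ?P > 0" unfolding d using q_ge_2 by simp
      then show "?P \<noteq> 0" by force
      show "poly ?P (V k) = 0" by (simp add: poly_Lpoly)
      show "degree ?P \<le> card ((\<lambda>c. V k + lin c) ` coefs r)"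
        using d card_translates st by simp
      fix t assume "t \<in> (\<lambda>c. V k + lin c) ` coefs r"
      then obtain c where c: "c \<in> coefs r" "t = V k + lin c" by auto
      have "c \<in> coefs m" using c st coefs_mono by blast
      moreover have "j < k \<and> j < 2*m+3-k" if "c j \<noteq> 0" for j
      proof -
        have "j \<le> r" using c(1) that by (force simp: coefs_def)
        then show ?thesis using \<open>r < k\<close> \<open>r < 2*m+3-k\<close> by linarith
      qed
      ultimately obtain \<sigma> where \<sigma>: "\<sigma> \<in> \<Gamma>" "\<sigma> (V k) = V k + lin c"
        "\<And>r. r \<in> {1..2*m+2} \<Longrightarrow> r \<noteq> k \<Longrightarrow> r \<le> m+2 \<or> r < k \<Longrightarrow> \<sigma> (V r) = V r"
        using shear[of k c] st(2) by auto
      show "\<exists>\<sigma>. ring_endo \<sigma> \<and> (\<forall>x\<in>E. \<sigma> x = x) \<and> \<sigma> f = f \<and> (\<forall>j\<in>S. \<sigma> (V j) = V j) \<and> \<sigma> (V k) = t"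
        using \<sigma> endo fixE f(2) c(2) st(6,7) by (intro exI[of _ \<sigma>]) blast
    qed (use st in auto)
  qed

  \<comment> \<open>The variables are removed from the highest index downwards; the one removed next
    is \<open>V (2*m+2-n)\<close>.\<close>
  have "f \<in> ?K {1..2*m+2-n}" if "n \<le> m" for n using that
  proof (induction n)
    case 0
    then show ?case using f by simp
  next
    case (Suc n)
    let ?i = "Suc n"
    let ?k = "2*m+3-?i"
    let ?S = "{1..2*m+2-?i}"
    have ins: "{1..2*m+2-n} = insert ?k ?S" using Suc.prems by auto
    have "L (?i - 1) (V ?k) \<in> ?K ?S"
    proof (rule L_isotropic_in_subfield[OF sub])
      show "range C \<subseteq> ?K ?S" using E(1) EK by blast
      show "\<And>j. j \<in> {1..<?k} \<Longrightarrow> V j \<in> ?K ?S"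
        using Suc.prems by (intro gen_field_incl UnI2 imageI) auto
      show "\<And>k. k \<in> {1..m} \<Longrightarrow> hV a k \<in> ?K ?S" using E(6) EK by blast
    qed (use Suc.prems in auto)
    then show ?case
      using Suc.prems Suc.IH unfolding ins by (intro step[of ?k ?S "?i - 1"]) auto
  qed
  from this[of m] have "f \<in> ?K {1..m+2}" by simp
  moreover have "{1..m+2} = insert (m+1) (insert (m+2) {1..m})" by auto
  ultimately have 1: "f \<in> ?K (insert (m+1) (insert (m+2) {1..m}))" by (simp only:)
  let ?S = "insert (m+2) {1..m}"
  let ?Z = "NV (m+1) ^ 2 + NV (m+2) * NV (m+1)"
  \<comment> \<open>The generator \<open>?Z\<close> is the value of \<open>?Q\<close> at
    \<open>V (m+1)\<close>. The degree, twice \<open>q ^ m\<close>, matches the two disjoint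
    families of conjugates collected in \<open>?R\<close>.\<close>
  let ?Q = "Lpoly m * (Lpoly m + [:NV (m+2):])"
  let ?P = "?Q - [:?Z:]"
  let ?T = "\<lambda>v. (\<lambda>c. v + lin c) ` coefs m"
  let ?R = "?T (V (m+1)) \<union> ?T (V (m+1) + V (m+2))"
  have dL: "degree (Lpoly m + [:NV (m+2):]) = q ^ m"
    using q_ge_2 by (simp add: degree_add_eq_left degree_Lpoly)
  then have "degree ?Q = 2 * q ^ m"
    using q_ge_2 degree_Lpoly[of m] by (subst degree_mult_eq) (auto simp: degree_Lpoly)
  then have dP: "degree ?P = 2 * q ^ m"
    using degree_diff_const[of ?Q] q_ge_2 by simp
  have "f \<in> ?K ?S"
  proof (rule tower_step[where P = ?P and R = ?R and i = "m+1", OF _ _ _ _ _ 1])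
    show "?P \<in> polys_over (?K ?S)"
      by (intro polys_over_simps sub Lpoly_over VFK EK E) auto
    have "degree ?P > 0" unfolding dP using q_ge_2 by simp
    then show "?P \<noteq> 0" by force
    show "poly ?P (V (m+1)) = 0"
      by (simp add: poly_Lpoly NV_def power2_eq_square algebra_simps)
    \<comment> \<open>A common element would put \<open>V (m+2)\<close> into the span of the first
      \<open>m\<close> variables.\<close>
    have "?T (V (m+1)) \<inter> ?T (V (m+1) + V (m+2)) = {}"
    proof (rule ccontr)
      assume "\<not> ?thesis"
      then obtain c d where cd: "c \<in> coefs m" "d \<in> coefs m" "V (m+1) + lin c = V (m+1) + V (m+2) + lin d"
        by auto
      have "V (m+2) = lin (\<lambda>j. c j + d j)"
        unfolding lin_add using cd(3) by (simp add: add.assoc two_eq_0)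
      then have "(\<Sum>j\<in>{m+2}. C 1 * V j) = lin (\<lambda>j. c j + d j)" by (simp add: C_1)
      from indep_lin(2)[where b = "\<lambda>_. 1", OF this coefs_add[OF cd(1,2)], of "m+2"] show False by simp
    qed
    then have "card ?R = 2 * q ^ m"
      by (subst card_Un_disjoint) (auto simp: finite_coefs card_translates)
    then show "degree ?P \<le> card ?R" using dP by simp
    fix t assume "t \<in> ?R"
    then show "\<exists>\<sigma>. ring_endo \<sigma> \<and> (\<forall>x\<in>E. \<sigma> x = x) \<and> \<sigma> f = f \<and> (\<forall>j\<in>?S. \<sigma> (V j) = V j) \<and> \<sigma> (V (m+1)) = t"
    proof
      assume "t \<in> ?T (V (m+1))"
      then obtain c where c: "c \<in> coefs m" "t = V (m+1) + lin c" by auto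
      have "j < m+1 \<and> j < 2*m+3-(m+1)" if "c j \<noteq> 0" for j
      proof -
        have "j \<le> m" using c(1) that by (force simp: coefs_def)
        then show ?thesis by linarith
      qed
      from shear[OF _ c(1) this] obtain \<sigma> where \<sigma>: "\<sigma> \<in> \<Gamma>" "\<sigma> (V (m+1)) = t"
        "\<And>r. r \<in> {1..2*m+2} \<Longrightarrow> r \<noteq> m+1 \<Longrightarrow> r \<le> m+2 \<or> r < m+1 \<Longrightarrow> \<sigma> (V r) = V r"
        using c(2) by auto
      have "\<forall>j\<in>?S. \<sigma> (V j) = V j" by (auto intro!: \<sigma>(3))
      then show ?thesis using \<sigma>(1,2) endo fixE f(2) by (intro exI[of _ \<sigma>]) blast
    next
      assume "t \<in> ?T (V (m+1) + V (m+2))"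
      then obtain c where c: "c \<in> coefs m" "t = V (m+1) + V (m+2) + lin c" by auto
      from shear'[OF c(1)] obtain \<sigma> where "\<sigma> \<in> \<Gamma>" "\<sigma> (V (m+1)) = t" "\<forall>r\<in>?S. \<sigma> (V r) = V r"
        using c(2) by auto
      then show ?thesis using endo fixE f(2) by (intro exI[of _ \<sigma>]) blast
    qed
  qed
  moreover have "L m (V (m+2)) \<in> ?K {1..m}" using EK[OF E(4)] by (simp add: NV_def)
  ultimately have "f \<in> ?K {1..m}" by (intro step[of "m+2" "{1..m}" m]) auto
  \<comment> \<open>The same counting removes \<open>V m\<close> down to \<open>V 1\<close>; at the
    end \<open>L 0\<close> is the identity and the value required in the field is \<open>V 1\<close>
    itself.\<close>
  then have "f \<in> ?K {1..m-n}" if "n \<le> m" for n using that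
  proof (induction n)
    case 0
    then show ?case by simp
  next
    case (Suc n)
    let ?k = "m - n"
    have ins: "{1..m-n} = insert ?k {1..m-Suc n}" using Suc.prems by auto
    have "L (?k - 1) (V ?k) \<in> ?K {1..m - Suc n}"
    proof (cases "?k = 1")
      case True
      then have "L (?k - 1) (V ?k) = V 1" by (simp add: L_0)
      then show ?thesis using EK[OF E(2)] by (simp only:)
    next
      case False
      then have "NV ?k \<in> E" using Suc.prems by (intro E(3)) auto
      moreover have "NV ?k = L (?k - 1) (V ?k)" by (simp add: NV_def min_def)
      ultimately show ?thesis using EK by simp
    qed
    then show ?case using Suc.prems Suc.IH unfolding ins
      by (intro step[of ?k "{1..m-Suc n}" "?k - 1"]) auto
  qed
  from this[of m] show ?thesis by simp
qed

end


subsection \<open>Invariance of the generators\<close>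

text \<open>The bilinear form that polarises \<open>minus_form\<close> when \<open>2 = 0\<close>.
  Its summand \<open>i = m + 1\<close> comes from the product of coordinates \<open>m + 1\<close>
  and \<open>m + 2\<close>; the square terms contribute nothing.\<close>

definition polar :: "nat \<Rightarrow> (nat \<Rightarrow> 'b::comm_ring_1) \<Rightarrow> (nat \<Rightarrow> 'b) \<Rightarrow> 'b" where
  "polar m x y = (\<Sum>i=1..m+1. x (2*m+3-i) * y i + x i * y (2*m+3-i))"

lemma minus_form_add_scaled:
  fixes x y :: "nat \<Rightarrow> 'b::comm_ring_1"
  assumes "\<And>z::'b. z + z = 0"
  shows "minus_form a m (\<lambda>i. x i + z * y i) = minus_form a m x + z ^ 2 * minus_form a m y + z * polar m x y"
proof -
  have 2: "2 * (u::'b) = 0" for u using assms[of u] by (simp only: mult_2)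
  have "(\<Sum>i=1..m. (x (2*m+3-i) + z * y (2*m+3-i)) * (x i + z * y i)) =
    (\<Sum>i=1..m. x (2*m+3-i) * x i) + z ^ 2 * (\<Sum>i=1..m. y (2*m+3-i) * y i)
    + z * (\<Sum>i=1..m. x (2*m+3-i) * y i + x i * y (2*m+3-i))"
    by (simp add: sum.distrib sum_distrib_left algebra_simps power2_eq_square)
  then show ?thesis
    unfolding minus_form_def polar_def
    by (simp add: algebra_simps power2_eq_square) (simp add: 2)
qed

lemma minus_form_cong:
  assumes "\<And>i. i \<in> {1..2*m+2} \<Longrightarrow> x i = y i"
  shows "minus_form a m x = minus_form a m y"
proof -
  have 1: "i \<in> {1..m} \<Longrightarrow> x i = y i" "i \<in> {1..m} \<Longrightarrow> x (2*m+3-i) = y (2*m+3-i)"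
    "x (m+1) = y (m+1)" "x (m+2) = y (m+2)" for i
    by (rule assms; auto)+
  have "(\<Sum>i=1..m. x (2*m+3-i) * x i) = (\<Sum>i=1..m. y (2*m+3-i) * y i)"
    by (rule sum.cong) (simp_all only: 1(1,2))
  then show ?thesis unfolding minus_form_def 1(3,4) by (simp only:)
qed

lemma polar_sum:
  "polar m (\<lambda>i. \<Sum>j\<in>A. f j i) y = (\<Sum>j\<in>A. polar m (f j) y)"
  unfolding polar_def sum_distrib_right sum.distrib[symmetric] by (rule sum.swap)

lemma polar_scale: "polar m (\<lambda>i. z * x i) y = z * polar m x y"
  unfolding polar_def sum_distrib_left by (simp add: algebra_simps)

text \<open>A quadratic form at a linear combination is determined by its values and polar values at
  the vectors combined.\<close>

lemma minus_form_sum_eqI: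
  fixes w w' :: "'j \<Rightarrow> nat \<Rightarrow> 'b::comm_ring_1"
  assumes 2: "\<And>z::'b. z + z = 0" and "finite A"
    and "\<And>j. minus_form a m (w j) = minus_form a m (w' j)"
    and "\<And>j l. polar m (w j) (w l) = polar m (w' j) (w' l)"
  shows "minus_form a m (\<lambda>i. \<Sum>j\<in>A. Z j * w j i) = minus_form a m (\<lambda>i. \<Sum>j\<in>A. Z j * w' j i)"
  using \<open>finite A\<close>
proof induction
  case (insert j A)
  have expand: "minus_form a m (\<lambda>i. \<Sum>j\<in>insert j A. Z j * v j i) =
      minus_form a m (\<lambda>i. \<Sum>j\<in>A. Z j * v j i) + Z j ^ 2 * minus_form a m (v j)
      + Z j * (\<Sum>l\<in>A. Z l * polar m (v l) (v j))" for v :: "'j \<Rightarrow> nat \<Rightarrow> 'b"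
    using minus_form_add_scaled[OF 2, of a m "\<lambda>i. \<Sum>j\<in>A. Z j * v j i" "Z j" "v j"] insert.hyps
    by (simp add: add.commute polar_sum polar_scale)
  show ?case unfolding expand insert.IH assms(3,4) ..
qed simp

lemma polar_eq:
  fixes x y :: "nat \<Rightarrow> 'b::comm_ring_1"
  assumes "\<And>z::'b. z + z = 0"
  shows "polar m x y = minus_form a m (\<lambda>i. x i + y i) + minus_form a m x + minus_form a m y"
proof -
  have 2: "minus_form a m (\<lambda>i. x i + y i) = minus_form a m x + minus_form a m y + polar m x y"
    using minus_form_add_scaled[OF assms, of a m x 1 y] by simp
  have "minus_form a m (\<lambda>i. x i + y i) + minus_form a m x + minus_form a m y
    = polar m x y + (minus_form a m x + minus_form a m x) + (minus_form a m y + minus_form a m y)"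
    unfolding 2 by (simp add: algebra_simps)
  then show ?thesis by (simp add: assms)
qed

section \<open>Extension of scalars and invariance of the forms\<close>

context gf_vars begin

lemma C_sum: "C (sum f A) = (\<Sum>i\<in>A. C (f i))"
  by (induction A rule: infinite_finite_induct) (auto simp: C_0 C_add)

lemma C_minus_form: "C (minus_form a m z) = minus_form (C a) m (\<lambda>i. C (z i))"
  unfolding minus_form_def by (simp add: C_add C_mult C_sum C_power)

lemma C_polar: "C (polar m x y) = polar m (\<lambda>i. C (x i)) (\<lambda>i. C (y i))"
  unfolding polar_def by (simp add: C_add C_mult C_sum)

lemma two_eq_0_base: "x + x = (0::'a)"
  by (metis C_eq_0 C_add two_eq_0)

text \<open>Over a finite field an identity of values need not be one of polynomials. Here it is,
  since a quadratic form is determined by its values at basis vectors and at sums of two of them,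
  which are available over the small field.\<close>

lemma minus_form_extend_scalars:
  assumes inv: "\<And>z::nat \<Rightarrow> 'a. minus_form a m (\<lambda>i. \<Sum>j=1..2*m+2. D i j * z j) = minus_form a m z"
  shows "minus_form (C a) m (\<lambda>i. \<Sum>j=1..2*m+2. C (D i j) * Z j) = minus_form (C a) m Z"
proof -
  let ?J = "{1..2*m+2}"
  \<comment> \<open>\<open>e j\<close> is the standard basis vector, or 0 for \<open>j\<close>
    outside \<open>?J\<close>; \<open>w j\<close> is its image under \<open>D\<close>.\<close>
  define e where "e j i = (if i = j \<and> j \<in> ?J then 1 else 0 :: 'a)" for i j :: nat
  define w where "w j i = (\<Sum>l\<in>?J. D i l * e j l)" for j i
  have q: "minus_form a m (w j) = minus_form a m (e j)" for j
    unfolding w_def by (rule inv)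
  have "minus_form a m (\<lambda>i. w j i + w l i) = minus_form a m (\<lambda>i. e j i + e l i)" for j l
    using inv[of "\<lambda>i. e j i + e l i"] by (simp add: w_def algebra_simps sum.distrib)
  then have p: "polar m (w j) (w l) = polar m (e j) (e l)" for j l
    unfolding polar_eq[OF two_eq_0_base, where a = a] q by (simp only:)
  have we: "w j i = D i j" if "j \<in> ?J" for i j
    using that unfolding w_def e_def by (subst sum.remove[of _ j]) (auto intro!: sum.neutral)
  have "minus_form (C a) m (\<lambda>i. \<Sum>j\<in>?J. C (D i j) * Z j)
    = minus_form (C a) m (\<lambda>i. \<Sum>j\<in>?J. Z j * C (w j i))"
    by (intro arg_cong[where f = "minus_form (C a) m"] ext sum.cong) (auto simp: we)
  also have "\<dots> = minus_form (C a) m (\<lambda>i. \<Sum>j\<in>?J. Z j * C (e j i))"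
    by (rule minus_form_sum_eqI[OF two_eq_0]) (simp_all only: C_polar[symmetric] C_minus_form[symmetric] p q finite_atLeastAtMost)
  also have "\<dots> = minus_form (C a) m Z"
  proof (rule minus_form_cong)
    fix i assume "i \<in> ?J"
    then show "(\<Sum>j\<in>?J. Z j * C (e j i)) = Z i"
      unfolding e_def by (subst sum.remove[of _ i]) (auto simp: C_1 C_0 intro!: sum.neutral)
  qed
  finally show ?thesis .
qed

text \<open>Exhibits \<open>hV\<close> as the polar value of the generic vector and its Frobenius
  twist.\<close>

lemma hV_eq_polar: "k > 1 \<Longrightarrow> hV a k = polar m V (\<lambda>i. V i ^ (q ^ (k - 1)))"
  unfolding hV_def polar_def by (subst if_not_P, simp) (intro sum.cong refl, simp only: ac_simps)

text \<open>The twist of the generic vector transforms by the same matrix \<open>D\<close>, because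
  the \<open>q\<close>-th power fixes constants. So for \<open>k > 1\<close> the claim follows from
  the invariance of the quadratic form at the vector, the twist and their sum.\<close>

lemma hV_fixed:
  assumes \<sigma>: "ring_endo \<sigma>" "\<And>x. \<sigma> (C x) = C x"
    and V: "\<And>i. i \<in> {1..2*m+2} \<Longrightarrow> \<sigma> (V i) = (\<Sum>j=1..2*m+2. C (D i j) * V j)"
    and inv: "\<And>z::nat \<Rightarrow> 'a. minus_form a m (\<lambda>i. \<Sum>j=1..2*m+2. D i j * z j) = minus_form a m z"
  shows "\<sigma> (hV a k) = hV a k"
proof -
  note S = ring_endoD(1-9)[OF \<sigma>(1)]
  let ?D = "\<lambda>Z i. \<Sum>j=1..2*m+2. C (D i j) * Z j"
  let ?Vk = "\<lambda>i. V i ^ (q ^ (k - 1))"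
  have inv': "minus_form (C a) m (?D Z) = minus_form (C a) m Z" for Z
    by (rule minus_form_extend_scalars[OF inv])
  have \<sigma>Q: "\<sigma> (minus_form (C a) m Z) = minus_form (C a) m (\<lambda>i. \<sigma> (Z i))" for Z
    unfolding minus_form_def by (simp only: S \<sigma>(2))
  show ?thesis
  proof (cases "k > 1")
    case False
    have "\<sigma> (minus_form (C a) m V) = minus_form (C a) m (?D V)"
      unfolding \<sigma>Q by (rule minus_form_cong) (rule V)
    then have 1: "\<sigma> (minus_form (C a) m V) = minus_form (C a) m V" unfolding inv' .
    show ?thesis
    proof (cases "k = 1")
      case True
      then show ?thesis using 1 by (simp add: hV_def)
    next
      case False
      \<comment> \<open>Truncated subtraction makes the exponent \<open>q ^ 0\<close> here, so equal
        summands are added and give 0.\<close>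
      then have "k = 0" using \<open>\<not> k > 1\<close> by simp
      then show ?thesis by (simp add: hV_def two_eq_0 mult.commute S(2) S(8))
    qed
  next
    case True
    have pow: "?D ?Vk i = (?D V i) ^ (q ^ (k - 1))" for i
      by (simp only: power_q_sum power_mult_distrib C_power_qs)
    have sum: "?D (\<lambda>i. V i + ?Vk i) i = ?D V i + ?D ?Vk i" for i
      by (simp only: distrib_left sum.distrib)
    have \<sigma>V: "\<sigma> (V i) = ?D V i" "\<sigma> (?Vk i) = ?D ?Vk i" "\<sigma> (V i + ?Vk i) = ?D (\<lambda>i. V i + ?Vk i) i"
      if "i \<in> {1..2*m+2}" for i
      unfolding pow sum S V[OF that] by (rule refl)+
    have fixd: "\<sigma> (minus_form (C a) m Z) = minus_form (C a) m Z"
      if "\<And>i. i \<in> {1..2*m+2} \<Longrightarrow> \<sigma> (Z i) = ?D Z i" for Z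
      unfolding \<sigma>Q by (subst inv'[symmetric], rule minus_form_cong) (rule that)
    show ?thesis
      unfolding hV_eq_polar[OF True] polar_eq[OF two_eq_0, where a = "C a"] S
      by (intro arg_cong2[where f = "(+)"] fixd \<sigma>V)
  qed
qed

section \<open>Invariance of the orbit products\<close>

lemma sum_in_lin_coefs:
  assumes "\<And>j. j \<in> A \<Longrightarrow> f j \<in> lin ` coefs r"
  shows "sum f A \<in> lin ` coefs r"
  using assms
proof (induction A rule: infinite_finite_induct)
  case (insert j A)
  then obtain c d where "f j = lin c" "c \<in> coefs r" "sum f A = lin d" "d \<in> coefs r" by fastforce
  then have "sum f (insert j A) = lin (\<lambda>j. c j + d j)" "(\<lambda>j. c j + d j) \<in> coefs r"
    using insert.hyps coefs_add by (auto simp: lin_add)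
  then show ?case by blast
qed (auto intro!: image_eqI[of _ _ "\<lambda>_. 0"] simp: lin_0 coefs_def)

text \<open>A unitriangular \<open>\<sigma>\<close> maps the span of the first \<open>r\<close>
  variables injectively into itself; the span is finite, so \<open>\<sigma>\<close> permutes it and
  with it the factors of the product.\<close>

lemma L_equivariant:
  assumes \<sigma>: "ring_endo \<sigma>" "\<And>x. \<sigma> (C x) = C x"
    and tri: "\<And>j. j \<in> {1..r} \<Longrightarrow> \<exists>c\<in>coefs (j - 1). \<sigma> (V j) = V j + lin c" and r: "r \<le> m"
  shows "\<sigma> (L r T) = L r (\<sigma> T)"
proof -
  note S = ring_endoD(1-9)[OF \<sigma>(1)]
  let ?W = "lin ` coefs r"
  have inj: "inj_on lin (coefs r)"
    using lin_inj coefs_mono[OF r] by (intro inj_onI) blast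
  have L: "L r T = (\<Prod>w\<in>?W. T + w)" for T
    unfolding L_def by (simp add: prod.reindex[OF inj])
  have "\<sigma> w \<in> ?W" if w: "w \<in> ?W" for w
  proof -
    obtain c where c: "c \<in> coefs r" "w = lin c" using w by auto
    have "C (c j) * \<sigma> (V j) \<in> ?W" for j
    proof (cases "j \<in> {1..r}")
      case True
      then obtain d b where d: "d \<in> coefs (j - 1)" "\<sigma> (V j) = V j + lin d"
        and b: "b \<in> coefs r" "V j = lin b" using tri V_eq_lin[OF True r] by metis
      have "j - 1 \<le> r" using True by auto
      then have "d \<in> coefs r" using d(1) coefs_mono by blast
      moreover have "C (c j) * \<sigma> (V j) = lin (\<lambda>i. c j * (b i + d i))"
        unfolding d(2) lin_mult lin_add b(2)[symmetric] ..
      ultimately show ?thesis using coefs_mult[OF coefs_add[OF b(1), of d]] by blast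
    next
      case False
      then have "C (c j) * \<sigma> (V j) = lin (\<lambda>_. 0)" using c(1) by (simp add: coefs_def C_0 lin_0)
      moreover have "(\<lambda>_. 0) \<in> coefs r" by (simp add: coefs_def)
      ultimately show ?thesis by blast
    qed
    then have "(\<Sum>j=1..m. C (c j) * \<sigma> (V j)) \<in> ?W" by (rule sum_in_lin_coefs)
    then show ?thesis unfolding c(2) lin_def by (simp only: S \<sigma>(2))
  qed
  then have "\<sigma> ` ?W \<subseteq> ?W" by auto
  moreover have injs: "inj_on \<sigma> ?W" using ring_endoD(10)[OF \<sigma>(1)] by (intro inj_onI) blast
  ultimately have W: "\<sigma> ` ?W = ?W" using finite_coefs by (intro endo_inj_surj) auto
  have "\<sigma> (L r T) = (\<Prod>w\<in>?W. \<sigma> T + \<sigma> w)" unfolding L by (simp only: S)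
  also have "\<dots> = (\<Prod>w\<in>\<sigma> ` ?W. \<sigma> T + w)" by (simp add: prod.reindex[OF injs])
  finally show ?thesis unfolding W L .
qed

text \<open>Common shape of the actions of \<open>L1\<close> and of the elements of
  \<open>G1\<close>. It is imposed on generators only; products are handled by
  \<open>act_rat_fixed_generate\<close>.\<close>

definition lower_action :: "('k \<Rightarrow> 'k) \<Rightarrow> bool" where
  "lower_action \<sigma> \<longleftrightarrow> ring_endo \<sigma> \<and> (\<forall>x. \<sigma> (C x) = C x) \<and>
     (\<forall>j\<in>{1..m}. \<exists>c\<in>coefs (j - 1). \<sigma> (V j) = V j + lin c) \<and>
     (\<exists>c\<in>coefs m. \<sigma> (V (m+2)) = V (m+2) + lin c) \<and>
     (\<exists>c\<in>coefs m. \<sigma> (V (m+1)) = V (m+1) + lin c \<or> \<sigma> (V (m+1)) = V (m+1) + V (m+2) + lin c)"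

text \<open>By equivariance and \<open>L_lin\<close> a shift by \<open>lin c\<close> is invisible to
  \<open>NV\<close>. So \<open>NV (m+1)\<close> is fixed or gains \<open>NV (m+2)\<close>, and the
  quadratic expression is the product of \<open>NV (m+1)\<close> and
  \<open>NV (m+1) + NV (m+2)\<close>, which the second possibility interchanges.\<close>

lemma
  assumes "lower_action \<sigma>"
  shows NV_fixed: "i \<in> insert (m+2) {1..m} \<Longrightarrow> \<sigma> (NV i) = NV i"
    and NV_quadratic_fixed: "\<sigma> (NV (m+1) ^ 2 + NV (m+2) * NV (m+1)) = NV (m+1) ^ 2 + NV (m+2) * NV (m+1)"
proof -
  note A = assms[unfolded lower_action_def]
  have \<sigma>: "ring_endo \<sigma>" using A by blast
  note S = ring_endoD(1-9)[OF \<sigma>]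
  have equi: "\<sigma> (L r T) = L r (\<sigma> T)" if "r \<le> m" for r T
    using A that by (intro L_equivariant) auto
  have fixd: "\<sigma> (NV i) = NV i" if i: "i \<in> insert (m+2) {1..m}" for i
  proof -
    let ?r = "min (i - 1) m"
    have "\<exists>c\<in>coefs ?r. \<sigma> (V i) = V i + lin c"
    proof (cases "i = m + 2")
      case True
      then show ?thesis using A by simp
    next
      case False
      then have "?r = i - 1" "i \<in> {1..m}" using i by auto
      then show ?thesis using A by simp
    qed
    then show ?thesis unfolding NV_def by (auto simp: equi L_add L_lin)
  qed
  show "\<sigma> (NV i) = NV i" if "i \<in> insert (m+2) {1..m}" using fixd[OF that] .
  obtain c where c: "c \<in> coefs m"
    "\<sigma> (V (m+1)) = V (m+1) + lin c \<or> \<sigma> (V (m+1)) = V (m+1) + V (m+2) + lin c" using A by blast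
  then have "\<sigma> (NV (m+1)) = NV (m+1) \<or> \<sigma> (NV (m+1)) = NV (m+1) + NV (m+2)"
    unfolding NV_def by (auto simp: equi L_add L_lin)
  then show "\<sigma> (NV (m+1) ^ 2 + NV (m+2) * NV (m+1)) = NV (m+1) ^ 2 + NV (m+2) * NV (m+1)"
  proof
    assume 1: "\<sigma> (NV (m+1)) = NV (m+1) + NV (m+2)"
    have "(x + y) ^ 2 + y * (x + y) = x ^ 2 + y * x" for x y :: 'k
    proof -
      have "(x + y) ^ 2 + y * (x + y) = x ^ 2 + y * x + ((y * x + y * x) + (y * y + y * y))"
        by (simp add: power2_eq_square algebra_simps)
      then show ?thesis unfolding two_eq_0 by simp
    qed
    then show ?thesis unfolding S 1 by (simp add: fixd)
  qed (simp add: S fixd)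
qed

end


subsection \<open>The action on polynomials and rational functions\<close>

definition poly_hom :: "('a::field mpol \<Rightarrow> 'b::comm_ring_1) \<Rightarrow> bool" where
  "poly_hom \<phi> \<longleftrightarrow> \<phi> 1 = 1 \<and> (\<forall>x y. \<phi> (x + y) = \<phi> x + \<phi> y \<and> \<phi> (x * y) = \<phi> x * \<phi> y)"

lemma poly_homD:
  assumes "poly_hom \<phi>"
  shows "\<phi> 1 = 1" "\<phi> 0 = 0" "\<phi> (x + y) = \<phi> x + \<phi> y" "\<phi> (x * y) = \<phi> x * \<phi> y" "\<phi> (x ^ n) = \<phi> x ^ n"
    "\<phi> (sum f A) = (\<Sum>i\<in>A. \<phi> (f i))" "\<phi> (prod f A) = (\<Prod>i\<in>A. \<phi> (f i))"
proof -
  note D = assms[unfolded poly_hom_def]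
  show 1: "\<phi> 1 = 1" using D by blast
  show add: "\<phi> (x + y) = \<phi> x + \<phi> y" for x y using D by blast
  show mult: "\<phi> (x * y) = \<phi> x * \<phi> y" for x y using D by blast
  show 0: "\<phi> 0 = 0" using add[of 0 0] by (metis add_cancel_right_left add_0)
  show "\<phi> (x ^ n) = \<phi> x ^ n" by (induction n) (auto simp: 1 mult)
  show "\<phi> (sum f A) = (\<Sum>i\<in>A. \<phi> (f i))" by (induction A rule: infinite_finite_induct) (auto simp: 0 add)
  show "\<phi> (prod f A) = (\<Prod>i\<in>A. \<phi> (f i))" by (induction A rule: infinite_finite_induct) (auto simp: 1 mult)
qed

section \<open>Substitution homomorphisms of the polynomial ring\<close>

lemma Const_simps:
  "Const 0 = 0" "Const 1 = 1" "Const (x + y) = Const x + Const y" "Const (x * y) = Const x * Const y"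
  by (simp_all add: Const_def single_add mult_single)

lemma Const_sum: "Const (sum f A) = (\<Sum>i\<in>A. Const (f i))"
  by (induction A rule: infinite_finite_induct) (auto simp: Const_simps)

lemma poly_mapping_eq_sum_single:
  "p = (\<Sum>t\<in>Poly_Mapping.keys p. Poly_Mapping.single t (Poly_Mapping.lookup p t))"
proof (rule poly_mapping_eqI)
  fix k
  have "(\<Sum>t\<in>Poly_Mapping.keys p. Poly_Mapping.lookup (Poly_Mapping.single t (Poly_Mapping.lookup p t)) k)
    = (\<Sum>t\<in>Poly_Mapping.keys p. if t = k then Poly_Mapping.lookup p k else 0)"
    by (intro sum.cong) (auto simp: lookup_single)
  then show "Poly_Mapping.lookup p k = Poly_Mapping.lookup
      (\<Sum>t\<in>Poly_Mapping.keys p. Poly_Mapping.single t (Poly_Mapping.lookup p t)) k"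
    by (auto simp: lookup_sum in_keys_iff)
qed

lemma subst_poly_superset:
  assumes "Poly_Mapping.keys p \<subseteq> A" "finite A"
  shows "subst_poly \<sigma> p = (\<Sum>t\<in>A. Const (Poly_Mapping.lookup p t) *
     (\<Prod>i\<in>Poly_Mapping.keys t. \<sigma> i ^ Poly_Mapping.lookup t i))"
  unfolding subst_poly_def using assms
  by (intro sum.mono_neutral_left) (auto simp: in_keys_iff Const_simps)

lemma subst_poly_add: "subst_poly \<sigma> (p + r) = subst_poly \<sigma> p + subst_poly \<sigma> r"
proof -
  let ?A = "Poly_Mapping.keys p \<union> Poly_Mapping.keys r"
  have "subst_poly \<sigma> (p + r) = (\<Sum>t\<in>?A. Const (Poly_Mapping.lookup (p + r) t) *
     (\<Prod>i\<in>Poly_Mapping.keys t. \<sigma> i ^ Poly_Mapping.lookup t i))"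
    by (rule subst_poly_superset) (auto dest: subsetD[OF Poly_Mapping.keys_add])
  also have "\<dots> = subst_poly \<sigma> p + subst_poly \<sigma> r"
    by (subst (1 2) subst_poly_superset[where A = ?A])
      (auto simp: lookup_add Const_simps distrib_right sum.distrib)
  finally show ?thesis .
qed

lemma subst_poly_0: "subst_poly \<sigma> 0 = 0"
  by (simp add: subst_poly_def)

lemma subst_poly_sum: "subst_poly \<sigma> (sum f A) = (\<Sum>i\<in>A. subst_poly \<sigma> (f i))"
  by (induction A rule: infinite_finite_induct) (auto simp: subst_poly_0 subst_poly_add)

lemma subst_poly_single:
  "subst_poly \<sigma> (Poly_Mapping.single t c) = Const c * (\<Prod>i\<in>Poly_Mapping.keys t. \<sigma> i ^ Poly_Mapping.lookup t i)"
  by (simp add: subst_poly_def Const_simps)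

lemma monomial_subst_add:
  fixes s t :: "nat \<Rightarrow>\<^sub>0 nat" and \<sigma> :: "nat \<Rightarrow> 'b::comm_ring_1"
  shows "(\<Prod>i\<in>Poly_Mapping.keys (s + t). \<sigma> i ^ Poly_Mapping.lookup (s + t) i) =
   (\<Prod>i\<in>Poly_Mapping.keys s. \<sigma> i ^ Poly_Mapping.lookup s i) * (\<Prod>i\<in>Poly_Mapping.keys t. \<sigma> i ^ Poly_Mapping.lookup t i)"
proof -
  let ?A = "Poly_Mapping.keys s \<union> Poly_Mapping.keys t"
  have extend: "(\<Prod>i\<in>Poly_Mapping.keys u. \<sigma> i ^ Poly_Mapping.lookup u i) = (\<Prod>i\<in>?A. \<sigma> i ^ Poly_Mapping.lookup u i)"
    if "Poly_Mapping.keys u \<subseteq> ?A" for u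
    using that by (intro prod.mono_neutral_left) (auto simp: in_keys_iff)
  show ?thesis
    unfolding extend[OF Poly_Mapping.keys_add] extend[OF Un_upper1] extend[OF Un_upper2]
    by (simp add: lookup_add power_add prod.distrib)
qed

lemma subst_poly_mult: "subst_poly \<sigma> (p * r) = subst_poly \<sigma> p * subst_poly \<sigma> r"
proof -
  have "subst_poly \<sigma> (p * r) = (\<Sum>s\<in>Poly_Mapping.keys p. \<Sum>t\<in>Poly_Mapping.keys r.
     subst_poly \<sigma> (Poly_Mapping.single s (Poly_Mapping.lookup p s) * Poly_Mapping.single t (Poly_Mapping.lookup r t)))"
    by (subst (1) poly_mapping_eq_sum_single[of p], subst (1) poly_mapping_eq_sum_single[of r])
      (simp only: sum_product subst_poly_sum)
  also have "\<dots> = (\<Sum>s\<in>Poly_Mapping.keys p. \<Sum>t\<in>Poly_Mapping.keys r.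
     subst_poly \<sigma> (Poly_Mapping.single s (Poly_Mapping.lookup p s)) * subst_poly \<sigma> (Poly_Mapping.single t (Poly_Mapping.lookup r t)))"
    by (simp only: mult_single subst_poly_single monomial_subst_add Const_simps mult.assoc mult.left_commute)
  also have "\<dots> = subst_poly \<sigma> p * subst_poly \<sigma> r"
    by (simp only: sum_product[symmetric] subst_poly_sum[symmetric] poly_mapping_eq_sum_single[symmetric])
  finally show ?thesis .
qed

lemma subst_poly_Const: "subst_poly \<sigma> (Const c) = Const c"
  unfolding Const_def[of c] subst_poly_single by simp

lemma subst_poly_Var: "subst_poly \<sigma> (Var i) = \<sigma> i"
  unfolding Var_def subst_poly_single by (simp add: Const_simps)

lemma poly_hom_subst_poly: "poly_hom (subst_poly \<sigma>)"
  unfolding poly_hom_def using subst_poly_Const[of \<sigma> 1]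
  by (simp add: subst_poly_add subst_poly_mult Const_simps)

lemma prod_Var_powers:
  assumes "finite A"
  shows "(\<Prod>i\<in>A. Var i ^ k i) = Poly_Mapping.single (\<Sum>i\<in>A. Poly_Mapping.single i (k i)) (1::'a::field)"
proof -
  have "Var i ^ n = Poly_Mapping.single (Poly_Mapping.single i n) (1::'a)" for i n
    by (induction n) (auto simp: Var_def mult_single single_add[symmetric])
  with assms show ?thesis by induction (auto simp: mult_single)
qed

lemma poly_eq_sum_Vars:
  "p = (\<Sum>t\<in>Poly_Mapping.keys p. Const (Poly_Mapping.lookup p t) * (\<Prod>i\<in>Poly_Mapping.keys t. Var i ^ Poly_Mapping.lookup t i))"
proof -
  have "Const c * (\<Prod>i\<in>Poly_Mapping.keys t. Var i ^ Poly_Mapping.lookup t i) = Poly_Mapping.single t (c::'a)" for c t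
    by (simp add: prod_Var_powers Const_def mult_single poly_mapping_eq_sum_single[symmetric])
  then show ?thesis by (simp only: poly_mapping_eq_sum_single[symmetric])
qed

lemma poly_hom_eqI:
  assumes "poly_hom \<phi>" "poly_hom \<psi>" "\<And>c. \<phi> (Const c) = \<psi> (Const c)" "\<And>i. \<phi> (Var i) = \<psi> (Var i)"
  shows "\<phi> p = \<psi> p"
  by (subst (1 2) poly_eq_sum_Vars[of p]) (simp only: poly_homD[OF assms(1)] poly_homD[OF assms(2)] assms(3,4))

section \<open>Matrix inverses and the action on polynomials\<close>

lemma group_GL: "group (GL n)"
  unfolding GL_def using ring.is_monoid[OF ring_mat] by (rule monoid.units_group)

lemma GL_simps:
  "mult (GL n :: 'a::field mat monoid) = (*)" "one (GL n :: 'a mat monoid) = 1\<^sub>m n"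
  by (simp_all add: GL_def units_of_mult units_of_one ring_mat_simps)

lemma GL_closed: "g \<in> carrier (GL n) \<Longrightarrow> g \<in> carrier_mat n n"
  by (simp add: GL_def units_of_carrier Units_def ring_mat_simps)

lemma GL_I:
  assumes "A \<in> carrier_mat n n" "B \<in> carrier_mat n n" "A * B = 1\<^sub>m n" "B * A = 1\<^sub>m n"
  shows "A \<in> carrier (GL n)"
  using assms by (auto simp: GL_def units_of_carrier Units_def ring_mat_simps)

lemma GL_inv_eqI:
  assumes "A \<in> carrier_mat n n" "B \<in> carrier_mat n n" "A * B = 1\<^sub>m n" "B * A = 1\<^sub>m n"
  shows "inv\<^bsub>GL n\<^esub> A = (B :: 'a::field mat)"
  using group.inv_equality[OF group_GL[of n], of B A] GL_I[OF assms] GL_I[OF assms(2,1,4,3)] assms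
  by (simp add: GL_simps)

text \<open>Passes between one-based variables and zero-based matrix entries.\<close>

lemma sum_shift_1: "(\<Sum>j=1..n. f (j - 1)) = (\<Sum>j<n. f j :: 'b::comm_monoid_add)" for n :: nat
  by (rule sum.reindex_bij_witness[of _ Suc "\<lambda>j. j - 1"]) auto

lemma poly_hom_act_poly: "poly_hom (act_poly n g)"
  unfolding act_poly_def by (rule poly_hom_subst_poly)

lemma act_poly_Const: "act_poly n g (Const c) = Const c"
  by (simp add: act_poly_def subst_poly_Const)

lemma act_poly_Var: "act_poly n g (Var i) = (if i \<in> {1..n}
     then \<Sum>j=1..n. Const ((inv\<^bsub>GL n\<^esub> g) $$ (i - 1, j - 1)) * Var j else Var i)"
  by (simp add: act_poly_def subst_poly_Var)

text \<open>A left action: the inverse reverses the product, and substitution reverses it once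
  more.\<close>

lemma act_poly_mult:
  assumes g: "g \<in> carrier (GL n)" and k: "k \<in> carrier (GL n)"
  shows "act_poly n (g * k) p = act_poly n g (act_poly n k p)"
proof (rule poly_hom_eqI[where \<phi> = "act_poly n (g * k)" and \<psi> = "\<lambda>p. act_poly n g (act_poly n k p)"])
  interpret GL: group "GL n" by (rule group_GL)
  note H = poly_homD[OF poly_hom_act_poly]
  show "poly_hom (\<lambda>p. act_poly n g (act_poly n k p))"
    unfolding poly_hom_def by (simp add: H)
  let ?g = "inv\<^bsub>GL n\<^esub> g" and ?k = "inv\<^bsub>GL n\<^esub> k"
  have car: "?g \<in> carrier_mat n n" "?k \<in> carrier_mat n n"
    using g k by (auto intro!: GL_closed GL.inv_closed)
  have inv: "inv\<^bsub>GL n\<^esub> (g * k) = ?k * ?g"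
    using GL.inv_mult_group[OF g k] by (simp add: GL_simps)
  fix i
  show "act_poly n (g * k) (Var i) = act_poly n g (act_poly n k (Var i))"
  proof (cases "i \<in> {1..n}")
    case True
    have entry: "(?k * ?g) $$ (i - 1, j - 1) = (\<Sum>l=1..n. ?k $$ (i - 1, l - 1) * ?g $$ (l - 1, j - 1))"
      if "j \<in> {1..n}" for j
    proof -
      have "(?k * ?g) $$ (i - 1, j - 1) = (\<Sum>l<n. ?k $$ (i - 1, l) * ?g $$ (l, j - 1))"
        using True that car by (auto simp: scalar_prod_def atLeast0LessThan intro!: sum.cong)
      then show ?thesis by (simp only: sum_shift_1[symmetric])
    qed
    have "act_poly n (g * k) (Var i) = (\<Sum>j=1..n. (\<Sum>l=1..n. Const (?k $$ (i - 1, l - 1)) * Const (?g $$ (l - 1, j - 1))) * Var j)"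
      unfolding act_poly_Var inv if_P[OF True] by (intro sum.cong refl) (simp only: entry Const_sum Const_simps)
    also have "\<dots> = (\<Sum>l=1..n. Const (?k $$ (i - 1, l - 1)) * (\<Sum>j=1..n. Const (?g $$ (l - 1, j - 1)) * Var j))"
      unfolding sum_distrib_left sum_distrib_right by (subst sum.swap) (simp add: mult.assoc)
    also have "\<dots> = act_poly n g (act_poly n k (Var i))"
      using True by (simp add: act_poly_Var[of n k] H act_poly_Const) (simp add: act_poly_Var)
    finally show ?thesis .
  next
    case False
    then show ?thesis by (simp only: act_poly_Var if_False)
  qed
qed (simp_all add: poly_hom_act_poly act_poly_Const)

lemma act_poly_one: "act_poly n (1\<^sub>m n) p = p"
proof (rule poly_hom_eqI[where \<psi> = "\<lambda>p. p"])
  have inv: "inv\<^bsub>GL n\<^esub> (1\<^sub>m n) = (1\<^sub>m n :: 'a mat)"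
    by (rule GL_inv_eqI) auto
  show "act_poly n (1\<^sub>m n) (Var i) = (Var i :: 'a mpol)" for i
  proof (cases "i \<in> {1..n}")
    case True
    have "(\<Sum>j=1..n. Const ((1\<^sub>m n :: 'a mat) $$ (i - 1, j - 1)) * Var j) = (\<Sum>j=1..n. if j = i then Var i else 0)"
      using True by (intro sum.cong) (auto simp: Const_simps)
    then show ?thesis using True unfolding act_poly_Var inv by simp
  next
    case False
    then show ?thesis by (simp only: act_poly_Var if_False)
  qed
qed (simp_all add: poly_hom_act_poly act_poly_Const, simp add: poly_hom_def)

lemma act_poly_inv:
  assumes "g \<in> carrier (GL n)"
  shows "act_poly n (inv\<^bsub>GL n\<^esub> g) (act_poly n g p) = p"
proof -
  interpret GL: group "GL n" by (rule group_GL)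
  have "inv\<^bsub>GL n\<^esub> g * g = 1\<^sub>m n" using GL.l_inv[OF assms] by (simp add: GL_simps)
  then show ?thesis using act_poly_mult[of "inv\<^bsub>GL n\<^esub> g" n g p] assms by (simp add: act_poly_one)
qed

section \<open>Extension of the action to fractions\<close>

lemma act_poly_eq_0: "g \<in> carrier (GL n) \<Longrightarrow> act_poly n g p = 0 \<longleftrightarrow> p = 0"
  using act_poly_inv[of g n p] poly_homD(2)[OF poly_hom_act_poly] by metis

text \<open>The description in \<open>act_rat\<close> is unambiguous because \<open>act_poly\<close>
  preserves the cross-multiplied equation of two representatives and, being injective, keeps
  denominators nonzero.\<close>

lemma act_rat_Fract:
  assumes g: "g \<in> carrier (GL n)" and r: "r \<noteq> 0"
  shows "act_rat n g (Fract p r) = Fract (act_poly n g p) (act_poly n g r)"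
  unfolding act_rat_def
proof (rule the_equality)
  show "\<exists>p' r'. r' \<noteq> 0 \<and> Fract p r = Fract p' r' \<and>
     Fract (act_poly n g p) (act_poly n g r) = Fract (act_poly n g p') (act_poly n g r')"
    using r by blast
  fix f' assume "\<exists>p' r'. r' \<noteq> 0 \<and> Fract p r = Fract p' r' \<and> f' = Fract (act_poly n g p') (act_poly n g r')"
  then obtain p' r' where *: "r' \<noteq> 0" "Fract p r = Fract p' r'" "f' = Fract (act_poly n g p') (act_poly n g r')"
    by blast
  have "p * r' = p' * r" using * r by (simp add: eq_fract)
  then have "act_poly n g p * act_poly n g r' = act_poly n g p' * act_poly n g r"
    by (metis poly_homD(4)[OF poly_hom_act_poly])
  then show "f' = Fract (act_poly n g p) (act_poly n g r)"
    using *(1,3) r g by (simp add: eq_fract act_poly_eq_0)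
qed

lemma act_rat_to_fract: "g \<in> carrier (GL n) \<Longrightarrow> act_rat n g (to_fract p) = to_fract (act_poly n g p)"
  by (simp add: to_fract_def act_rat_Fract poly_homD(1)[OF poly_hom_act_poly])

lemma ring_endo_act_rat:
  fixes g :: "'a::field mat"
  assumes g: "g \<in> carrier (GL n)"
  shows "ring_endo (act_rat n g)"
  unfolding ring_endo_def
proof (intro conjI allI)
  note H = poly_homD[OF poly_hom_act_poly]
  show "act_rat n g 1 = 1" using act_rat_to_fract[OF g, of 1] by (simp add: H)
  fix x y :: "'a mpol fract"
  obtain p r where x: "x = Fract p r" "r \<noteq> 0" by (cases x) auto
  obtain p' r' where y: "y = Fract p' r'" "r' \<noteq> 0" by (cases y) auto
  show "act_rat n g (x + y) = act_rat n g x + act_rat n g y" "act_rat n g (x * y) = act_rat n g x * act_rat n g y"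
    using x y by (simp_all add: act_rat_Fract[OF g] H act_poly_eq_0[OF g])
qed

lemma act_rat_mult:
  assumes "g \<in> carrier (GL n)" "k \<in> carrier (GL n)"
  shows "act_rat n (g * k) f = act_rat n g (act_rat n k f)"
proof -
  interpret GL: group "GL n" by (rule group_GL)
  obtain p r where f: "f = Fract p r" "r \<noteq> 0" by (cases f) auto
  have "g * k \<in> carrier (GL n)" using GL.m_closed[OF assms] by (simp add: GL_simps)
  then show ?thesis using f assms by (simp add: act_rat_Fract act_poly_mult act_poly_eq_0)
qed

lemma act_rat_one:
  fixes f :: "'a::field mpol fract"
  shows "act_rat n (1\<^sub>m n) f = f"
proof -
  obtain p r where f: "f = Fract p r" "r \<noteq> 0" by (cases f) auto
  have "(1\<^sub>m n :: 'a mat) \<in> carrier (GL n)" by (rule GL_I[of _ _ "1\<^sub>m n"]) auto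
  then show ?thesis using f by (simp add: act_rat_Fract act_poly_one)
qed

lemma act_rat_fixed_generate:
  assumes K: "K \<subseteq> carrier (GL n)" and fixed: "\<And>g. g \<in> K \<Longrightarrow> act_rat n g f = f"
    and g: "g \<in> generate (GL n) K"
  shows "act_rat n g f = f"
  using g
proof induction
  interpret GL: group "GL n" by (rule group_GL)
  case one
  show ?case by (simp add: GL_simps act_rat_one)
next
  case (incl g)
  then show ?case by (rule fixed)
next
  interpret GL: group "GL n" by (rule group_GL)
  case (inv g)
  then have g: "g \<in> carrier (GL n)" using K by auto
  have "act_rat n (inv\<^bsub>GL n\<^esub> g) f = act_rat n (inv\<^bsub>GL n\<^esub> g) (act_rat n g f)" using fixed inv by simp
  also have "\<dots> = act_rat n (inv\<^bsub>GL n\<^esub> g * g) f" using g by (simp add: act_rat_mult)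
  also have "inv\<^bsub>GL n\<^esub> g * g = 1\<^sub>m n" using GL.l_inv[OF g] by (simp add: GL_simps)
  finally show ?case by (simp add: act_rat_one)
next
  interpret GL: group "GL n" by (rule group_GL)
  case (eng g k)
  have "g \<in> carrier (GL n)" "k \<in> carrier (GL n)" using eng.hyps GL.generate_in_carrier[OF K] by auto
  then show ?case using eng.IH by (simp add: GL_simps act_rat_mult)
qed

section \<open>The field of rational functions\<close>

lemma polys_simps:
  "Const c \<in> polys n" "i \<in> {1..n} \<Longrightarrow> Var i \<in> polys n" "0 \<in> polys n" "1 \<in> polys n"
  "p \<in> polys n \<Longrightarrow> r \<in> polys n \<Longrightarrow> p + r \<in> polys n" "p \<in> polys n \<Longrightarrow> r \<in> polys n \<Longrightarrow> p * r \<in> polys n"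
  "p \<in> polys n \<Longrightarrow> - p \<in> polys n"
proof -
  show "Const c \<in> polys n" "i \<in> {1..n} \<Longrightarrow> Var i \<in> polys n" "0 \<in> polys n" "1 \<in> polys n"
    by (auto simp: polys_def Const_def Var_def split: if_splits)
  show "p + r \<in> polys n" if "p \<in> polys n" "r \<in> polys n"
    using that subsetD[OF Poly_Mapping.keys_add[of p r]] by (fastforce simp: polys_def)
  show "- p \<in> polys n" if "p \<in> polys n"
    using that by (simp add: polys_def in_keys_iff)
  show "p * r \<in> polys n" if "p \<in> polys n" "r \<in> polys n"
    unfolding polys_def
  proof (intro CollectI ballI)
    fix t assume "t \<in> Poly_Mapping.keys (p * r)"
    then obtain u v where "t = u + v" "u \<in> Poly_Mapping.keys p" "v \<in> Poly_Mapping.keys r"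
      using keys_mult[of p r] by blast
    then show "Poly_Mapping.keys t \<subseteq> {1..n}"
      using that Poly_Mapping.keys_add[of u v] by (fastforce simp: polys_def)
  qed
qed

lemma ratfuns_eq_gen_field:
  "ratfuns n = gen_field (range (\<lambda>c::'a::field. to_fract (Const c)) \<union> (\<lambda>i. to_fract (Var i)) ` {1..n})" (is "_ = ?K")
proof
  note K = is_subfield_gen_field
  have to: "to_fract p \<in> ?K" if p: "p \<in> polys n" for p
  proof -
    have "poly_hom (to_fract :: 'a mpol \<Rightarrow> _)" by (simp add: poly_hom_def)
    note H = poly_homD[OF this]
    have "i \<in> {1..n}" if "t \<in> Poly_Mapping.keys p" "i \<in> Poly_Mapping.keys t" for t i
      using p that unfolding polys_def by blast
    then show ?thesis
      by (subst poly_eq_sum_Vars[of p], unfold H)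
        (intro is_subfield_sum[OF K] is_subfieldD(4)[OF K] is_subfield_prod[OF K] is_subfieldD(9)[OF K] gen_field_incl, auto)
  qed
  show "ratfuns n \<subseteq> ?K"
  proof
    fix f :: "'a mpol fract"
    assume "f \<in> ratfuns n"
    then obtain p r where "f = Fract p r" "p \<in> polys n" "r \<in> polys n" by (auto simp: ratfuns_def)
    then have "f = to_fract p / to_fract r" by (simp add: to_fract_def)
    then show "f \<in> ?K" using to \<open>p \<in> polys n\<close> \<open>r \<in> polys n\<close> by (simp add: is_subfieldD(8)[OF K])
  qed
  have "is_subfield (ratfuns n :: 'a mpol fract set)"
    unfolding is_subfield_def
  proof (intro conjI ballI)
    show "1 \<in> (ratfuns n :: 'a mpol fract set)" unfolding ratfuns_def One_fract_def using polys_simps(4) by force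
    fix x :: "'a mpol fract"
    assume "x \<in> ratfuns n"
    then obtain p r where x: "x = Fract p r" "p \<in> polys n" "r \<in> polys n" "r \<noteq> 0" by (auto simp: ratfuns_def)
    show "- x \<in> ratfuns n" using x polys_simps(7) by (auto simp: ratfuns_def)
    show "inverse x \<in> ratfuns n"
    proof (cases "p = 0")
      case True
      then have "inverse x = x" using x by (simp add: fract_collapse)
      then show ?thesis using \<open>x \<in> ratfuns n\<close> by simp
    next
      case False
      then show ?thesis using x by (auto simp: ratfuns_def)
    qed
    fix y :: "'a mpol fract"
    assume "y \<in> ratfuns n"
    then obtain p' r' where y: "y = Fract p' r'" "p' \<in> polys n" "r' \<in> polys n" "r' \<noteq> 0" by (auto simp: ratfuns_def)
    have "x + y = Fract (p * r' + p' * r) (r * r')" "x * y = Fract (p * p') (r * r')" "r * r' \<noteq> 0"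
      using x y by auto
    then show "x + y \<in> ratfuns n" "x * y \<in> ratfuns n"
      using x y polys_simps(5,6) unfolding ratfuns_def by blast+
  qed
  moreover have to': "to_fract (p :: 'a mpol) \<in> ratfuns n" if "p \<in> polys n" for p
    unfolding ratfuns_def to_fract_def using that polys_simps(4) by force
  ultimately show "?K \<subseteq> ratfuns n"
    by (intro gen_field_least Un_least image_subsetI to' polys_simps(1,2))
qed

text \<open>Linear independence is read off from the coefficients at the monomials
  \<open>Poly_Mapping.single j 1\<close>.\<close>

lemma gf_vars_ratfuns:
  assumes "q = card (UNIV :: 'a::{finite,field} set)" "even q"
  shows "gf_vars (\<lambda>c::'a. to_fract (Const c)) (\<lambda>i. to_fract (Var i)) q m"
proof
  fix c :: "nat \<Rightarrow> 'a" and j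
  assume sum: "(\<Sum>j=1..2*m+2. to_fract (Const (c j)) * to_fract (Var j)) = 0" and j: "j \<in> {1..2*m+2}"
  have "poly_hom (to_fract :: 'a mpol \<Rightarrow> _)" by (simp add: poly_hom_def)
  note H = poly_homD[OF this]
  have "to_fract (\<Sum>j=1..2*m+2. Const (c j) * Var j) = 0" using sum by (simp only: H)
  then have "(\<Sum>j=1..2*m+2. Const (c j) * Var j) = 0" by (simp only: to_fract_eq_0_iff)
  then have "0 = Poly_Mapping.lookup (\<Sum>j=1..2*m+2. Const (c j) * Var j) (Poly_Mapping.single j 1)"
    by (simp only: lookup_zero)
  also have "\<dots> = (\<Sum>i=1..2*m+2. if i = j then c j else 0)"
    unfolding lookup_sum
  proof (rule sum.cong[OF refl])
    fix i
    have "Poly_Mapping.single i (1::nat) = Poly_Mapping.single j 1 \<longleftrightarrow> i = j"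
      by (metis lookup_single_eq lookup_single_not_eq zero_neq_one)
    then show "Poly_Mapping.lookup (Const (c i) * Var i) (Poly_Mapping.single j 1) = (if i = j then c j else 0)"
      by (auto simp: Const_def Var_def mult_single lookup_single)
  qed
  also have "\<dots> = c j" using j by (simp only: sum.delta[OF finite_atLeastAtMost] if_True)
  finally show "c j = 0" by simp
qed (use assms in \<open>simp_all add: Const_simps\<close>)


subsection \<open>Isometries in matrix form\<close>

lemma mat_mult_entry:
  assumes "A \<in> carrier_mat n l" "B \<in> carrier_mat l k" "i < n" "j < k"
  shows "(A * B) $$ (i, j) = (\<Sum>x<l. A $$ (i, x) * B $$ (x, j) :: 'a::semiring_0)"
  using assms by (auto simp: scalar_prod_def atLeast0LessThan intro!: sum.cong)

lemma antidiag_one_carrier: "antidiag_one n \<in> carrier_mat n n"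
  by (simp add: antidiag_one_def)

lemma antidiag_mult_left:
  assumes "A \<in> carrier_mat n k" "i < n" "j < k"
  shows "(antidiag_one n * A) $$ (i, j) = (A $$ (n - 1 - i, j) :: 'a::field)"
proof -
  have "(antidiag_one n * A) $$ (i, j) = (\<Sum>l<n. antidiag_one n $$ (i, l) * A $$ (l, j))"
    by (rule mat_mult_entry[OF antidiag_one_carrier assms])
  also have "\<dots> = (\<Sum>l<n. if l = n - 1 - i then A $$ (l, j) else 0)"
    using assms by (intro sum.cong) (auto simp: antidiag_one_def)
  also have "\<dots> = A $$ (n - 1 - i, j)" using assms by (subst sum.delta) auto
  finally show ?thesis .
qed

lemma antidiag_mult_right:
  assumes "A \<in> carrier_mat k n" "i < k" "j < n"
  shows "(A * antidiag_one n) $$ (i, j) = (A $$ (i, n - 1 - j) :: 'a::field)"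
proof -
  have "(A * antidiag_one n) $$ (i, j) = (\<Sum>l<n. A $$ (i, l) * antidiag_one n $$ (l, j))"
    by (rule mat_mult_entry[OF assms(1) antidiag_one_carrier assms(2,3)])
  also have "\<dots> = (\<Sum>l<n. if l = n - 1 - j then A $$ (i, l) else 0)"
    using assms by (intro sum.cong) (auto simp: antidiag_one_def)
  also have "\<dots> = A $$ (i, n - 1 - j)" using assms by (subst sum.delta) auto
  finally show ?thesis .
qed

lemma antidiag_square: "antidiag_one n * antidiag_one n = (1\<^sub>m n :: 'a::field mat)"
proof (rule eq_matI)
  fix i j assume "i < dim_row (1\<^sub>m n :: 'a mat)" "j < dim_col (1\<^sub>m n :: 'a mat)"
  then have ij: "i < n" "j < n" by auto
  then have "(antidiag_one n * antidiag_one n :: 'a mat) $$ (i, j) = antidiag_one n $$ (n - 1 - i, j)"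
    by (rule antidiag_mult_left[OF antidiag_one_carrier])
  then show "(antidiag_one n * antidiag_one n) $$ (i, j) = (1\<^sub>m n :: 'a mat) $$ (i, j)"
    using ij by (auto simp: antidiag_one_def)
qed (auto simp: antidiag_one_def)

text \<open>With \<open>Y = antidiag_one (2*m+2)\<close>, which is its own inverse, the inverse of
  \<open>M\<close> is \<open>Y * transpose_mat M * Y\<close>, that is, \<open>M\<close> reflected in
  the antidiagonal.\<close>

lemma Gplus_inverse:
  assumes "M \<in> Gplus m"
  shows "M \<in> carrier (GL (2*m+2))"
    and "\<And>i j. i < 2*m+2 \<Longrightarrow> j < 2*m+2 \<Longrightarrow>
      (inv\<^bsub>GL (2*m+2)\<^esub> M) $$ (i, j) = (M $$ (2*m+1 - j, 2*m+1 - i) :: 'a::field)"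
proof -
  let ?n = "2*m+2"
  let ?Y = "antidiag_one ?n :: 'a mat"
  let ?B = "?Y * (transpose_mat M * ?Y)"
  have M: "M \<in> carrier_mat ?n ?n" "transpose_mat M * ?Y * M = ?Y"
    using assms by (auto simp: Gplus_def lower_unitriangular_def)
  note Y = antidiag_one_carrier[where n = ?n and ?'a = 'a]
  have car: "transpose_mat M * ?Y \<in> carrier_mat ?n ?n" "?B \<in> carrier_mat ?n ?n" using M(1) Y by auto
  have BM: "?B * M = 1\<^sub>m ?n"
    using assoc_mult_mat[OF Y car(1) M(1)] M(2) antidiag_square by simp
  then have MB: "M * ?B = 1\<^sub>m ?n" using mat_mult_left_right_inverse[OF car(2) M(1)] by simp
  show "M \<in> carrier (GL ?n)" by (rule GL_I[OF M(1) car(2) MB BM])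
  have inv: "inv\<^bsub>GL ?n\<^esub> M = ?B" by (rule GL_inv_eqI[OF M(1) car(2) MB BM])
  fix i j assume ij: "i < ?n" "j < ?n"
  have "?B $$ (i, j) = (transpose_mat M * ?Y) $$ (?n - 1 - i, j)"
    by (rule antidiag_mult_left[OF car(1) ij])
  also have "\<dots> = transpose_mat M $$ (?n - 1 - i, ?n - 1 - j)"
    using ij M(1) by (intro antidiag_mult_right) auto
  also have "\<dots> = M $$ (2*m+1 - j, 2*m+1 - i)" using ij M(1) by simp
  finally show "(inv\<^bsub>GL ?n\<^esub> M) $$ (i, j) = M $$ (2*m+1 - j, 2*m+1 - i)" unfolding inv .
qed

section \<open>Gram matrices and membership in \<open>G1\<close>\<close>

lemma polar_eq_sum: "polar m x y = (\<Sum>i=1..2*m+2. x (2*m+3-i) * y i)"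
proof -
  have "(\<Sum>i=1..m+1. x i * y (2*m+3-i)) = (\<Sum>i=m+2..2*m+2. x (2*m+3-i) * y i)"
    by (rule sum.reindex_bij_witness[of _ "\<lambda>i. 2*m+3-i" "\<lambda>i. 2*m+3-i"]) auto
  moreover have "{1..2*m+2} = {1..m+1} \<union> {m+2..2*m+2}" by auto
  moreover have "(\<Sum>i\<in>{1..m+1} \<union> {m+2..2*m+2}. x (2*m+3-i) * y i) =
      (\<Sum>i=1..m+1. x (2*m+3-i) * y i) + (\<Sum>i=m+2..2*m+2. x (2*m+3-i) * y i)"
    by (rule sum.union_disjoint) auto
  ultimately show ?thesis unfolding polar_def sum.distrib by (simp only:)
qed

text \<open>Multiplication by \<open>antidiag_one\<close> reverses an index, so the product is the
  Gram matrix of the columns of \<open>M\<close> for \<open>polar\<close>.\<close>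

lemma transpose_antidiag_mult_entry:
  assumes M: "M \<in> carrier_mat (2*m+2) (2*m+2)" and ij: "i < 2*m+2" "j < 2*m+2"
  shows "(transpose_mat M * antidiag_one (2*m+2) * M) $$ (i, j) =
    polar m (\<lambda>r. M $$ (r - 1, i)) (\<lambda>r. M $$ (r - 1, j) :: 'a::field)"
proof -
  let ?n = "2*m+2"
  have "(transpose_mat M * antidiag_one ?n * M) $$ (i, j) =
    (\<Sum>l<?n. (transpose_mat M * antidiag_one ?n) $$ (i, l) * M $$ (l, j))"
    by (rule mat_mult_entry[OF _ M ij]) (use M antidiag_one_carrier[of ?n, where ?'a = 'a] in auto)
  also have "\<dots> = (\<Sum>l<?n. M $$ (?n - 1 - l, i) * M $$ (l, j))"
    using M ij by (intro sum.cong refl) (subst antidiag_mult_right[of _ ?n], auto)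
  also have "\<dots> = (\<Sum>l=1..?n. M $$ (?n - 1 - (l - 1), i) * M $$ (l - 1, j))"
    by (simp only: sum_shift_1[where f = "\<lambda>l. M $$ (?n - 1 - l, i) * M $$ (l, j)"])
  also have "\<dots> = (\<Sum>l=1..?n. M $$ (2*m+3-l-1, i) * M $$ (l - 1, j))"
  proof (rule sum.cong[OF refl])
    fix l assume "l \<in> {1..?n}"
    then have "?n - 1 - (l - 1) = 2*m+3-l-1" by auto
    then show "M $$ (?n - 1 - (l - 1), i) * M $$ (l - 1, j) = M $$ (2*m+3-l-1, i) * M $$ (l - 1, j)"
      by (simp only:)
  qed
  finally show ?thesis unfolding polar_eq_sum .
qed

lemma mult_mat_vec_eq:
  assumes "M \<in> carrier_mat n n" "v \<in> carrier_vec n" "r \<in> {1..n}"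
  shows "(M *\<^sub>v v) $ (r - 1) = (\<Sum>s=1..n. M $$ (r - 1, s - 1) * (v $ (s - 1) :: 'a::field))"
proof -
  have "(M *\<^sub>v v) $ (r - 1) = (\<Sum>s<n. M $$ (r - 1, s) * v $ s)"
    using assms by (auto simp: scalar_prod_def atLeast0LessThan intro!: sum.cong)
  then show ?thesis by (simp only: sum_shift_1[symmetric])
qed

text \<open>Both remaining conditions express isometry: the equation of \<open>Gplus\<close> says
  that the polar form is preserved on basis vectors, the condition on \<open>S\<close> that the
  first \<open>m\<close> basis vectors keep the value 0.\<close>

lemma G1_I:
  fixes a :: "'a::field"
  assumes M: "M \<in> lower_unitriangular (2*m+2)" and F: "block_F m M = 1\<^sub>m 2"
    and Q: "\<And>v. v \<in> carrier_vec (2*m+2) \<Longrightarrow> quad_form a m (M *\<^sub>v v) = quad_form a m v"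
    and 2: "\<And>z::'a. z + z = 0"
  shows "M \<in> G1 a m"
proof -
  let ?n = "2*m+2"
  have Mc: "M \<in> carrier_mat ?n ?n" and Mlow: "\<And>i j. j < ?n \<Longrightarrow> i < j \<Longrightarrow> M $$ (i, j) = 0"
    and Md: "\<And>i. i < ?n \<Longrightarrow> M $$ (i, i) = 1"
    using M by (auto simp: lower_unitriangular_def)
  let ?q = "\<lambda>v. quad_form a m v"
  have qc: "minus_form a m (\<lambda>r. A $$ (r - 1, i)) = ?q (A *\<^sub>v unit_vec ?n i)"
    "minus_form a m (\<lambda>r. A $$ (r - 1, i) + A $$ (r - 1, j)) = ?q (A *\<^sub>v (unit_vec ?n i + unit_vec ?n j))"
    if A: "A \<in> carrier_mat ?n ?n" and ij: "i < ?n" "j < ?n" for A i j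
  proof -
    have u: "(A *\<^sub>v unit_vec ?n i) $ (r - 1) = A $$ (r - 1, i)" if "r \<in> {1..?n}" "i < ?n" for r i
      using A that by (auto simp: scalar_prod_right_unit)
    show "minus_form a m (\<lambda>r. A $$ (r - 1, i)) = ?q (A *\<^sub>v unit_vec ?n i)"
      unfolding quad_form_def by (rule minus_form_cong) (simp only: u ij)
    have "(A *\<^sub>v (unit_vec ?n i + unit_vec ?n j)) $ (r - 1) = A $$ (r - 1, i) + A $$ (r - 1, j)"
      if "r \<in> {1..?n}" for r
    proof -
      have "A *\<^sub>v (unit_vec ?n i + unit_vec ?n j) = A *\<^sub>v unit_vec ?n i + A *\<^sub>v unit_vec ?n j"
        by (rule mult_add_distrib_mat_vec[OF A]) auto
      then have "(A *\<^sub>v (unit_vec ?n i + unit_vec ?n j)) $ (r - 1) = (A *\<^sub>v unit_vec ?n i) $ (r - 1) + (A *\<^sub>v unit_vec ?n j) $ (r - 1)"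
        using that A by auto
      then show ?thesis by (simp only: u that ij)
    qed
    then show "minus_form a m (\<lambda>r. A $$ (r - 1, i) + A $$ (r - 1, j)) = ?q (A *\<^sub>v (unit_vec ?n i + unit_vec ?n j))"
      unfolding quad_form_def by (intro minus_form_cong) (simp only:)
  qed
  have Qe: "?q (M *\<^sub>v v) = ?q (1\<^sub>m ?n *\<^sub>v v)" if "v \<in> carrier_vec ?n" for v
    using Q[OF that] that by simp
  \<comment> \<open>Polarising the form at unit vectors compares \<open>M\<close> with the identity,
    whose Gram matrix is \<open>antidiag_one\<close> itself.\<close>
  have Y: "transpose_mat M * antidiag_one ?n * M = antidiag_one ?n"
  proof (rule eq_matI)
    fix i j assume "i < dim_row (antidiag_one ?n :: 'a mat)" "j < dim_col (antidiag_one ?n :: 'a mat)"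
    then have ij: "i < ?n" "j < ?n" by (auto simp: antidiag_one_def)
    note one = one_carrier_mat[of ?n, where ?'a = 'a]
    have "(transpose_mat M * antidiag_one ?n * M) $$ (i, j) = (transpose_mat (1\<^sub>m ?n) * antidiag_one ?n * 1\<^sub>m ?n) $$ (i, j)"
      unfolding transpose_antidiag_mult_entry[OF Mc ij] transpose_antidiag_mult_entry[OF one ij]
        polar_eq[OF 2, where a = a] qc[OF Mc ij] qc[OF one ij] qc(1)[OF Mc ij(2) ij(1)] qc(1)[OF one ij(2) ij(1)]
        Qe[OF unit_vec_carrier] Qe[OF add_carrier_vec[OF unit_vec_carrier unit_vec_carrier]] ..
    then show "(transpose_mat M * antidiag_one ?n * M) $$ (i, j) = (antidiag_one ?n :: 'a mat) $$ (i, j)"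
      using antidiag_one_carrier[of ?n, where ?'a = 'a] by simp
  qed (use Mc in \<open>auto simp: antidiag_one_def\<close>)
  let ?A = "block_A m M" and ?C = "block_C m M" and ?J = "antidiag_one m :: 'a mat"
  have A: "?A \<in> carrier_mat m m" and C: "?C \<in> carrier_mat m m" by (auto simp: block_A_def block_C_def)
  note J = antidiag_one_carrier[of m, where ?'a = 'a]
  have "Determinant.det ?A = prod_list (diag_mat ?A)"
    by (rule det_lower_triangular[OF _ A]) (auto simp: block_A_def intro!: Mlow)
  also have "diag_mat ?A = map (\<lambda>_. 1) [0..<m]"
    unfolding diag_mat_def using Md by (auto simp: block_A_def)
  also have "prod_list \<dots> = 1" by (induction m) auto
  finally have "?A \<in> carrier (GL m)"
    using det_non_zero_imp_unit[OF A, of "()"] by (simp add: GL_def units_of_carrier)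
  then have Ai: "inv\<^bsub>GL m\<^esub> ?A \<in> carrier_mat m m" "?A * inv\<^bsub>GL m\<^esub> ?A = 1\<^sub>m m"
    using group.r_inv[OF group_GL, of ?A] group.inv_closed[OF group_GL, of ?A] GL_closed by (auto simp: GL_simps)
  \<comment> \<open>The defining equation of \<open>S\<close> solved for \<open>S\<close>;
    \<open>?J\<close> is its own inverse.\<close>
  define S where "S = transpose_mat ?A * (?J * ?C)"
  have Sc: "S \<in> carrier_mat m m" unfolding S_def using A C J by auto
  have "?J * transpose_mat (inv\<^bsub>GL m\<^esub> ?A) * S = ?C"
  proof -
    let ?I = "transpose_mat (inv\<^bsub>GL m\<^esub> ?A)"
    have I: "?I \<in> carrier_mat m m" and At: "transpose_mat ?A \<in> carrier_mat m m" and JC: "?J * ?C \<in> carrier_mat m m"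
      using Ai A J C by auto
    have IA: "?I * transpose_mat ?A = 1\<^sub>m m"
      using transpose_mult[OF A Ai(1)] Ai(2) by simp
    have "?J * ?I * S = ?J * (?I * S)" by (rule assoc_mult_mat[OF J I Sc])
    also have "?I * S = ?I * transpose_mat ?A * (?J * ?C)"
      unfolding S_def by (rule assoc_mult_mat[symmetric, OF I At JC])
    also have "\<dots> = ?J * ?C" unfolding IA by (rule left_mult_one_mat[OF JC])
    also have "?J * (?J * ?C) = ?J * ?J * ?C" by (rule assoc_mult_mat[symmetric, OF J J C])
    also have "\<dots> = ?C" unfolding antidiag_square by (rule left_mult_one_mat[OF C])
    finally show ?thesis .
  qed
  moreover have "S $$ (i, i) = block_B m M $$ (0, i) ^ 2 + block_B m M $$ (0, i) * block_B m M $$ (1, i)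
      + a * block_B m M $$ (1, i) ^ 2" (is "_ = ?b") if i: "i < m" for i
  proof -
    \<comment> \<open>The diagonal entry turns out to be the hyperbolic part of the form at a column
      of \<open>M\<close>; the two middle coordinates of that column supply
      \<open>?b\<close>.\<close>
    have "S $$ (i, i) = (\<Sum>j<m. transpose_mat ?A $$ (i, j) * (?J * ?C) $$ (j, i))"
      unfolding S_def by (rule mat_mult_entry[OF _ _ i i]) (use A C J in auto)
    also have "\<dots> = (\<Sum>j<m. ?A $$ (j, i) * (?J * ?C) $$ (j, i))"
      using A i by (intro sum.cong) auto
    also have "\<dots> = (\<Sum>j<m. M $$ (j, i) * M $$ (2*m+1-j, i))"
    proof (rule sum.cong[OF refl])
      fix j assume "j \<in> {..<m}"
      then have j: "j < m" by simp
      have "(?J * ?C) $$ (j, i) = ?C $$ (m - 1 - j, i)" by (rule antidiag_mult_left[OF C j i])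
      also have "\<dots> = M $$ (m + 2 + (m - 1 - j), i)" using i j by (simp add: block_C_def)
      also have "m + 2 + (m - 1 - j) = 2*m+1-j" using j by simp
      finally show "?A $$ (j, i) * (?J * ?C) $$ (j, i) = M $$ (j, i) * M $$ (2*m+1-j, i)"
        using i j by (simp add: block_A_def)
    qed
    also have "\<dots> = (\<Sum>j=1..m. M $$ (j-1, i) * M $$ (2*m+1-(j-1), i))"
      by (simp only: sum_shift_1[where f = "\<lambda>j. M $$ (j, i) * M $$ (2*m+1-j, i)"])
    also have "\<dots> = (\<Sum>j=1..m. M $$ (2*m+3-j-1, i) * M $$ (j-1, i))"
    proof (rule sum.cong[OF refl])
      fix j assume "j \<in> {1..m}"
      then have "2*m+1-(j-1) = 2*m+3-j-1" by auto
      then show "M $$ (j-1, i) * M $$ (2*m+1-(j-1), i) = M $$ (2*m+3-j-1, i) * M $$ (j-1, i)"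
        by (simp only: mult.commute)
    qed
    finally have S: "S $$ (i, i) = (\<Sum>j=1..m. M $$ (2*m+3-j-1, i) * M $$ (j-1, i))" .
    have b: "block_B m M $$ (0, i) = M $$ (m, i)" "block_B m M $$ (1, i) = M $$ (m+1, i)"
      using i by (auto simp: block_B_def)
    have "minus_form a m (\<lambda>r. M $$ (r - 1, i)) = S $$ (i, i) + ?b"
      unfolding minus_form_def S b by (simp add: add.assoc)
    moreover have "minus_form a m (\<lambda>r. M $$ (r - 1, i)) = 0"
    proof -
      have i': "i < ?n" using i by simp
      have "minus_form a m (\<lambda>r. M $$ (r - 1, i)) = minus_form a m (\<lambda>r. 1\<^sub>m ?n $$ (r - 1, i))"
        unfolding qc(1)[OF Mc i' i'] qc(1)[OF one_carrier_mat i' i'] by (rule Qe) auto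
      also have "\<dots> = 0"
        unfolding minus_form_def using i by (auto intro!: sum.neutral)
      finally show ?thesis .
    qed
    ultimately have "S $$ (i, i) + ?b = 0" by simp
    then have "S $$ (i, i) + ?b + ?b = ?b" by simp
    then show ?thesis using 2[of ?b] by (simp only: add.assoc add_0_right)
  qed
  ultimately show ?thesis using M F Y Sc unfolding G1_def Gplus_def by (auto intro!: bexI[of _ S])
qed

text \<open>
  Row \<open>r\<close> of the matrix of \<open>v \<mapsto> v + l(v) e\<^sub>k + (v\<^sub>k\<^sub>' + \<beta> l(v)) \<Sum>\<^sub>j c\<^sub>j e\<^sub>j\<^sub>'\<close>, where \<open>l(v) = \<Sum>\<^sub>j c\<^sub>j v\<^sub>j\<close> and
  \<open>j' = 2m + 3 - j\<close>. It is an isometry when \<open>\<beta>\<close> is the value of the quadratic form at \<open>e\<^sub>k\<close>.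
\<close>

definition siegel :: "'a::field \<Rightarrow> nat \<Rightarrow> nat \<Rightarrow> (nat \<Rightarrow> 'a) \<Rightarrow> nat \<Rightarrow> nat \<Rightarrow> 'a" where
  "siegel \<beta> m k c r s = (if r = s then 1 else 0) + (if r = k then c s else 0)
     + c (2*m+3-r) * ((if s = 2*m+3-k then 1 else 0) + \<beta> * c s)"

lemma siegel_sum:
  assumes "k \<in> {1..2*m+2}" "r \<in> {1..2*m+2}"
  shows "(\<Sum>s=1..2*m+2. siegel \<beta> m k c r s * z s) =
    z r + (\<Sum>s=1..2*m+2. c s * z s) * (if r = k then 1 else 0)
      + (z (2*m+3-k) + \<beta> * (\<Sum>s=1..2*m+2. c s * z s)) * c (2*m+3-r)"
proof -
  let ?l = "\<Sum>s=1..2*m+2. c s * z s"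
  let ?S = "{1..2*m+2}"
  have d: "(\<Sum>s\<in>?S. (if s = i then 1 else 0) * z s) = z i" if "i \<in> ?S" for i
  proof -
    have "(\<Sum>s\<in>?S. (if s = i then 1 else 0) * z s) = (\<Sum>s\<in>?S. if s = i then z s else 0)"
      by (intro sum.cong) auto
    then show ?thesis using that by (simp only: sum.delta[OF finite_atLeastAtMost] if_True)
  qed
  have k': "2*m+3-k \<in> ?S" using assms(1) by auto
  have "siegel \<beta> m k c r s * z s = (if s = r then 1 else 0) * z s + (if r = k then 1 else 0) * (c s * z s)
    + c (2*m+3-r) * ((if s = 2*m+3-k then 1 else 0) * z s + \<beta> * (c s * z s))" for s
    by (auto simp: siegel_def algebra_simps)
  then have "(\<Sum>s\<in>?S. siegel \<beta> m k c r s * z s) =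
    z r + (if r = k then 1 else 0) * ?l + c (2*m+3-r) * (z (2*m+3-k) + \<beta> * ?l)"
    by (simp only: sum.distrib sum_distrib_left[symmetric] d[OF assms(2)] d[OF k'])
  then show ?thesis by (simp only: mult.commute)
qed

text \<open>The form is expanded along \<open>e\<close> and along \<open>c'\<close>. Here
  \<open>c'\<close> is singular and its polar value with \<open>z + l * e\<close> is
  \<open>l\<close>; the terms \<open>l * z (2*m+3-k)\<close> and \<open>l ^ 2 * \<beta>\<close> then
  occur twice and cancel.\<close>

lemma siegel_isometry:
  fixes c z :: "nat \<Rightarrow> 'a::field" and a :: 'a
  assumes k: "k \<in> {1..2*m+2}" and supp: "\<And>j. c j \<noteq> 0 \<Longrightarrow> j \<in> {1..m} \<and> j < k \<and> j < 2*m+3-k"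
    and 2: "\<And>z::'a. z + z = 0"
  defines "\<beta> \<equiv> (if k = m+1 then 1 else if k = m+2 then a else 0)"
  shows "minus_form a m (\<lambda>r. \<Sum>s=1..2*m+2. siegel \<beta> m k c r s * z s) = minus_form a m z"
proof -
  define l where "l = (\<Sum>s=1..2*m+2. c s * z s)"
  define e where "e = (\<lambda>r. if r = k then 1 else 0 :: 'a)"
  define c' where "c' = (\<lambda>r. c (2*m+3-r))"
  define \<mu> where "\<mu> = z (2*m+3-k) + \<beta> * l"
  have ck: "c k = 0" using supp[of k] by auto
  have c0: "c j = 0" if "j \<notin> {1..m}" for j using supp[of j] that by auto
  have "minus_form a m (\<lambda>r. \<Sum>s=1..2*m+2. siegel \<beta> m k c r s * z s) = minus_form a m (\<lambda>r. (z r + l * e r) + \<mu> * c' r)"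
    by (rule minus_form_cong) (simp only: siegel_sum[OF k] l_def e_def c'_def \<mu>_def)
  also have "\<dots> = minus_form a m (\<lambda>r. z r + l * e r) + \<mu> ^ 2 * minus_form a m c' + \<mu> * polar m (\<lambda>r. z r + l * e r) c'"
    by (rule minus_form_add_scaled[OF 2])
  also have "minus_form a m c' = 0"
  proof -
    have "c' i = 0" if "i \<le> m + 2" for i unfolding c'_def using that by (intro c0) auto
    then show ?thesis by (simp add: minus_form_def)
  qed
  also have "polar m (\<lambda>r. z r + l * e r) c' = (\<Sum>s=1..2*m+2. c s * (z s + l * e s))"
    unfolding polar_eq_sum c'_def
    by (rule sum.reindex_bij_witness[of _ "\<lambda>i. 2*m+3-i" "\<lambda>i. 2*m+3-i"]) auto
  also have "\<dots> = l"
  proof -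
    have "c s * (z s + l * e s) = c s * z s" for s using ck by (simp add: e_def algebra_simps)
    then show ?thesis by (simp only: l_def)
  qed
  also have "minus_form a m (\<lambda>r. z r + l * e r) = minus_form a m z + l ^ 2 * minus_form a m e + l * polar m z e"
    by (rule minus_form_add_scaled[OF 2])
  also have "minus_form a m e = \<beta>"
  proof -
    have "(\<Sum>i=1..m. e (2*m+3-i) * e i) = 0" by (rule sum.neutral) (auto simp: e_def)
    then show ?thesis unfolding minus_form_def by (auto simp: e_def \<beta>_def)
  qed
  also have "polar m z e = z (2*m+3-k)"
  proof -
    have "(\<Sum>i=1..2*m+2. z (2*m+3-i) * e i) = (\<Sum>i=1..2*m+2. if i = k then z (2*m+3-i) else 0)"
      by (intro sum.cong) (auto simp: e_def)
    then show ?thesis unfolding polar_eq_sum using k by (simp only: sum.delta[OF finite_atLeastAtMost] if_True)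
  qed
  finally have eq: "minus_form a m (\<lambda>r. \<Sum>s=1..2*m+2. siegel \<beta> m k c r s * z s) =
     minus_form a m z + ((l * z (2*m+3-k) + l * z (2*m+3-k)) + (l ^ 2 * \<beta> + l ^ 2 * \<beta>))"
    by (simp add: \<mu>_def algebra_simps power2_eq_square)
  then show ?thesis by (simp only: 2 add_0_right)
qed

text \<open>The support condition makes \<open>M\<close> lower unitriangular. Its entries are
  symmetric under reflection in the antidiagonal, so by \<open>Gplus_inverse\<close> the matrix is
  its own inverse.\<close>

lemma siegel_in_G1:
  fixes c :: "nat \<Rightarrow> 'a::field" and a :: 'a
  assumes k: "k \<in> {1..2*m+2}" and supp: "\<And>j. c j \<noteq> 0 \<Longrightarrow> j \<in> {1..m} \<and> j < k \<and> j < 2*m+3-k"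
    and 2: "\<And>z::'a. z + z = 0"
  defines "\<beta> \<equiv> (if k = m+1 then 1 else if k = m+2 then a else 0)"
  defines "M \<equiv> mat (2*m+2) (2*m+2) (\<lambda>(r, s). siegel \<beta> m k c (r+1) (s+1))"
  shows "M \<in> G1 a m"
    and "\<And>i j. i \<in> {1..2*m+2} \<Longrightarrow> j \<in> {1..2*m+2} \<Longrightarrow>
       (inv\<^bsub>GL (2*m+2)\<^esub> M) $$ (i - 1, j - 1) = siegel \<beta> m k c i j"
proof -
  let ?n = "2*m+2"
  have c0: "c j = 0" if "j \<notin> {1..m}" for j using supp[of j] that by auto
  have ck: "c k = 0" "c (2*m+3-k) = 0" using supp by auto
  \<comment> \<open>On and above the diagonal every summand beyond the identity is killed by the
    support of \<open>c\<close>.\<close>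
  have sup: "siegel \<beta> m k c r s = (if r = s then 1 else 0)"
    if "r \<le> s" "r \<in> {1..?n}" "s \<in> {1..?n}" for r s
  proof -
    have 1: "(if r = k then c s else 0) = 0"
      using supp[of s] that by (cases "c s = 0") auto
    have 2: "c (2*m+3-r) * (if s = 2*m+3-k then 1 else 0) = 0"
    proof (cases "c (2*m+3-r) = 0")
      case False
      then have "2*m+3-r < k" using supp by auto
      then have "s \<noteq> 2*m+3-k" using that k by auto
      then show ?thesis by simp
    qed simp
    have 3: "c (2*m+3-r) * c s = 0"
    proof (cases "c s = 0")
      case False
      then have "s \<le> m" using supp by auto
      then have "2*m+3-r \<notin> {1..m}" using that by auto
      then show ?thesis using c0 by simp
    qed simp
    show ?thesis unfolding siegel_def 1 using 2 3 by (auto simp: distrib_left)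
  qed
  have M: "M \<in> lower_unitriangular ?n"
    unfolding lower_unitriangular_def M_def using sup by auto
  have F: "block_F m M = 1\<^sub>m 2"
  proof (rule eq_matI)
    fix i j assume "i < dim_row (1\<^sub>m 2 :: 'a mat)" "j < dim_col (1\<^sub>m 2 :: 'a mat)"
    then have ij: "i < 2" "j < 2" by auto
    have "c (m+j+1) = 0" "c (2*m+3-(m+i+1)) = 0" using ij by (auto intro!: c0)
    then have "siegel \<beta> m k c (m+i+1) (m+j+1) = (if i = j then 1 else 0)" by (simp add: siegel_def)
    then show "block_F m M $$ (i, j) = 1\<^sub>m 2 $$ (i, j)" using ij by (simp add: block_F_def M_def)
  qed (auto simp: block_F_def)
  have Mc: "M \<in> carrier_mat ?n ?n" by (simp add: M_def)
  have ent: "M $$ (r - 1, s - 1) = siegel \<beta> m k c r s" if "r \<in> {1..?n}" "s \<in> {1..?n}" for r s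
    using that by (auto simp: M_def)
  show G: "M \<in> G1 a m"
  proof (rule G1_I[OF M F _ 2])
    fix v :: "'a vec" assume v: "v \<in> carrier_vec ?n"
    have "quad_form a m (M *\<^sub>v v) = minus_form a m (\<lambda>r. \<Sum>s=1..?n. siegel \<beta> m k c r s * v $ (s - 1))"
      unfolding quad_form_def
    proof (rule minus_form_cong)
      fix r assume r: "r \<in> {1..?n}"
      show "(M *\<^sub>v v) $ (r - 1) = (\<Sum>s=1..?n. siegel \<beta> m k c r s * v $ (s - 1))"
        unfolding mult_mat_vec_eq[OF Mc v r] by (intro sum.cong refl) (simp only: ent[OF r])
    qed
    also have "\<dots> = quad_form a m v"
      unfolding quad_form_def \<beta>_def by (rule siegel_isometry[OF k supp 2])
    finally show "quad_form a m (M *\<^sub>v v) = quad_form a m v" .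
  qed
  fix i j assume ij: "i \<in> {1..?n}" "j \<in> {1..?n}"
  have "M \<in> Gplus m" using G by (simp add: G1_def)
  then have "(inv\<^bsub>GL ?n\<^esub> M) $$ (i - 1, j - 1) = M $$ (2*m+1 - (j - 1), 2*m+1 - (i - 1))"
    using ij by (intro Gplus_inverse(2)) auto
  also have "\<dots> = M $$ ((2*m+3-j) - 1, (2*m+3-i) - 1)"
    using ij by (intro arg_cong[where f = "($$) M"]) auto
  also have "\<dots> = siegel \<beta> m k c (2*m+3-j) (2*m+3-i)" using ij by (intro ent) auto
  also have "\<dots> = siegel \<beta> m k c i j"
  proof -
    have "2*m+3-(2*m+3-j) = j" "2*m+3-j = 2*m+3-i \<longleftrightarrow> i = j" "2*m+3-j = k \<longleftrightarrow> j = 2*m+3-k"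
      "2*m+3-i = 2*m+3-k \<longleftrightarrow> i = k" using ij k by auto
    then show ?thesis unfolding siegel_def by (simp add: algebra_simps)
  qed
  finally show "(inv\<^bsub>GL ?n\<^esub> M) $$ (i - 1, j - 1) = siegel \<beta> m k c i j" .
qed

text \<open>An involution because \<open>1 + 1 = 0\<close>. Counted from 0, the off-diagonal entry
  stands in row \<open>m\<close> and column \<open>m+1\<close>.\<close>

lemma L1_inverse:
  assumes 2: "\<And>z::'a::field. z + z = 0"
  shows "(L1 m :: 'a mat) \<in> carrier (GL (2*m+2))"
    and "i < 2*m+2 \<Longrightarrow> j < 2*m+2 \<Longrightarrow>
      (inv\<^bsub>GL (2*m+2)\<^esub> (L1 m :: 'a mat)) $$ (i, j) = (if i = j \<or> i = m \<and> j = m+1 then 1 else 0)"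
proof -
  let ?n = "2*m+2"
  let ?L = "mat ?n ?n (\<lambda>(i, j). if i = j \<or> i = m \<and> j = m+1 then 1 else 0 :: 'a)"
  have L: "L1 m = ?L"
  proof (rule eq_matI)
    fix i j assume "i < dim_row ?L" "j < dim_col ?L"
    then have ij: "i < ?n" "j < ?n" by auto
    let ?B = "mat_of_rows_list 2 [[1, 1], [0, 1]] :: 'a mat"
    have B: "?B $$ (x, y) = (if x = y \<or> x = 0 \<and> y = 1 then 1 else 0)" if "x < 2" "y < 2" for x y
      using that by (auto simp: mat_of_rows_list_def less_2_cases_iff)
    have entry: "L1 m $$ (i, j) = (if i < m then if j < m then 1\<^sub>m m $$ (i, j) else 0 else if j < m then 0
      else if i - m < 2 then if j - m < 2 then ?B $$ (i - m, j - m) else 0 else if j - m < 2 then 0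
      else 1\<^sub>m m $$ (i - m - 2, j - m - 2))"
      unfolding L1_def using ij by (simp add: Let_def mat_of_rows_list_def)
    have split: "k < m \<or> k = m \<or> k = m + 1 \<or> (\<exists>x. k = m + 2 + x)" for k
      by presburger
    show "L1 m $$ (i, j) = ?L $$ (i, j)"
      using ij split[of i] split[of j] unfolding entry by (elim disjE exE) (simp_all add: B)
  qed (auto simp: L1_def mat_of_rows_list_def Let_def)
  have sq: "?L * ?L = 1\<^sub>m ?n"
  proof (rule eq_matI)
    fix i j assume "i < dim_row (1\<^sub>m ?n :: 'a mat)" "j < dim_col (1\<^sub>m ?n :: 'a mat)"
    then have ij: "i < ?n" "j < ?n" by auto
    let ?f = "\<lambda>i j. if i = j \<or> i = m \<and> j = m+1 then 1 else 0 :: 'a"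
    have "(?L * ?L) $$ (i, j) = (\<Sum>l<?n. ?L $$ (i, l) * ?L $$ (l, j))"
      by (rule mat_mult_entry[OF _ _ ij]) auto
    also have "\<dots> = (\<Sum>l<?n. ?f i l * ?f l j)"
      using ij by (intro sum.cong) auto
    also have "\<dots> = (\<Sum>l<?n. (if l = i then ?f i j else 0) + (if l = m+1 then (if i = m \<and> j = m+1 then 1 else 0) else 0))"
      by (intro sum.cong) auto
    also have "\<dots> = ?f i j + (if i = m \<and> j = m+1 then 1 else 0)"
      using ij by (simp only: sum.distrib sum.delta[OF finite_lessThan]) auto
    also have "\<dots> = 1\<^sub>m ?n $$ (i, j)" using ij 2[of 1] by auto
    finally show "(?L * ?L) $$ (i, j) = 1\<^sub>m ?n $$ (i, j)" .
  qed auto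
  show "(L1 m :: 'a mat) \<in> carrier (GL ?n)" unfolding L by (rule GL_I[OF _ _ sq sq]) auto
  have "inv\<^bsub>GL ?n\<^esub> (L1 m) = ?L" unfolding L by (rule GL_inv_eqI[OF _ _ sq sq]) auto
  then show "i < ?n \<Longrightarrow> j < ?n \<Longrightarrow>
      (inv\<^bsub>GL ?n\<^esub> (L1 m :: 'a mat)) $$ (i, j) = (if i = j \<or> i = m \<and> j = m+1 then 1 else 0)" by simp
qed


subsection \<open>The invariant field\<close>

lemma is_subfield_Int: "is_subfield K \<Longrightarrow> is_subfield K' \<Longrightarrow> is_subfield (K \<inter> K')"
  by (simp add: is_subfield_def)

locale minus_type =
  fixes a :: "'a::{finite,field}" and q m :: nat
  assumes q_eq: "q = card (UNIV :: 'a set)" and even: "even q"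

sublocale minus_type \<subseteq> gf_vars "\<lambda>c::'a. to_fract (Const c)" "\<lambda>i. to_fract (Var i)" q m
  using gf_vars_ratfuns[OF q_eq even] .

section \<open>The generators of the group acting on the variables\<close>

context minus_type begin

abbreviation C :: "'a \<Rightarrow> 'a mpol fract" where "C c \<equiv> to_fract (Const c)"

abbreviation V :: "nat \<Rightarrow> 'a mpol fract" where "V i \<equiv> to_fract (Var i)"

abbreviation act :: "'a mat \<Rightarrow> 'a mpol fract \<Rightarrow> 'a mpol fract" where "act \<equiv> act_rat (2*m+2)"

lemma poly_hom_to_fract: "poly_hom (to_fract :: 'a mpol \<Rightarrow> _)"
  by (simp add: poly_hom_def)

lemma act_C: "g \<in> carrier (GL (2*m+2)) \<Longrightarrow> act g (C c) = C c"
  by (simp only: act_rat_to_fract act_poly_Const)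

lemma act_V:
  assumes "g \<in> carrier (GL (2*m+2))" "i \<in> {1..2*m+2}"
  shows "act g (V i) = (\<Sum>j=1..2*m+2. C ((inv\<^bsub>GL (2*m+2)\<^esub> g) $$ (i - 1, j - 1)) * V j)"
  unfolding act_rat_to_fract[OF assms(1)] act_poly_Var if_P[OF assms(2)]
  by (simp only: poly_homD[OF poly_hom_to_fract])

lemma row_sum_eq_lin:
  assumes i: "i \<in> {1..2*m+2}" and c: "c \<in> coefs m"
    and b: "\<And>j. j \<in> {1..2*m+2} \<Longrightarrow> b j = (if j = i then 1 else 0) + c j"
  shows "(\<Sum>j=1..2*m+2. C (b j) * V j) = V i + lin c"
proof -
  have "(\<Sum>j=1..2*m+2. C (b j) * V j) = (\<Sum>j=1..2*m+2. (if j = i then V j else 0) + C (c j) * V j)"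
    by (rule sum.cong[OF refl]) (auto simp only: b C_add distrib_right C_1 C_0 mult_1 mult_zero_left split: if_splits)
  also have "\<dots> = V i + (\<Sum>j=1..2*m+2. C (c j) * V j)"
    using i by (simp only: sum.distrib sum.delta[OF finite_atLeastAtMost] if_True)
  also have "(\<Sum>j=1..2*m+2. C (c j) * V j) = lin c"
    unfolding lin_def using c by (intro sum.mono_neutral_right) (auto simp: coefs_def C_0)
  finally show ?thesis .
qed

lemma zero_coefs: "(\<lambda>_. 0) \<in> coefs r"
  by (simp add: coefs_def)

lemma G1_GL: "g \<in> G1 a m \<Longrightarrow> g \<in> carrier (GL (2*m+2))"
  by (rule Gplus_inverse(1)) (simp add: G1_def)

lemma L1_GL: "(L1 m :: 'a mat) \<in> carrier (GL (2*m+2))"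
  by (rule L1_inverse(1)[OF two_eq_0_base])

text \<open>Row \<open>i\<close> of the inverse is a reflected column of \<open>g\<close>: entries
  beyond the diagonal vanish, and for \<open>i = m + 2\<close> the condition on
  \<open>block_F\<close> removes the coefficient of \<open>V (m+1)\<close>.\<close>

lemma act_G1:
  assumes g: "g \<in> G1 a m" and i: "i \<in> {1..m+2}"
  shows "\<exists>c\<in>coefs (min (i - 1) m). act g (V i) = V i + lin c"
proof -
  let ?n = "2*m+2"
  let ?r = "min (i - 1) m"
  let ?b = "\<lambda>j. (inv\<^bsub>GL ?n\<^esub> g) $$ (i - 1, j - 1)"
  let ?c = "\<lambda>j. if j \<in> {1..?r} then ?b j else 0"
  have gp: "g \<in> Gplus m" and F: "block_F m g = 1\<^sub>m 2" using g by (auto simp: G1_def)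
  then have low: "\<And>i j. j < ?n \<Longrightarrow> i < j \<Longrightarrow> g $$ (i, j) = 0" and diag: "\<And>i. i < ?n \<Longrightarrow> g $$ (i, i) = 1"
    by (auto simp: Gplus_def lower_unitriangular_def)
  \<comment> \<open>Counted from 0 this is the subdiagonal entry of \<open>block_F\<close>, and
    reflection in the antidiagonal leaves its position unchanged.\<close>
  have "g $$ (m + 1, m) = block_F m g $$ (1, 0)" by (simp add: block_F_def)
  then have F': "g $$ (m + 1, m) = 0" unfolding F by simp
  have "act g (V i) = (\<Sum>j=1..?n. C (?b j) * V j)"
    using i by (intro act_V G1_GL g) auto
  also have "\<dots> = V i + lin ?c"
  proof (rule row_sum_eq_lin)
    show "i \<in> {1..?n}" using i by auto
    show "?c \<in> coefs m" by (auto simp: coefs_def)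
    fix j assume j: "j \<in> {1..?n}"
    have b: "?b j = g $$ (2*m+1 - (j - 1), 2*m+1 - (i - 1))"
      using i j by (intro Gplus_inverse(2)[OF gp]) auto
    consider "j = i" | "j > i" | "j < i" "j \<le> m" | "i = m + 2" "j = m + 1" using i j by fastforce
    then show "?b j = (if j = i then 1 else 0) + ?c j"
    proof cases
      case 1
      then show ?thesis using i unfolding b by (auto simp: diag)
    next
      case 2
      then show ?thesis using i j unfolding b by (simp add: low)
    next
      case 3
      then show ?thesis using j by simp
    next
      case 4
      then have "2*m+1 - (j - 1) = m + 1" "2*m+1 - (i - 1) = m" by auto
      then have "?b j = 0" unfolding b using F' by (simp only:)
      then show ?thesis using 4 by simp
    qed
  qed
  finally show ?thesis by (intro bexI[of _ ?c]) (auto simp: coefs_def)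
qed

lemma act_L1:
  "i \<in> {1..2*m+2} \<Longrightarrow> i \<noteq> m + 1 \<Longrightarrow> act (L1 m) (V i) = V i"
  "act (L1 m) (V (m+1)) = V (m+1) + V (m+2)"
proof -
  let ?n = "2*m+2"
  note inv = L1_inverse(2)[OF two_eq_0_base, where m = m]
  have act: "act (L1 m) (V i) = (\<Sum>j=1..?n. C (if i = j \<or> i = m+1 \<and> j = m+2 then 1 else 0) * V j)"
    if "i \<in> {1..?n}" for i
    unfolding act_V[OF L1_GL that]
  proof (rule sum.cong[OF refl])
    fix j assume j: "j \<in> {1..?n}"
    then have "i - 1 < ?n" "j - 1 < ?n" using that by auto
    from inv[OF this] have "(inv\<^bsub>GL ?n\<^esub> (L1 m :: 'a mat)) $$ (i - 1, j - 1) = (if i = j \<or> i = m+1 \<and> j = m+2 then 1 else 0)"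
      using that j by auto
    then show "C ((inv\<^bsub>GL ?n\<^esub> (L1 m :: 'a mat)) $$ (i - 1, j - 1)) * V j = C (if i = j \<or> i = m+1 \<and> j = m+2 then 1 else 0) * V j"
      by (simp only:)
  qed
  show "act (L1 m) (V i) = V i" if i: "i \<in> {1..?n}" "i \<noteq> m + 1"
  proof -
    have "act (L1 m) (V i) = V i + lin (\<lambda>_. 0)"
      unfolding act[OF i(1)] by (rule row_sum_eq_lin[OF i(1) zero_coefs]) (use i(2) in auto)
    then show ?thesis by (simp only: lin_0 add_0_right)
  qed
  have m1: "m + 1 \<in> {1..?n}" by auto
  have "act (L1 m) (V (m+1)) = (\<Sum>j=1..?n. (if j = m+1 then V j else 0) + (if j = m+2 then V j else 0))"
    unfolding act[OF m1] by (intro sum.cong refl) (auto simp: C_1 C_0)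
  then show "act (L1 m) (V (m+1)) = V (m+1) + V (m+2)"
    by (simp only: sum.distrib sum.delta[OF finite_atLeastAtMost]) auto
qed

lemma lower_action_generators:
  assumes "g \<in> G1 a m \<union> {L1 m}"
  shows "lower_action (act g)"
  using assms
proof
  assume g: "g \<in> G1 a m"
  have "\<exists>c\<in>coefs (j - 1). act g (V j) = V j + lin c" if "j \<in> {1..m}" for j
    using act_G1[OF g, of j] that by (auto simp: min_def split: if_splits)
  moreover have "\<exists>c\<in>coefs m. act g (V (m+2)) = V (m+2) + lin c" "\<exists>c\<in>coefs m. act g (V (m+1)) = V (m+1) + lin c"
    using act_G1[OF g, of "m+2"] act_G1[OF g, of "m+1"] by auto
  ultimately show ?thesis
    unfolding lower_action_def using ring_endo_act_rat[OF G1_GL[OF g]] act_C[OF G1_GL[OF g]] by blast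
next
  assume "g \<in> {L1 m}"
  then have g: "g = L1 m" by simp
  have z: "\<exists>c\<in>coefs r. x = x + lin c" for r and x :: "'a mpol fract"
    using zero_coefs lin_0 by (intro bexI[of _ "\<lambda>_. 0"]) auto
  have "\<exists>c\<in>coefs (j - 1). act g (V j) = V j + lin c" if "j \<in> {1..m}" for j
    using that z[of "j - 1" "V j"] unfolding g by (subst act_L1(1)) auto
  moreover have "\<exists>c\<in>coefs m. act g (V (m+2)) = V (m+2) + lin c"
    using z[of m "V (m+2)"] unfolding g by (subst act_L1(1)) auto
  moreover have "\<exists>c\<in>coefs m. act g (V (m+1)) = V (m+1) + V (m+2) + lin c"
    using z[of m "V (m+1) + V (m+2)"] unfolding g act_L1(2) .
  ultimately show ?thesis
    unfolding lower_action_def using ring_endo_act_rat[OF L1_GL] act_C[OF L1_GL] g by blast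
qed

text \<open>Row \<open>k\<close> of \<open>siegel\<close> is the unit row plus \<open>c\<close>,
  because \<open>c\<close> vanishes at \<open>2*m+3-k\<close>. The other rows listed are unit rows
  since \<open>2*m+3-i\<close> lies outside the support of \<open>c\<close>.\<close>

lemma siegel_action:
  assumes k: "k \<in> {1..2*m+2}" and c: "c \<in> coefs m" and supp: "\<And>j. c j \<noteq> 0 \<Longrightarrow> j < k \<and> j < 2*m+3-k"
  obtains M where "M \<in> G1 a m" "act M (V k) = V k + lin c"
    "\<And>i. i \<in> {1..2*m+2} \<Longrightarrow> i \<noteq> k \<Longrightarrow> i \<le> m+2 \<or> i < k \<Longrightarrow> act M (V i) = V i"
proof -
  let ?n = "2*m+2"
  have c0: "c j = 0" if "j \<notin> {1..m}" for j using c that by (auto simp: coefs_def)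
  have supp': "j \<in> {1..m} \<and> j < k \<and> j < 2*m+3-k" if "c j \<noteq> 0" for j using supp[OF that] c0 that by blast
  let ?\<beta> = "if k = m+1 then 1 else if k = m+2 then a else 0"
  define M where "M = mat ?n ?n (\<lambda>(r, s). siegel ?\<beta> m k c (r+1) (s+1))"
  note S = siegel_in_G1[where c = c and a = a and k = k and m = m, OF k supp' two_eq_0_base, folded M_def]
  have M: "M \<in> G1 a m" by (rule S(1))
  have inv: "(inv\<^bsub>GL ?n\<^esub> M) $$ (i - 1, j - 1) = siegel ?\<beta> m k c i j"
    if "i \<in> {1..?n}" "j \<in> {1..?n}" for i j
    by (rule S(2)[OF _ that])
  have act: "act M (V i) = (\<Sum>j=1..?n. C (siegel ?\<beta> m k c i j) * V j)" if "i \<in> {1..?n}" for i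
    unfolding act_V[OF G1_GL[OF M] that] by (rule sum.cong[OF refl]) (simp only: inv[OF that])
  have ck: "c (2*m+3-k) = 0" using supp by blast
  show ?thesis
  proof (rule that)
    show "M \<in> G1 a m" by (rule M)
    show "act M (V k) = V k + lin c"
      unfolding act[OF k] by (rule row_sum_eq_lin[OF k c]) (auto simp: siegel_def ck)
    fix i assume i: "i \<in> {1..?n}" "i \<noteq> k" "i \<le> m+2 \<or> i < k"
    have "c (2*m+3-i) = 0"
    proof (rule ccontr)
      assume "c (2*m+3-i) \<noteq> 0"
      from supp'[OF this] i k show False by auto
    qed
    then have "act M (V i) = V i + lin (\<lambda>_. 0)"
      unfolding act[OF i(1)] using i by (intro row_sum_eq_lin zero_coefs) (auto simp: siegel_def)
    then show "act M (V i) = V i" by (simp add: lin_0)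
  qed
qed

text \<open>The orbit of \<open>V i\<close> is the set of all translates by the span of the first
  \<open>min (i - 1) m\<close> variables: \<open>act_G1\<close> gives one inclusion,
  \<open>siegel_action\<close> the other.\<close>

lemma to_fract_N:
  assumes i: "i \<in> {1..m+2}"
  shows "to_fract (N a m i) = NV i"
proof -
  let ?n = "2*m+2"
  let ?r = "min (i - 1) m"
  let ?A = "(\<lambda>g. act_poly ?n g (Var i)) ` G1 a m"
  have "to_fract ` ?A = (\<lambda>c. V i + lin c) ` coefs ?r"
  proof
    show "to_fract ` ?A \<subseteq> (\<lambda>c. V i + lin c) ` coefs ?r"
      using act_G1[OF _ i] G1_GL by (force simp: act_rat_to_fract)
    show "(\<lambda>c. V i + lin c) ` coefs ?r \<subseteq> to_fract ` ?A"
    proof (rule image_subsetI)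
      fix c assume c: "c \<in> coefs ?r"
      then have cm: "c \<in> coefs m" using coefs_mono[of ?r m] by auto
      have "j < i \<and> j < 2*m+3-i" if "c j \<noteq> 0" for j
      proof -
        have "j \<in> {1..?r}" using c that by (auto simp: coefs_def)
        then show ?thesis using i by auto
      qed
      moreover have "i \<in> {1..?n}" using i by auto
      ultimately obtain M where "M \<in> G1 a m" "act M (V i) = V i + lin c"
        using siegel_action[OF _ cm, of i] by metis
      then show "V i + lin c \<in> to_fract ` ?A" using G1_GL act_rat_to_fract by (metis imageI)
    qed
  qed
  moreover have "to_fract (N a m i) = \<Prod>(to_fract ` ?A)"
    unfolding N_def orbit_prod_def poly_homD(7)[OF poly_hom_to_fract]
    by (simp add: prod.reindex inj_on_def)
  moreover have "inj_on (\<lambda>c. V i + lin c) (coefs ?r)"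
  proof (rule inj_onI)
    fix c d assume "c \<in> coefs ?r" "d \<in> coefs ?r" "V i + lin c = V i + lin d"
    then have "c \<in> coefs m" "d \<in> coefs m" "lin c = lin d" using coefs_mono[of ?r m] by auto
    then show "c = d" by (rule lin_inj)
  qed
  ultimately show ?thesis unfolding NV_def L_def by (simp add: prod.reindex)
qed

lemma to_fract_h: "to_fract (h q a m k) = hV a k"
proof -
  note H = poly_homD[OF poly_hom_to_fract]
  show ?thesis
  proof (cases "k = 1")
    case True
    then show ?thesis unfolding h_def hV_def minus_form_def if_P[OF True] by (simp only: H)
  next
    case False
    then show ?thesis unfolding h_def hV_def if_not_P[OF False] by (simp only: H)
  qed
qed

lemma NV_in_VF: "i \<in> {1..m+2} \<Longrightarrow> NV i \<in> VF {1..2*m+2}"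
proof -
  assume i: "i \<in> {1..m+2}"
  have "VF {1..min (i - 1) m} \<subseteq> VF {1..2*m+2}" by (intro gen_field_mono) auto
  then have "lin c \<in> VF {1..2*m+2}" if "c \<in> coefs (min (i - 1) m)" for c
    using lin_in_VF[OF that] by auto
  moreover have "V i \<in> VF {1..2*m+2}" using i by (intro gen_field_incl) auto
  ultimately show ?thesis unfolding NV_def L_def
    by (intro is_subfield_prod[OF is_subfield_gen_field] is_subfieldD(3)[OF is_subfield_gen_field])
qed

lemma hV_in_VF: "hV a k \<in> VF {1..2*m+2}"
proof -
  note K = is_subfield_gen_field
  have C: "C x \<in> VF {1..2*m+2}" for x by (intro gen_field_incl) auto
  have V: "V i \<in> VF {1..2*m+2}" if "i \<in> {1..2*m+2}" for i using that by (intro gen_field_incl) auto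
  show ?thesis
  proof (cases "k = 1")
    case True
    show ?thesis unfolding hV_def minus_form_def if_P[OF True]
      by (intro is_subfieldD(3,4,9)[OF K] is_subfield_sum[OF K] C V) auto
  next
    case False
    show ?thesis unfolding hV_def if_not_P[OF False]
      by (intro is_subfieldD(3,4,9)[OF K] is_subfield_sum[OF K] C V) auto
  qed
qed

text \<open>The action substitutes with the inverse matrix, hence the isometry condition is placed
  on the inverse of \<open>g\<close>.\<close>

lemma hV_fixed_orthogonal:
  assumes g: "g \<in> carrier (GL (2*m+2))" and inv: "inv\<^bsub>GL (2*m+2)\<^esub> g \<in> carrier (orth_minus a m)"
  shows "act g (hV a k) = hV a k"
proof (rule hV_fixed)
  let ?n = "2*m+2"
  let ?g = "inv\<^bsub>GL ?n\<^esub> g"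
  let ?D = "\<lambda>i j. ?g $$ (i - 1, j - 1)"
  show "ring_endo (act g)" by (rule ring_endo_act_rat[OF g])
  show "act g (C x) = C x" for x by (rule act_C[OF g])
  show "act g (V i) = (\<Sum>j=1..?n. C (?D i j) * V j)" if "i \<in> {1..?n}" for i
    by (rule act_V[OF g that])
  fix z :: "nat \<Rightarrow> 'a"
  define v where "v = vec ?n (\<lambda>i. z (i + 1))"
  have v: "v \<in> carrier_vec ?n" and vz: "v $ (i - 1) = z i" if "i \<in> {1..?n}" for i
    using that by (auto simp: v_def)
  have gc: "?g \<in> carrier_mat ?n ?n" using inv by (auto simp: orth_minus_def intro: GL_closed)
  have v: "v \<in> carrier_vec ?n" by (simp add: v_def)
  have "minus_form a m (\<lambda>i. \<Sum>j=1..?n. ?D i j * z j) = quad_form a m (?g *\<^sub>v v)"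
    unfolding quad_form_def
  proof (rule minus_form_cong)
    fix i assume i: "i \<in> {1..?n}"
    show "(\<Sum>j=1..?n. ?D i j * z j) = (?g *\<^sub>v v) $ (i - 1)"
      unfolding mult_mat_vec_eq[OF gc v i] by (rule sum.cong[OF refl]) (simp only: vz)
  qed
  also have "\<dots> = quad_form a m v" using inv v by (simp add: orth_minus_def)
  also have "\<dots> = minus_form a m z" unfolding quad_form_def by (rule minus_form_cong) (rule vz)
  finally show "minus_form a m (\<lambda>i. \<Sum>j=1..?n. ?D i j * z j) = minus_form a m z" .
qed

end

theorem theorem4p22:
  fixes a :: "'a::{finite, field}" and q m :: nat and G :: "'a mat set"
  assumes "q = card (UNIV :: 'a set)" and "even q"
    and "m \<ge> 1"
    and "Factorial_Ring.irreducible [:a, 1, 1:]"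
    and "G = generate (GL (2*m+2)) (G1 a m \<union> {L1 m})"
    and "is_sylow_subgroup 2 (orth_minus a m) G"
  shows "invariant_field (2*m+2) G =
    field_generated_by (to_fract `
      ({Var 1} \<union> N a m ` {2..m}
       \<union> {N a m (m+1) ^ 2 + N a m (m+2) * N a m (m+1), N a m (m+2)}
       \<union> h q a m ` {1..m}))"
proof -
  interpret minus_type a q m using assms(1,2) by unfold_locales
  interpret GL: group "GL (2*m+2) :: 'a mat monoid" by (rule group_GL)
  let ?n = "2*m+2"
  let ?Z = "NV (m+1) ^ 2 + NV (m+2) * NV (m+1)"
  define E where "E = range C \<union> ({V 1} \<union> NV ` {2..m} \<union> {?Z, NV (m+2)} \<union> hV a ` {1..m})"
  have "to_fract ` ({Var 1} \<union> N a m ` {2..m} \<union> {N a m (m+1) ^ 2 + N a m (m+2) * N a m (m+1), N a m (m+2)}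
       \<union> h q a m ` {1..m}) = {V 1} \<union> NV ` {2..m} \<union> {?Z, NV (m+2)} \<union> hV a ` {1..m}"
  proof -
    have "to_fract ` (N a m ` {2..m}) = NV ` {2..m}"
      unfolding image_image by (rule image_cong[OF refl]) (rule to_fract_N, auto)
    moreover have "to_fract ` (h q a m ` {1..m}) = hV a ` {1..m}"
      unfolding image_image by (simp only: to_fract_h)
    moreover have "to_fract (N a m (m+1)) = NV (m+1)" "to_fract (N a m (m+2)) = NV (m+2)"
      by (rule to_fract_N; simp)+
    ultimately show ?thesis
      by (simp only: image_Un image_insert image_empty poly_homD[OF poly_hom_to_fract])
  qed
  then have rhs: "field_generated_by (to_fract ` ({Var 1} \<union> N a m ` {2..m}
      \<union> {N a m (m+1) ^ 2 + N a m (m+2) * N a m (m+1), N a m (m+2)} \<union> h q a m ` {1..m})) = gen_field E"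
    by (simp only: field_generated_by_def E_def)
  have gens: "G1 a m \<union> {L1 m} \<subseteq> carrier (GL ?n)" using G1_GL L1_GL by auto
  have GGL: "G \<subseteq> carrier (GL ?n)"
    unfolding assms(5) using GL.generate_in_carrier[OF gens] by auto
  \<comment> \<open>The Sylow hypothesis places \<open>G\<close> inside the orthogonal group, which
    yields the invariance of the \<open>hV a k\<close>.\<close>
  have Gorth: "G \<subseteq> carrier (orth_minus a m)"
    using assms(6) by (auto simp: is_sylow_subgroup_def dest: subgroup.subset)
  have Ginv: "inv\<^bsub>GL ?n\<^esub> g \<in> G" if "g \<in> G" for g
    using subgroup.m_inv_closed[OF GL.generate_is_subgroup[OF gens]] that unfolding assms(5) by blast
  have incl: "g \<in> G" if "g \<in> G1 a m \<union> {L1 m}" for g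
    unfolding assms(5) using that by (rule generate.incl)
  \<comment> \<open>Orbit products are checked on the generators of \<open>G\<close>, the elements
    \<open>hV a k\<close> on all of \<open>G\<close> at once.\<close>
  have fixE: "act g x = x" if g: "g \<in> G" and x: "x \<in> E" for g x
  proof -
    have NVfix: "act g (NV i) = NV i" if "i \<in> insert (m+2) {1..m}" for i
      by (rule act_rat_fixed_generate[OF gens NV_fixed[OF lower_action_generators that]])
        (use g assms(5) in simp_all)
    have Zfix: "act g ?Z = ?Z"
      by (rule act_rat_fixed_generate[OF gens NV_quadratic_fixed[OF lower_action_generators]])
        (use g assms(5) in simp_all)
    from x consider "x \<in> range C" | "x = V 1" | "x \<in> NV ` {2..m}" | "x = NV (m+2)" | "x = ?Z" | "x \<in> hV a ` {1..m}"
      unfolding E_def by blast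
    then show ?thesis
    proof cases
      case 1
      then show ?thesis using act_C g GGL by blast
    next
      case 2
      then have x: "x = NV 1" by (simp add: NV_def L_0)
      show ?thesis unfolding x by (rule NVfix) (use assms(3) in auto)
    next
      case 3
      then obtain i where x: "x = NV i" "i \<in> {2..m}" by auto
      show ?thesis unfolding x(1) by (rule NVfix) (use x(2) in auto)
    next
      case 4
      show ?thesis unfolding 4 by (rule NVfix) auto
    next
      case 5
      show ?thesis unfolding 5 by (rule Zfix)
    next
      case 6
      then show ?thesis using hV_fixed_orthogonal g GGL Gorth Ginv by blast
    qed
  qed
  have EV: "E \<subseteq> VF {1..?n}"
  proof -
    note K = is_subfield_gen_field
    have 1: "range C \<subseteq> VF {1..?n}" "V 1 \<in> VF {1..?n}" by (auto intro!: gen_field_incl)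
    have 2: "NV (m+1) \<in> VF {1..?n}" "NV (m+2) \<in> VF {1..?n}" by (rule NV_in_VF; simp)+
    have 3: "?Z \<in> VF {1..?n}" by (intro is_subfieldD(3,4,9)[OF K] 2)
    have 4: "NV ` {2..m} \<subseteq> VF {1..?n}" by (rule image_subsetI, rule NV_in_VF) auto
    have 5: "hV a ` {1..m} \<subseteq> VF {1..?n}" by (rule image_subsetI, rule hV_in_VF)
    show ?thesis
      unfolding E_def by (intro Un_least insert_subsetI 1 2 3 4 5 empty_subsetI)
  qed
  have "gen_field E \<subseteq> invariant_field ?n G"
  proof -
    have "is_subfield (ratfuns ?n \<inter> {x. \<forall>\<sigma>\<in>act ` G. \<sigma> x = x})"
      unfolding ratfuns_eq_gen_field using ring_endo_act_rat GGL
      by (intro is_subfield_Int is_subfield_gen_field is_subfield_fixed) blast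
    then have "gen_field E \<subseteq> ratfuns ?n \<inter> {x. \<forall>\<sigma>\<in>act ` G. \<sigma> x = x}"
      by (rule gen_field_least) (use EV fixE in \<open>auto simp: ratfuns_eq_gen_field\<close>)
    then show ?thesis unfolding invariant_field_def by auto
  qed
  moreover have "invariant_field ?n G \<subseteq> gen_field E"
  proof
    fix f assume f: "f \<in> invariant_field ?n G"
    show "f \<in> gen_field E"
    proof (rule invariants_generated[where \<Gamma> = "act ` G" and a = a])
      show "ring_endo \<sigma>" if "\<sigma> \<in> act ` G" for \<sigma> using that ring_endo_act_rat GGL by blast
      show "\<sigma> x = x" if "\<sigma> \<in> act ` G" "x \<in> E" for \<sigma> x using that fixE by blast
      show "\<sigma> f = f" if "\<sigma> \<in> act ` G" for \<sigma> using that f by (auto simp: invariant_field_def)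
      have "VF {1..?n} \<subseteq> gen_field (E \<union> V ` {1..?n})" by (rule gen_field_mono) (auto simp: E_def)
      then show "f \<in> gen_field (E \<union> V ` {1..?n})"
        using f by (auto simp: invariant_field_def ratfuns_eq_gen_field)
      fix k c assume k: "k \<in> {1..?n}" and c: "c \<in> coefs m" and supp: "\<And>j. c j \<noteq> 0 \<Longrightarrow> j < k \<and> j < 2*m+3-k"
      from siegel_action[OF k c supp] obtain M where "M \<in> G1 a m" "act M (V k) = V k + lin c"
        "\<And>i. i \<in> {1..?n} \<Longrightarrow> i \<noteq> k \<Longrightarrow> i \<le> m+2 \<or> i < k \<Longrightarrow> act M (V i) = V i" by blast
      then show "\<exists>\<sigma>\<in>act ` G. \<sigma> (V k) = V k + lin c \<and> (\<forall>r\<in>{1..?n}. r \<noteq> k \<and> (r \<le> m+2 \<or> r < k) \<longrightarrow> \<sigma> (V r) = V r)"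
        using incl by (intro bexI[of _ "act M"]) auto
    next
      fix c assume c: "c \<in> coefs m"
      have "j < m+1 \<and> j < 2*m+3-(m+1)" if "c j \<noteq> 0" for j
      proof -
        have "j \<in> {1..m}" using c that by (auto simp: coefs_def)
        then show ?thesis by auto
      qed
      \<comment> \<open>The required element is \<open>L1 m * M\<close>: here \<open>M\<close>
        shifts \<open>V (m+1)\<close> by \<open>lin c\<close>, and \<open>L1 m\<close> adds
        \<open>V (m+2)\<close> and fixes \<open>lin c\<close>.\<close>
      from siegel_action[OF _ c this] obtain M where M: "M \<in> G1 a m" "act M (V (m+1)) = V (m+1) + lin c"
        "\<And>i. i \<in> {1..?n} \<Longrightarrow> i \<noteq> m+1 \<Longrightarrow> i \<le> m+2 \<or> i < m+1 \<Longrightarrow> act M (V i) = V i" by auto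
      note S = ring_endoD[OF ring_endo_act_rat[OF L1_GL]]
      have lin: "act (L1 m) (lin c) = lin c"
        unfolding lin_def S
      proof (rule sum.cong[OF refl])
        fix j assume "j \<in> {1..m}"
        then have j: "j \<in> {1..?n}" "j \<noteq> m+1" by auto
        show "act (L1 m) (C (c j)) * act (L1 m) (V j) = C (c j) * V j"
          unfolding act_C[OF L1_GL] act_L1(1)[OF j] ..
      qed
      have comp: "act (L1 m * M) x = act (L1 m) (act M x)" for x
        by (rule act_rat_mult[OF L1_GL G1_GL[OF M(1)]])
      have "L1 m * M \<in> G"
        using generate.eng[of "L1 m" "GL ?n" "G1 a m \<union> {L1 m}" M] incl[of "L1 m"] incl[of M] M(1)
        unfolding assms(5) by (simp add: GL_simps)
      moreover have "act (L1 m * M) (V (m+1)) = V (m+1) + V (m+2) + lin c"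
        unfolding comp M(2) S lin act_L1(2) ..
      moreover have "act (L1 m * M) (V r) = V r" if "r \<in> insert (m+2) {1..m}" for r
      proof -
        have r: "r \<in> {1..?n}" "r \<noteq> m+1" "r \<le> m+2" using that by auto
        show ?thesis unfolding comp M(3)[OF r(1,2) disjI1[OF r(3)]] act_L1(1)[OF r(1,2)] ..
      qed
      ultimately show "\<exists>\<sigma>\<in>act ` G. \<sigma> (V (m+1)) = V (m+1) + V (m+2) + lin c \<and> (\<forall>r\<in>insert (m+2) {1..m}. \<sigma> (V r) = V r)"
        by blast
    qed (auto simp: E_def)
  qed
  ultimately show ?thesis unfolding rhs by blast
qed

end
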